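(* Let $\mathbf{C}$ be a stiff category. Then $\mathbf{C}$ has universal joins (respectively universal finite joins, universal directed joins) of subunits if and only if for each idempotent (respectively idempotent and finitely bounded, idempotent and directed) $U \subseteq \mathrm{ISub}(\mathbf{C})$: \begin{itemize} \item the diagram $D(U,X)$ has a colimit for each object $X$; \item the canonical morphism $\mathrm{colim}\, D(U,I) \to I$ is monic; \item the canonical morphism $\mathrm{colim}\, D(U,X) \to (\mathrm{colim}\, D(U,I)) \otimes X$ is invertible for each object $X$. \end{itemize}
   Context: An object name also denotes its identity morphism, and coherence isomorphisms are suppressed, so $s \otimes X$ also denotes the map $S \otimes X \to X$. Let $\mathbf{C}$ be braided monoidal with tensor unit $I$. A subunit is a subobject $s \colon S \rightarrowtail I$ such that $s \otimes S \colon S \otimes S \to I \otimes S$ is an isomorphism; $\mathrm{ISub}(\mathbf{C})$ is the collection of subunits, ordered as subobjects (size issues are disregarded). $\mathbf{C}$ is stiff when for all objects $X$ and subunits $s,t$ the square with top $s \otimes T \otimes X \colon S \otimes T \otimes X \to T \otimes X$, left $S \otimes t \otimes X \colon S \otimes T \otimes X \to S \otimes X$, right $t \otimes X \colon T \otimes X \to X$ and bottom $s \otimes X \colon S \otimes X \to X$ is a pullback of monomorphisms. Then $\mathrm{ISub}(\mathbf{C})$ is a meet-semilattice with $s \wedge t = \lambda_I \circ (s \otimes t)$. For $U \subseteq \mathrm{ISub}(\mathbf{C})$ and an object $X$, $D(U,X)$ is the diagram of objects $S \otimes X$ for $s \in U$ and all morphisms $f \colon S \otimes X \to T \otimes X$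 with $(t \otimes X) \circ f = s \otimes X$. $U$ is idempotent when $U = \{s \wedge t \mid s,t \in U\}$; directed when for any $a,b \in U$ there is $c \in U$ with $a \le c \ge b$; finitely bounded when it has a finite set of maximal elements, in the sense that each element of $U$ lies below one of finitely many maximal elements of $U$ (for $U$ downward closed: $U$ is the downset generated by finitely many elements). Canonical morphisms: write $c_s^X \colon S \otimes X \to \mathrm{colim}\, D(U,X)$ for the colimit cocone (with $c^I_s \colon S \to \mathrm{colim}\, D(U,I)$). The map $\mathrm{colim}\, D(U,I) \to I$ is the unique one whose composite with $c_s^I$ is $s$ for all $s \in U$. The map $\mathrm{colim}\, D(U,X) \to (\mathrm{colim}\, D(U,I)) \otimes X$ is the unique one whose composite with $c_s^X$ is $c_s^I \otimes X$ for all $s \in U$ (in a stiff category the maps $c_s^I \otimes X$ do form a cocone over $D(U,X)$ for idempotent $U$). Universal joins: $\mathbf{C}$ has universal finite joins of subunits when it has an initial object $0$ whose morphism $0 \to I$ is monic, with $X \otimes 0 \simeq 0$ for all objects $X$, and $\mathrm{ISub}(\mathbf{C})$ has finite joins such that for all subunits $s,t$ and objects $X$ the square of canonical inclusions $S \otimes T \otimes X \to S \otimes X \to (S \vee T) \otimes X$, $S \otimes T \otimes X \to T \otimes X \to (S \vee T)\otimes X$ is both a pullback and a pushout of monomorphisms. A stiff category $\mathbf{C}$ has universal directed joins of subunits when it has directed colimits of subunits (colimits of diagrams indexed by a directed poset all of whose arrows are inclusions $S_i \rightarrowtail S_j$ between subunits $s_i \colon S_i \rightarrowtail I$), each of whose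 induced arrows $\mathrm{colim}\, S_i \to I$ is again a subunit, and these colimits are preserved by each functor $X \otimes (-)$. $\mathbf{C}$ has universal joins of subunits when it is locale-based: it is stiff, $\mathrm{ISub}(\mathbf{C})$ is a frame, and the canonical maps $S \otimes X \to (\bigvee U) \otimes X$ form a colimit of $D(U,X)$ for each idempotent $U \subseteq \mathrm{ISub}(\mathbf{C})$ and object $X$. *)

theory Defs
  imports "HOL-Algebra.Complete_Lattice"
begin

section \<open>Categories\<close>

record ('o, 'a) category =
  Obj :: "'o set"
  Arr :: "'a set"
  Dom :: "'a \<Rightarrow> 'o"
  Cod :: "'a \<Rightarrow> 'o"
  Id :: "'o \<Rightarrow> 'a"
  Comp :: "'a \<Rightarrow> 'a \<Rightarrow> 'a" (infixr \<open>\<cdot>\<index>\<close> 70)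

definition Hom :: "('o, 'a, 'x) category_scheme \<Rightarrow> 'o \<Rightarrow> 'o \<Rightarrow> 'a set" where
  "Hom C X Y = {f \<in> Arr C. Dom C f = X \<and> Cod C f = Y}"

locale category =
  fixes C :: "('o, 'a, 'x) category_scheme" (structure)
  assumes Dom_in_Obj: "f \<in> Arr C \<Longrightarrow> Dom C f \<in> Obj C"
    and Cod_in_Obj: "f \<in> Arr C \<Longrightarrow> Cod C f \<in> Obj C"
    and Id_in_Hom: "X \<in> Obj C \<Longrightarrow> Id C X \<in> Hom C X X"
    and Comp_in_Hom: "\<lbrakk>f \<in> Hom C X Y; g \<in> Hom C Y Z\<rbrakk> \<Longrightarrow> g \<cdot> f \<in> Hom C X Z"
    and Comp_Id: "f \<in> Hom C X Y \<Longrightarrow> f \<cdot> Id C X = f"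
    and Id_Comp: "f \<in> Hom C X Y \<Longrightarrow> Id C Y \<cdot> f = f"
    and Comp_assoc:
      "\<lbrakk>f \<in> Hom C W X; g \<in> Hom C X Y; h \<in> Hom C Y Z\<rbrakk> \<Longrightarrow> (h \<cdot> g) \<cdot> f = h \<cdot> (g \<cdot> f)"

definition monic :: "('o, 'a, 'x) category_scheme \<Rightarrow> 'a \<Rightarrow> bool" where
  "monic C m \<longleftrightarrow> m \<in> Arr C \<and>
     (\<forall>W\<in>Obj C. \<forall>f\<in>Hom C W (Dom C m). \<forall>g\<in>Hom C W (Dom C m).
        m \<cdot>\<^bsub>C\<^esub> f = m \<cdot>\<^bsub>C\<^esub> g \<longrightarrow> f = g)"

definition inverse_arrows :: "('o, 'a, 'x) category_scheme \<Rightarrow> 'a \<Rightarrow> 'a \<Rightarrow> bool" where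
  "inverse_arrows C f g \<longleftrightarrow> f \<in> Arr C \<and> g \<in> Hom C (Cod C f) (Dom C f) \<and>
     g \<cdot>\<^bsub>C\<^esub> f = Id C (Dom C f) \<and> f \<cdot>\<^bsub>C\<^esub> g = Id C (Cod C f)"

definition is_iso :: "('o, 'a, 'x) category_scheme \<Rightarrow> 'a \<Rightarrow> bool" where
  "is_iso C f \<longleftrightarrow> (\<exists>g. inverse_arrows C f g)"

definition Inv :: "('o, 'a, 'x) category_scheme \<Rightarrow> 'a \<Rightarrow> 'a" where
  "Inv C f = (THE g. inverse_arrows C f g)"

definition isomorphic :: "('o, 'a, 'x) category_scheme \<Rightarrow> 'o \<Rightarrow> 'o \<Rightarrow> bool" where
  "isomorphic C X Y \<longleftrightarrow> (\<exists>f\<in>Hom C X Y. is_iso C f)"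

definition initial :: "('o, 'a, 'x) category_scheme \<Rightarrow> 'o \<Rightarrow> bool" where
  "initial C Z \<longleftrightarrow> Z \<in> Obj C \<and> (\<forall>X\<in>Obj C. \<exists>!f. f \<in> Hom C Z X)"

text \<open>
  Both predicates refer to the square with top \<open>p\<close>, left \<open>q\<close>, right \<open>f\<close> and bottom \<open>g\<close>,
  that is, \<open>f \<cdot> p = g \<cdot> q\<close>.
\<close>

definition commuting_square ::
  "('o, 'a, 'x) category_scheme \<Rightarrow> 'a \<Rightarrow> 'a \<Rightarrow> 'a \<Rightarrow> 'a \<Rightarrow> bool" where
  "commuting_square C p q f g \<longleftrightarrow>
     p \<in> Arr C \<and> q \<in> Arr C \<and> f \<in> Arr C \<and> g \<in> Arr C \<and>
     Dom C p = Dom C q \<and> Cod C p = Dom C f \<and> Cod C q = Dom C g \<and> Cod C f = Cod C g \<and>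
     f \<cdot>\<^bsub>C\<^esub> p = g \<cdot>\<^bsub>C\<^esub> q"

definition is_pullback ::
  "('o, 'a, 'x) category_scheme \<Rightarrow> 'a \<Rightarrow> 'a \<Rightarrow> 'a \<Rightarrow> 'a \<Rightarrow> bool" where
  "is_pullback C p q f g \<longleftrightarrow> commuting_square C p q f g \<and>
     (\<forall>p' q'. commuting_square C p' q' f g \<longrightarrow>
        (\<exists>!u. u \<in> Hom C (Dom C p') (Dom C p) \<and> p \<cdot>\<^bsub>C\<^esub> u = p' \<and> q \<cdot>\<^bsub>C\<^esub> u = q'))"

definition is_pushout ::
  "('o, 'a, 'x) category_scheme \<Rightarrow> 'a \<Rightarrow> 'a \<Rightarrow> 'a \<Rightarrow> 'a \<Rightarrow> bool" where
  "is_pushout C p q f g \<longleftrightarrow> commuting_square C p q f g \<and>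
     (\<forall>f' g'. commuting_square C p q f' g' \<longrightarrow>
        (\<exists>!u. u \<in> Hom C (Cod C f) (Cod C f') \<and> u \<cdot>\<^bsub>C\<^esub> f = f' \<and> u \<cdot>\<^bsub>C\<^esub> g = g'))"


section \<open>Diagrams and colimits\<close>

text \<open>
  A diagram is a graph with vertices labelled by objects and edges labelled by arrows.  The colimit
  of a functor is the colimit of its underlying graph, so no composition of edges is recorded.
\<close>

record ('i, 'o, 'a) diagram =
  Node :: "'i set"
  Vertex :: "'i \<Rightarrow> 'o"
  Edge :: "('i \<times> 'a \<times> 'i) set"

definition is_cocone ::
  "('o, 'a, 'x) category_scheme \<Rightarrow> ('i, 'o, 'a) diagram \<Rightarrow> 'o \<Rightarrow> ('i \<Rightarrow> 'a) \<Rightarrow> bool" where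
  "is_cocone C D L c \<longleftrightarrow> L \<in> Obj C \<and>
     (\<forall>i\<in>Node D. c i \<in> Hom C (Vertex D i) L) \<and>
     (\<forall>(i, f, j)\<in>Edge D. c j \<cdot>\<^bsub>C\<^esub> f = c i)"

definition is_colimit ::
  "('o, 'a, 'x) category_scheme \<Rightarrow> ('i, 'o, 'a) diagram \<Rightarrow> 'o \<Rightarrow> ('i \<Rightarrow> 'a) \<Rightarrow> bool" where
  "is_colimit C D L c \<longleftrightarrow> is_cocone C D L c \<and>
     (\<forall>L' c'. is_cocone C D L' c' \<longrightarrow>
        (\<exists>!u. u \<in> Hom C L L' \<and> (\<forall>i\<in>Node D. u \<cdot>\<^bsub>C\<^esub> c i = c' i)))"


section \<open>Braided monoidal categories\<close>

record ('o, 'a) braided_data = "('o, 'a) category" +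
  Unit :: 'o
  TensorO :: "'o \<Rightarrow> 'o \<Rightarrow> 'o" (infixr \<open>\<otimes>\<index>\<close> 75)
  TensorA :: "'a \<Rightarrow> 'a \<Rightarrow> 'a" (infixr \<open>\<star>\<index>\<close> 75)
  Assoc :: "'o \<Rightarrow> 'o \<Rightarrow> 'o \<Rightarrow> 'a"
  Lunit :: "'o \<Rightarrow> 'a"
  Runit :: "'o \<Rightarrow> 'a"
  Braid :: "'o \<Rightarrow> 'o \<Rightarrow> 'a"

locale braided_monoidal_category = category C
  for C :: "('o, 'a) braided_data" (structure) +
  assumes Unit_in_Obj: "Unit C \<in> Obj C"
    and TensorO_in_Obj: "\<lbrakk>X \<in> Obj C; Y \<in> Obj C\<rbrakk> \<Longrightarrow> X \<otimes> Y \<in> Obj C"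
    and TensorA_in_Hom:
      "\<lbrakk>f \<in> Hom C X X'; g \<in> Hom C Y Y'\<rbrakk> \<Longrightarrow> f \<star> g \<in> Hom C (X \<otimes> Y) (X' \<otimes> Y')"
    and TensorA_Id: "\<lbrakk>X \<in> Obj C; Y \<in> Obj C\<rbrakk> \<Longrightarrow> Id C X \<star> Id C Y = Id C (X \<otimes> Y)"
    and TensorA_Comp:
      "\<lbrakk>f \<in> Hom C X X'; f' \<in> Hom C X' X''; g \<in> Hom C Y Y'; g' \<in> Hom C Y' Y''\<rbrakk>
        \<Longrightarrow> (f' \<cdot> f) \<star> (g' \<cdot> g) = (f' \<star> g') \<cdot> (f \<star> g)"
    and Assoc_in_Hom:
      "\<lbrakk>X \<in> Obj C; Y \<in> Obj C; Z \<in> Obj C\<rbrakk>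
        \<Longrightarrow> Assoc C X Y Z \<in> Hom C ((X \<otimes> Y) \<otimes> Z) (X \<otimes> (Y \<otimes> Z))"
    and Assoc_iso: "\<lbrakk>X \<in> Obj C; Y \<in> Obj C; Z \<in> Obj C\<rbrakk> \<Longrightarrow> is_iso C (Assoc C X Y Z)"
    and Assoc_natural:
      "\<lbrakk>f \<in> Hom C X X'; g \<in> Hom C Y Y'; h \<in> Hom C Z Z'\<rbrakk>
        \<Longrightarrow> Assoc C X' Y' Z' \<cdot> ((f \<star> g) \<star> h) = (f \<star> (g \<star> h)) \<cdot> Assoc C X Y Z"
    and Lunit_in_Hom: "X \<in> Obj C \<Longrightarrow> Lunit C X \<in> Hom C (Unit C \<otimes> X) X"
    and Lunit_iso: "X \<in> Obj C \<Longrightarrow> is_iso C (Lunit C X)"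
    and Lunit_natural:
      "f \<in> Hom C X Y \<Longrightarrow> Lunit C Y \<cdot> (Id C (Unit C) \<star> f) = f \<cdot> Lunit C X"
    and Runit_in_Hom: "X \<in> Obj C \<Longrightarrow> Runit C X \<in> Hom C (X \<otimes> Unit C) X"
    and Runit_iso: "X \<in> Obj C \<Longrightarrow> is_iso C (Runit C X)"
    and Runit_natural:
      "f \<in> Hom C X Y \<Longrightarrow> Runit C Y \<cdot> (f \<star> Id C (Unit C)) = f \<cdot> Runit C X"
    and pentagon:
      "\<lbrakk>W \<in> Obj C; X \<in> Obj C; Y \<in> Obj C; Z \<in> Obj C\<rbrakk>
        \<Longrightarrow> (Id C W \<star> Assoc C X Y Z) \<cdot> Assoc C W (X \<otimes> Y) Z \<cdot> (Assoc C W X Y \<star> Id C Z)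
          = Assoc C W X (Y \<otimes> Z) \<cdot> Assoc C (W \<otimes> X) Y Z"
    and triangle:
      "\<lbrakk>X \<in> Obj C; Y \<in> Obj C\<rbrakk>
        \<Longrightarrow> (Id C X \<star> Lunit C Y) \<cdot> Assoc C X (Unit C) Y = Runit C X \<star> Id C Y"
    and Braid_in_Hom: "\<lbrakk>X \<in> Obj C; Y \<in> Obj C\<rbrakk> \<Longrightarrow> Braid C X Y \<in> Hom C (X \<otimes> Y) (Y \<otimes> X)"
    and Braid_iso: "\<lbrakk>X \<in> Obj C; Y \<in> Obj C\<rbrakk> \<Longrightarrow> is_iso C (Braid C X Y)"
    and Braid_natural:
      "\<lbrakk>f \<in> Hom C X X'; g \<in> Hom C Y Y'\<rbrakk>
        \<Longrightarrow> Braid C X' Y' \<cdot> (f \<star> g) = (g \<star> f) \<cdot> Braid C X Y"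
    and hexagon1:
      "\<lbrakk>X \<in> Obj C; Y \<in> Obj C; Z \<in> Obj C\<rbrakk>
        \<Longrightarrow> Assoc C Y Z X \<cdot> Braid C X (Y \<otimes> Z) \<cdot> Assoc C X Y Z
          = (Id C Y \<star> Braid C X Z) \<cdot> Assoc C Y X Z \<cdot> (Braid C X Y \<star> Id C Z)"
    and hexagon2:
      "\<lbrakk>X \<in> Obj C; Y \<in> Obj C; Z \<in> Obj C\<rbrakk>
        \<Longrightarrow> Inv C (Assoc C Z X Y) \<cdot> Braid C (X \<otimes> Y) Z \<cdot> Inv C (Assoc C X Y Z)
          = (Braid C X Z \<star> Id C Y) \<cdot> Inv C (Assoc C X Z Y) \<cdot> (Id C X \<star> Braid C Y Z)"


section \<open>Subunits\<close>

text \<open>For \<open>s : S \<rightarrow> I\<close>, this is the map \<open>s \<otimes> X : S \<otimes> X \<rightarrow> X\<close>, with its unitor made explicit.\<close>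

definition unit_act :: "('o, 'a) braided_data \<Rightarrow> 'a \<Rightarrow> 'o \<Rightarrow> 'a" where
  "unit_act C s X = Lunit C X \<cdot>\<^bsub>C\<^esub> (s \<star>\<^bsub>C\<^esub> Id C X)"

definition subunit :: "('o, 'a) braided_data \<Rightarrow> 'a \<Rightarrow> bool" where
  "subunit C s \<longleftrightarrow> monic C s \<and> Cod C s = Unit C \<and> is_iso C (s \<star>\<^bsub>C\<^esub> Id C (Dom C s))"

text \<open>
  Subobjects are represented by monomorphisms: the carrier consists of the monomorphisms that
  represent a subunit, and the equality \<open>.=\<close> of the structure is equality of subobjects.
\<close>

definition ISub :: "('o, 'a) braided_data \<Rightarrow> 'a gorder" where
  "ISub C = \<lparr>carrier = {s. subunit C s},
     eq = (\<lambda>s t. \<exists>f\<in>Hom C (Dom C s) (Dom C t). is_iso C f \<and> t \<cdot>\<^bsub>C\<^esub> f = s),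
     le = (\<lambda>s t. \<exists>f\<in>Hom C (Dom C s) (Dom C t). t \<cdot>\<^bsub>C\<^esub> f = s)\<rparr>"

text \<open>The inclusion \<open>S \<rightarrow> T\<close> witnessing \<open>s \<le> t\<close>; it is unique because \<open>t\<close> is monic.\<close>

definition incl :: "('o, 'a) braided_data \<Rightarrow> 'a \<Rightarrow> 'a \<Rightarrow> 'a" where
  "incl C s t = (THE f. f \<in> Hom C (Dom C s) (Dom C t) \<and> t \<cdot>\<^bsub>C\<^esub> f = s)"

definition sub_meet :: "('o, 'a) braided_data \<Rightarrow> 'a \<Rightarrow> 'a \<Rightarrow> 'a" where
  "sub_meet C s t = Lunit C (Unit C) \<cdot>\<^bsub>C\<^esub> (s \<star>\<^bsub>C\<^esub> t)"

text \<open>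
  With \<open>S \<otimes> T \<otimes> X\<close> bracketed as \<open>S \<otimes> (T \<otimes> X)\<close>, no associator is needed in the square.
\<close>

definition stiff :: "('o, 'a) braided_data \<Rightarrow> bool" where
  "stiff C \<longleftrightarrow> (\<forall>X\<in>Obj C. \<forall>s t. subunit C s \<and> subunit C t \<longrightarrow>
     (let p = unit_act C s (Dom C t \<otimes>\<^bsub>C\<^esub> X);
          q = Id C (Dom C s) \<star>\<^bsub>C\<^esub> unit_act C t X;
          f = unit_act C t X;
          g = unit_act C s X
      in is_pullback C p q f g \<and> monic C p \<and> monic C q \<and> monic C f \<and> monic C g))"

locale stiff_category = braided_monoidal_category +
  assumes stiff: "stiff C"


section \<open>The diagrams \<open>D(U, X)\<close>\<close>

definition subunit_diagram ::
  "('o, 'a) braided_data \<Rightarrow> 'a set \<Rightarrow> 'o \<Rightarrow> ('a, 'o, 'a) diagram" where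
  "subunit_diagram C U X = \<lparr>Node = U,
     Vertex = (\<lambda>s. Dom C s \<otimes>\<^bsub>C\<^esub> X),
     Edge = {(s, f, t). s \<in> U \<and> t \<in> U \<and> f \<in> Hom C (Dom C s \<otimes>\<^bsub>C\<^esub> X) (Dom C t \<otimes>\<^bsub>C\<^esub> X) \<and>
       unit_act C t X \<cdot>\<^bsub>C\<^esub> f = unit_act C s X}\<rparr>"

definition meet_idempotent :: "('o, 'a) braided_data \<Rightarrow> 'a set \<Rightarrow> bool" where
  "meet_idempotent C U \<longleftrightarrow> U {.=}\<^bsub>ISub C\<^esub> {sub_meet C s t | s t. s \<in> U \<and> t \<in> U}"

text \<open>Nonemptiness is not required, neither for sets of subunits nor for index posets below.\<close>

definition directed :: "('b, 'x) gorder_scheme \<Rightarrow> 'b set \<Rightarrow> bool" where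
  "directed L U \<longleftrightarrow> (\<forall>a\<in>U. \<forall>b\<in>U. \<exists>c\<in>U. a \<sqsubseteq>\<^bsub>L\<^esub> c \<and> b \<sqsubseteq>\<^bsub>L\<^esub> c)"

definition finitely_bounded :: "('b, 'x) gorder_scheme \<Rightarrow> 'b set \<Rightarrow> bool" where
  "finitely_bounded L U \<longleftrightarrow> (\<exists>M\<subseteq>U. finite M \<and>
     (\<forall>m\<in>M. \<forall>u\<in>U. m \<sqsubseteq>\<^bsub>L\<^esub> u \<longrightarrow> u .=\<^bsub>L\<^esub> m) \<and> (\<forall>u\<in>U. \<exists>m\<in>M. u \<sqsubseteq>\<^bsub>L\<^esub> m))"

text \<open>
  The maps \<open>c\<^sub>s\<^sup>I : S \<rightarrow> colim D(U, I)\<close>, obtained from the cocone maps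
  \<open>d s : S \<otimes> I \<rightarrow> colim D(U, I)\<close> by removing the unitor.
\<close>

definition unit_leg :: "('o, 'a) braided_data \<Rightarrow> ('a \<Rightarrow> 'a) \<Rightarrow> 'a \<Rightarrow> 'a" where
  "unit_leg C d s = d s \<cdot>\<^bsub>C\<^esub> Inv C (Runit C (Dom C s))"

definition canonical_to_unit ::
  "('o, 'a) braided_data \<Rightarrow> 'a set \<Rightarrow> 'o \<Rightarrow> ('a \<Rightarrow> 'a) \<Rightarrow> 'a \<Rightarrow> bool" where
  "canonical_to_unit C U K d m \<longleftrightarrow>
     m \<in> Hom C K (Unit C) \<and> (\<forall>s\<in>U. m \<cdot>\<^bsub>C\<^esub> unit_leg C d s = s)"

definition canonical_to_tensor ::
  "('o, 'a) braided_data \<Rightarrow> 'a set \<Rightarrow> 'o \<Rightarrow> 'o \<Rightarrow> ('a \<Rightarrow> 'a) \<Rightarrow> 'o \<Rightarrow> ('a \<Rightarrow> 'a) \<Rightarrow> 'a \<Rightarrow> bool" where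
  "canonical_to_tensor C U X L c K d k \<longleftrightarrow>
     k \<in> Hom C L (K \<otimes>\<^bsub>C\<^esub> X) \<and> (\<forall>s\<in>U. k \<cdot>\<^bsub>C\<^esub> c s = unit_leg C d s \<star>\<^bsub>C\<^esub> Id C X)"

text \<open>
  Colimits are determined up to isomorphism only, so the conditions on the canonical morphisms are
  imposed for every choice of colimits.
\<close>

definition colimit_conditions :: "('o, 'a) braided_data \<Rightarrow> 'a set \<Rightarrow> bool" where
  "colimit_conditions C U \<longleftrightarrow>
     (\<forall>X\<in>Obj C. \<exists>L c. is_colimit C (subunit_diagram C U X) L c) \<and>
     (\<forall>K d. is_colimit C (subunit_diagram C U (Unit C)) K d \<longrightarrow>
        (\<exists>m. canonical_to_unit C U K d m \<and> monic C m)) \<and>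
     (\<forall>X\<in>Obj C. \<forall>L c K d.
        is_colimit C (subunit_diagram C U X) L c \<and>
        is_colimit C (subunit_diagram C U (Unit C)) K d \<longrightarrow>
        (\<exists>k. canonical_to_tensor C U X L c K d k \<and> is_iso C k))"


section \<open>Universal joins of subunits\<close>

definition weak_frame :: "('b, 'x) gorder_scheme \<Rightarrow> bool" where
  "weak_frame L \<longleftrightarrow> weak_complete_lattice L \<and>
     (\<forall>a\<in>carrier L. \<forall>B\<subseteq>carrier L.
        a \<sqinter>\<^bsub>L\<^esub> (\<Squnion>\<^bsub>L\<^esub> B) .=\<^bsub>L\<^esub> \<Squnion>\<^bsub>L\<^esub> {a \<sqinter>\<^bsub>L\<^esub> b | b. b \<in> B})"

definition universal_joins :: "('o, 'a) braided_data \<Rightarrow> bool" where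
  "universal_joins C \<longleftrightarrow> stiff_category C \<and> weak_frame (ISub C) \<and>
     (\<forall>U\<subseteq>carrier (ISub C). meet_idempotent C U \<longrightarrow> (\<forall>X\<in>Obj C.
        is_colimit C (subunit_diagram C U X)
          (Dom C (\<Squnion>\<^bsub>ISub C\<^esub> U) \<otimes>\<^bsub>C\<^esub> X)
          (\<lambda>s. incl C s (\<Squnion>\<^bsub>ISub C\<^esub> U) \<star>\<^bsub>C\<^esub> Id C X)))"

definition universal_finite_joins :: "('o, 'a) braided_data \<Rightarrow> bool" where
  "universal_finite_joins C \<longleftrightarrow>
     (\<exists>Z. initial C Z \<and> (\<forall>z\<in>Hom C Z (Unit C). monic C z) \<and>
        (\<forall>X\<in>Obj C. isomorphic C (X \<otimes>\<^bsub>C\<^esub> Z) Z)) \<and>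
     (\<forall>A\<subseteq>carrier (ISub C). finite A \<longrightarrow> (\<exists>j. is_lub (ISub C) j A)) \<and>
     (\<forall>s\<in>carrier (ISub C). \<forall>t\<in>carrier (ISub C). \<forall>X\<in>Obj C.
        let p = Id C (Dom C s) \<star>\<^bsub>C\<^esub> unit_act C t X;
            q = unit_act C s (Dom C t \<otimes>\<^bsub>C\<^esub> X);
            f = incl C s (s \<squnion>\<^bsub>ISub C\<^esub> t) \<star>\<^bsub>C\<^esub> Id C X;
            g = incl C t (s \<squnion>\<^bsub>ISub C\<^esub> t) \<star>\<^bsub>C\<^esub> Id C X
        in is_pullback C p q f g \<and> is_pushout C p q f g \<and>
           monic C p \<and> monic C q \<and> monic C f \<and> monic C g)"

text \<open>
  A diagram of inclusions between subunits, indexed by a poset \<open>P\<close>, is a monotone family of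
  subunits.
\<close>

definition subunit_family ::
  "('o, 'a) braided_data \<Rightarrow> 'i gorder \<Rightarrow> ('i \<Rightarrow> 'a) \<Rightarrow> bool" where
  "subunit_family C P s \<longleftrightarrow> (\<forall>i\<in>carrier P. s i \<in> carrier (ISub C)) \<and>
     (\<forall>i\<in>carrier P. \<forall>j\<in>carrier P. i \<sqsubseteq>\<^bsub>P\<^esub> j \<longrightarrow> s i \<sqsubseteq>\<^bsub>ISub C\<^esub> s j)"

definition family_diagram ::
  "('o, 'a) braided_data \<Rightarrow> 'i gorder \<Rightarrow> ('i \<Rightarrow> 'a) \<Rightarrow> ('i, 'o, 'a) diagram" where
  "family_diagram C P s = \<lparr>Node = carrier P,
     Vertex = (\<lambda>i. Dom C (s i)),
     Edge = {(i, incl C (s i) (s j), j) | i j. i \<in> carrier P \<and> j \<in> carrier P \<and> i \<sqsubseteq>\<^bsub>P\<^esub> j}\<rparr>"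

definition tensor_diagram ::
  "('o, 'a) braided_data \<Rightarrow> 'o \<Rightarrow> ('i, 'o, 'a) diagram \<Rightarrow> ('i, 'o, 'a) diagram" where
  "tensor_diagram C X D = \<lparr>Node = Node D,
     Vertex = (\<lambda>i. X \<otimes>\<^bsub>C\<^esub> Vertex D i),
     Edge = {(i, Id C X \<star>\<^bsub>C\<^esub> f, j) | i f j. (i, f, j) \<in> Edge D}\<rparr>"

text \<open>
  HOL cannot quantify over all types inside a formula, so the type \<open>'i\<close> from which the index
  posets are drawn is a parameter.  The type of arrows is large enough: up to equivalence, a directed
  diagram of inclusions is determined by the set of subunits occurring in it.
\<close>

definition universal_directed_joins :: "'i itself \<Rightarrow> ('o, 'a) braided_data \<Rightarrow> bool" where
  "universal_directed_joins TI C \<longleftrightarrow> stiff_category C \<and>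
     (\<forall>(P :: 'i gorder) s.
        partial_order P \<and> directed P (carrier P) \<and> subunit_family C P s \<longrightarrow>
        (\<exists>L c. is_colimit C (family_diagram C P s) L c) \<and>
        (\<forall>L c. is_colimit C (family_diagram C P s) L c \<longrightarrow>
           (\<exists>m\<in>Hom C L (Unit C). (\<forall>i\<in>carrier P. m \<cdot>\<^bsub>C\<^esub> c i = s i) \<and> subunit C m) \<and>
           (\<forall>X\<in>Obj C. is_colimit C (tensor_diagram C X (family_diagram C P s))
              (X \<otimes>\<^bsub>C\<^esub> L) (\<lambda>i. Id C X \<star>\<^bsub>C\<^esub> c i))))"

end

theory Submission
  imports Defs
begin

text \<open>
All objects \<open>S \<otimes> X\<close>, for a subunit \<open>s\<close>, are subobjects of \<open>X\<close> through the action map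
\<open>act s X : S \<otimes> X \<rightarrow> X\<close>, and stiffness says that \<open>S \<otimes> (T \<otimes> X)\<close> is the intersection of \<open>S \<otimes> X\<close> and
\<open>T \<otimes> X\<close>.  This suggests reading subunits as opens and the three notions of universal joins as sheaf
conditions.  A family of maps \<open>c a : A \<otimes> X \<rightarrow> L\<close>, one for each \<open>a\<close> in a set of subunits, is
\<open>matching\<close> when it agrees on intersections.  A subunit \<open>j\<close> \<open>covers\<close> the set when for
each \<open>X\<close> every matching family glues to a unique map \<open>J \<otimes> X \<rightarrow> L\<close>.  Such a \<open>j\<close> is a join of the set, and
only the downset generated by the set matters (\<open>covers_lub\<close>, \<open>covers_cofinal\<close>).

For idempotent \<open>U\<close> the cocones on \<open>D(U, X)\<close> are the matching families (\<open>cocone_matching\<close>): an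
intersection \<open>S \<otimes> (T \<otimes> X)\<close> lies in \<open>R \<otimes> X\<close> for some \<open>r\<close> in \<open>U\<close> equal to \<open>s \<and> t\<close>, and the inclusions of
\<open>R \<otimes> X\<close> are edges of the diagram.  So \<open>j\<close> covers \<open>U\<close> exactly if the objects \<open>J \<otimes> X\<close> are colimits of
the \<open>D(U, X)\<close>.  The three conditions on colimits hold for \<open>U\<close> exactly if some \<open>j\<close> covers \<open>U\<close>
(\<open>colimit_conditions_iff_covers\<close>).  The substance lies in \<open>colimit_subunit\<close>: if
\<open>K = colim D(U, I)\<close> is a subobject of the unit and the \<open>K \<otimes> X\<close> are the colimits of the \<open>D(U, X)\<close>, then
\<open>K\<close> is a subunit, because the inverse of \<open>K \<otimes> K \<rightarrow> K\<close> can be glued from the diagonals \<open>S \<rightarrow> S \<otimes> S\<close>.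

It remains to see that each notion of universal joins says that all sets of the corresponding kind are
covered.  For arbitrary sets, the frame law follows from gluing maps \<open>B \<otimes> A \<rightarrow> T\<close> to a map \<open>J \<otimes> A \<rightarrow> T\<close>
(\<open>covers_distrib\<close>).  For finite sets, covering the empty set means that \<open>Z \<otimes> X\<close> is initial, covering a
pair is the pushout condition (\<open>covers_pair_iff_pushout\<close>), and covers of larger finite sets are obtained
by adding one element at a time (\<open>covers_insert\<close>).  For directed sets, a cocone is automatically
matching, because two members of the set can be compared inside a third, and the braiding
turns \<open>X \<otimes> J\<close> into \<open>J \<otimes> X\<close>.  A cover of the image of a directed diagram depends on that image only, which
is why the index type is immaterial.

Coherence is mostly avoided by working with the objects \<open>Y\<close> for which \<open>act s Y\<close> is invertible.  They
are closed under isomorphism and under tensoring with any object, and every map \<open>Y \<rightarrow> X\<close> from such an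
object factors through \<open>S \<otimes> X\<close> (\<open>act_lift\<close>).
\<close>


section \<open>Isomorphisms and monomorphisms\<close>

context category
begin

text \<open>
Typing statements are turned into equations on domains and codomains, so that the simplifier can type
composites and normalise them to right-nested form.
\<close>

lemma arr_Hom: "f \<in> Hom C X Y \<longleftrightarrow> f \<in> Arr C \<and> Dom C f = X \<and> Cod C f = Y"
  by (auto simp: Hom_def)

lemma arr_Comp [simp]:
  assumes "f \<in> Arr C" "g \<in> Arr C" "Cod C f = Dom C g"
  shows "g \<cdot> f \<in> Arr C" "Dom C (g \<cdot> f) = Dom C f" "Cod C (g \<cdot> f) = Cod C g"
  using Comp_in_Hom[of f "Dom C f" "Cod C f" g "Cod C g"] assms by (auto simp: arr_Hom)

lemma arr_Id [simp]:
  assumes "X \<in> Obj C" shows "Id C X \<in> Arr C" "Dom C (Id C X) = X" "Cod C (Id C X) = X"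
  using Id_in_Hom assms by (auto simp: arr_Hom)

lemma Obj_Dom [simp]: "f \<in> Arr C \<Longrightarrow> Dom C f \<in> Obj C"
  by (rule Dom_in_Obj)

lemma Obj_Cod [simp]: "f \<in> Arr C \<Longrightarrow> Cod C f \<in> Obj C"
  by (rule Cod_in_Obj)

lemma comp_Id [simp]: "f \<in> Arr C \<Longrightarrow> Dom C f = X \<Longrightarrow> f \<cdot> Id C X = f"
  using Comp_Id[of f X "Cod C f"] by (simp add: arr_Hom)

lemma Id_comp [simp]: "f \<in> Arr C \<Longrightarrow> Cod C f = X \<Longrightarrow> Id C X \<cdot> f = f"
  using Id_Comp[of f "Dom C f" X] by (simp add: arr_Hom)

lemma comp_assoc [simp]:
  "\<lbrakk>f \<in> Arr C; g \<in> Arr C; h \<in> Arr C; Cod C f = Dom C g; Cod C g = Dom C h\<rbrakk>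
    \<Longrightarrow> (h \<cdot> g) \<cdot> f = h \<cdot> g \<cdot> f"
  using Comp_assoc[of f "Dom C f" "Dom C g" g "Dom C h" h "Cod C h"] by (simp add: arr_Hom)

text \<open>
An equation between composites, applied at the head of a longer right-nested composite.
\<close>

lemma comp_tail:
  assumes "g \<cdot> f = k" "f \<in> Arr C" "g \<in> Arr C" "h \<in> Arr C" "Cod C f = Dom C g" "Cod C h = Dom C f"
  shows "g \<cdot> f \<cdot> h = k \<cdot> h"
  using assms comp_assoc[of h f g] by simp

lemma comp_tail2:
  assumes "g \<cdot> f = g' \<cdot> f'" "f \<in> Arr C" "g \<in> Arr C" "f' \<in> Arr C" "g' \<in> Arr C" "h \<in> Arr C"
    "Cod C f = Dom C g" "Cod C h = Dom C f" "Cod C f' = Dom C g'" "Cod C h = Dom C f'"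
  shows "g \<cdot> f \<cdot> h = g' \<cdot> f' \<cdot> h"
  using assms comp_assoc[of h f g] comp_assoc[of h f' g'] by simp

lemma isoI:
  assumes "f \<in> Arr C" "g \<in> Arr C" "Dom C g = Cod C f" "Cod C g = Dom C f"
    "g \<cdot> f = Id C (Dom C f)" "f \<cdot> g = Id C (Cod C f)"
  shows "is_iso C f"
  using assms by (auto simp: is_iso_def inverse_arrows_def arr_Hom)

lemma isoE:
  assumes "is_iso C f"
  obtains g where "f \<in> Arr C" "g \<in> Arr C" "Dom C g = Cod C f" "Cod C g = Dom C f"
    "g \<cdot> f = Id C (Dom C f)" "f \<cdot> g = Id C (Cod C f)"
  using assms by (auto simp: is_iso_def inverse_arrows_def arr_Hom)

lemma iso_arr: "is_iso C f \<Longrightarrow> f \<in> Arr C"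
  by (auto elim: isoE)

lemma Inv_props:
  assumes "is_iso C f"
  shows "Inv C f \<in> Arr C" "Dom C (Inv C f) = Cod C f" "Cod C (Inv C f) = Dom C f"
    "Inv C f \<cdot> f = Id C (Dom C f)" "f \<cdot> Inv C f = Id C (Cod C f)"
proof -
  obtain g where g: "f \<in> Arr C" "g \<in> Arr C" "Dom C g = Cod C f" "Cod C g = Dom C f"
    "g \<cdot> f = Id C (Dom C f)" "f \<cdot> g = Id C (Cod C f)"
    using assms by (rule isoE)
  have "h = g" if "inverse_arrows C f h" for h
  proof -
    have h: "h \<in> Arr C" "Dom C h = Cod C f" "h \<cdot> f = Id C (Dom C f)" "Cod C h = Dom C f"
      using that by (auto simp: inverse_arrows_def arr_Hom)
    have "h = h \<cdot> f \<cdot> g" using g h by simp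
    also have "\<dots> = (h \<cdot> f) \<cdot> g" using g h by (intro comp_assoc[symmetric]) simp_all
    also have "\<dots> = g" using g h(3) by simp
    finally show ?thesis .
  qed
  moreover have "inverse_arrows C f g" using g by (auto simp: inverse_arrows_def arr_Hom)
  ultimately have "inverse_arrows C f (Inv C f)"
    unfolding Inv_def by (metis theI)
  then show "Inv C f \<in> Arr C" "Dom C (Inv C f) = Cod C f" "Cod C (Inv C f) = Dom C f"
    "Inv C f \<cdot> f = Id C (Dom C f)" "f \<cdot> Inv C f = Id C (Cod C f)"
    by (auto simp: inverse_arrows_def arr_Hom)
qed

lemma iso_Id: "X \<in> Obj C \<Longrightarrow> is_iso C (Id C X)"
  by (rule isoI[of _ "Id C X"]) auto

lemma iso_comp:
  assumes "is_iso C f" "is_iso C g" "Cod C f = Dom C g"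
  shows "is_iso C (g \<cdot> f)"
proof -
  obtain f' where f: "f \<in> Arr C" "f' \<in> Arr C" "Dom C f' = Cod C f" "Cod C f' = Dom C f"
    "f' \<cdot> f = Id C (Dom C f)" "f \<cdot> f' = Id C (Cod C f)"
    using assms(1) by (rule isoE)
  obtain g' where g: "g \<in> Arr C" "g' \<in> Arr C" "Dom C g' = Cod C g" "Cod C g' = Dom C g"
    "g' \<cdot> g = Id C (Dom C g)" "g \<cdot> g' = Id C (Cod C g)"
    using assms(2) by (rule isoE)
  show ?thesis
    using f g assms(3) by (intro isoI[of _ "f' \<cdot> g'"])
      (simp_all add: comp_tail[OF g(5)] comp_tail[OF f(6)])
qed

lemma iso_cancel_left:
  assumes "is_iso C g" "f \<in> Arr C" "f' \<in> Arr C" "Cod C f = Dom C g" "Cod C f' = Dom C g" "g \<cdot> f = g \<cdot> f'"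
  shows "f = f'"
proof -
  obtain h where h: "g \<in> Arr C" "h \<in> Arr C" "Dom C h = Cod C g" "Cod C h = Dom C g"
    "h \<cdot> g = Id C (Dom C g)"
    using assms(1) by (rule isoE)
  have "f = h \<cdot> g \<cdot> f" using assms(1-5) h by (simp add: comp_tail[OF h(5)])
  also have "\<dots> = h \<cdot> g \<cdot> f'" using assms(6) by simp
  also have "\<dots> = f'" using assms(1-5) h by (simp add: comp_tail[OF h(5)])
  finally show ?thesis .
qed

lemma iso_cancel_right:
  assumes "is_iso C g" "f \<in> Arr C" "f' \<in> Arr C" "Dom C f = Cod C g" "Dom C f' = Cod C g" "f \<cdot> g = f' \<cdot> g"
  shows "f = f'"
proof -
  obtain h where h: "g \<in> Arr C" "h \<in> Arr C" "Dom C h = Cod C g" "Cod C h = Dom C g"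
    "g \<cdot> h = Id C (Cod C g)"
    using assms(1) by (rule isoE)
  have "f = (f \<cdot> g) \<cdot> h" using assms(1-5) h by simp
  also have "\<dots> = (f' \<cdot> g) \<cdot> h" using assms(6) by simp
  also have "\<dots> = f'" using assms(1-5) h by simp
  finally show ?thesis .
qed

lemma monicD:
  assumes "monic C m" "f \<in> Arr C" "g \<in> Arr C" "Cod C f = Dom C m" "Cod C g = Dom C m"
    "Dom C f = Dom C g" "m \<cdot> f = m \<cdot> g"
  shows "f = g"
proof -
  have "Dom C f \<in> Obj C" "f \<in> Hom C (Dom C f) (Dom C m)" "g \<in> Hom C (Dom C f) (Dom C m)"
    using assms by (simp_all add: arr_Hom)
  then show ?thesis using assms(1,7) unfolding monic_def by blast
qed

lemma monicI:
  assumes "m \<in> Arr C"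
    "\<And>f g. \<lbrakk>f \<in> Arr C; g \<in> Arr C; Cod C f = Dom C m; Cod C g = Dom C m; Dom C f = Dom C g;
       m \<cdot> f = m \<cdot> g\<rbrakk> \<Longrightarrow> f = g"
  shows "monic C m"
  unfolding monic_def
  by (intro conjI ballI impI assms(1); rule assms(2)) (simp_all only: arr_Hom)

lemma monic_arr: "monic C m \<Longrightarrow> m \<in> Arr C"
  by (simp add: monic_def)

lemma monic_comp:
  assumes "monic C m" "monic C n" "Cod C m = Dom C n" shows "monic C (n \<cdot> m)"
proof (rule monicI)
  show "n \<cdot> m \<in> Arr C" using assms by (simp add: monic_arr)
  fix f g
  assume fg: "f \<in> Arr C" "g \<in> Arr C" "Cod C f = Dom C (n \<cdot> m)" "Cod C g = Dom C (n \<cdot> m)"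
    "Dom C f = Dom C g" "(n \<cdot> m) \<cdot> f = (n \<cdot> m) \<cdot> g"
  have a: "m \<in> Arr C" "n \<in> Arr C" using assms by (simp_all add: monic_arr)
  have "m \<cdot> f = m \<cdot> g"
    by (rule monicD[OF assms(2)]) (use assms(3) a fg in auto)
  show "f = g"
    by (rule monicD[OF assms(1)]) (use \<open>m \<cdot> f = m \<cdot> g\<close> a assms(3) fg in auto)
qed

lemma monic_left_factor:
  assumes "monic C (n \<cdot> m)" "m \<in> Arr C" "n \<in> Arr C" "Cod C m = Dom C n" shows "monic C m"
proof (rule monicI)
  fix f g
  assume fg: "f \<in> Arr C" "g \<in> Arr C" "Cod C f = Dom C m" "Cod C g = Dom C m"
    "Dom C f = Dom C g" "m \<cdot> f = m \<cdot> g"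
  show "f = g"
    by (rule monicD[OF assms(1)]) (use assms fg in auto)
qed (use assms in auto)

lemma iso_monic: "is_iso C f \<Longrightarrow> monic C f"
  by (rule monicI) (simp_all add: iso_arr iso_cancel_left)

lemma monic_section_iso:
  assumes "monic C m" "f \<in> Arr C" "Cod C f = Dom C m" "Dom C f = Cod C m" "m \<cdot> f = Id C (Cod C m)"
  shows "is_iso C m"
proof (rule isoI)
  have m: "m \<in> Arr C" using assms(1) by (rule monic_arr)
  have *: "m \<cdot> f \<cdot> m = m" using assms m by (simp add: comp_tail[OF assms(5)])
  show "f \<cdot> m = Id C (Dom C m)"
    by (rule monicD[OF assms(1)]) (use assms m * in auto)
qed (use assms monic_arr in auto)

lemma isomorphicI: "\<lbrakk>is_iso C f; Dom C f = X; Cod C f = Y\<rbrakk> \<Longrightarrow> isomorphic C X Y"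
  by (auto simp: isomorphic_def arr_Hom iso_arr)

lemma isomorphicE:
  assumes "isomorphic C X Y"
  obtains f where "is_iso C f" "Dom C f = X" "Cod C f = Y"
  using assms by (auto simp: isomorphic_def arr_Hom)

lemma isomorphic_sym: "isomorphic C X Y \<Longrightarrow> isomorphic C Y X"
  by (erule isomorphicE, erule isoE, rule isomorphicI, rule isoI) auto

lemma isomorphic_trans [trans]: "isomorphic C X Y \<Longrightarrow> isomorphic C Y Z \<Longrightarrow> isomorphic C X Z"
  by (elim isomorphicE, rule isomorphicI, erule (1) iso_comp) (auto simp: iso_arr)

end

section \<open>Colimits and initial objects\<close>

context category
begin

lemma cocone_arr:
  assumes "is_cocone C D L c" "i \<in> Node D"
  shows "c i \<in> Arr C" "Dom C (c i) = Vertex D i" "Cod C (c i) = L"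
  using assms by (auto simp: is_cocone_def arr_Hom)

lemma colimit_glue:
  assumes "is_colimit C D L c" "is_cocone C D L' c'"
  obtains u where "u \<in> Arr C" "Dom C u = L" "Cod C u = L'" "\<And>i. i \<in> Node D \<Longrightarrow> u \<cdot> c i = c' i"
  using assms unfolding is_colimit_def arr_Hom by metis

lemma colimit_cocone: "is_colimit C D L c \<Longrightarrow> is_cocone C D L c"
  by (simp add: is_colimit_def)

lemma cocone_post:
  assumes "is_cocone C D L c" "u \<in> Arr C" "Dom C u = L"
    "\<And>i f j. (i, f, j) \<in> Edge D \<Longrightarrow> i \<in> Node D \<and> j \<in> Node D \<and> f \<in> Arr C \<and> Cod C f = Vertex D j"
  shows "is_cocone C D (Cod C u) (\<lambda>i. u \<cdot> c i)"
  unfolding is_cocone_def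
proof (intro conjI ballI)
  fix e assume e: "e \<in> Edge D"
  obtain i f j where ifj: "e = (i, f, j)" by (cases e)
  have "c j \<cdot> f = c i" using assms(1) e ifj by (auto simp: is_cocone_def)
  then show "case e of (i, f, j) \<Rightarrow> (u \<cdot> c j) \<cdot> f = u \<cdot> c i"
    using assms(2,3) assms(4)[of i f j] e ifj cocone_arr[OF assms(1), of j] by simp
qed (use assms(2,3) cocone_arr[OF assms(1)] in \<open>simp_all add: arr_Hom\<close>)

text \<open>
The typing hypothesis on edges is what makes post-composition of a cocone a cocone again; a diagram is just
a labelled graph and need not satisfy it.
\<close>

lemma colimit_ext:
  assumes "is_colimit C D L c" "u \<in> Arr C" "v \<in> Arr C" "Dom C u = L" "Dom C v = L" "Cod C u = Cod C v"
    "\<And>i f j. (i, f, j) \<in> Edge D \<Longrightarrow> i \<in> Node D \<and> j \<in> Node D \<and> f \<in> Arr C \<and> Cod C f = Vertex D j"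
    "\<And>i. i \<in> Node D \<Longrightarrow> u \<cdot> c i = v \<cdot> c i"
  shows "u = v"
proof -
  have "is_cocone C D (Cod C u) (\<lambda>i. u \<cdot> c i)"
    by (rule cocone_post[OF colimit_cocone[OF assms(1)] assms(2,4,7)])
  then have "\<exists>!w. w \<in> Hom C L (Cod C u) \<and> (\<forall>i\<in>Node D. w \<cdot> c i = u \<cdot> c i)"
    using assms(1) unfolding is_colimit_def by blast
  moreover have "u \<in> Hom C L (Cod C u)" "v \<in> Hom C L (Cod C u)"
    using assms(2-6) by (simp_all add: arr_Hom)
  ultimately show ?thesis using assms(8) by metis
qed

lemma colimit_unique:
  assumes c: "is_colimit C D L c" and c': "is_colimit C D L' c'"
    and D: "\<And>i f j. (i, f, j) \<in> Edge D \<Longrightarrow> i \<in> Node D \<and> j \<in> Node D \<and> f \<in> Arr C \<and> Cod C f = Vertex D j"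
  obtains u where "is_iso C u" "Dom C u = L" "Cod C u = L'" "\<And>i. i \<in> Node D \<Longrightarrow> u \<cdot> c i = c' i"
proof -
  note cc = colimit_cocone[OF c] colimit_cocone[OF c']
  have obj: "L \<in> Obj C" "L' \<in> Obj C" using cc by (auto simp: is_cocone_def)
  obtain u where u: "u \<in> Arr C" "Dom C u = L" "Cod C u = L'" "\<And>i. i \<in> Node D \<Longrightarrow> u \<cdot> c i = c' i"
    using colimit_glue[OF c cc(2)] by blast
  obtain v where v: "v \<in> Arr C" "Dom C v = L'" "Cod C v = L" "\<And>i. i \<in> Node D \<Longrightarrow> v \<cdot> c' i = c i"
    using colimit_glue[OF c' cc(1)] by blast
  have "v \<cdot> u = Id C L"
    by (rule colimit_ext[OF c _ _ _ _ _ D]) (use u v obj cocone_arr[OF cc(1)] in simp_all)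
  moreover have "u \<cdot> v = Id C L'"
    by (rule colimit_ext[OF c' _ _ _ _ _ D]) (use u v obj cocone_arr[OF cc(2)] in simp_all)
  ultimately have "is_iso C u" using u v by (intro isoI[of u v]) simp_all
  then show ?thesis using that u by blast
qed

lemma colimit_transport:
  assumes c: "is_colimit C D L c" and u: "is_iso C u" "Dom C u = L" "Cod C u = L'"
    and c': "\<And>i. i \<in> Node D \<Longrightarrow> c' i = u \<cdot> c i"
    and D: "\<And>i f j. (i, f, j) \<in> Edge D \<Longrightarrow> i \<in> Node D \<and> j \<in> Node D \<and> f \<in> Arr C \<and> Cod C f = Vertex D j"
  shows "is_colimit C D L' c'"
proof -
  note cc = colimit_cocone[OF c]
  obtain v where v: "u \<in> Arr C" "v \<in> Arr C" "Dom C v = L'" "Cod C v = L" "v \<cdot> u = Id C L" "u \<cdot> v = Id C L'"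
    using isoE[OF u(1)] u(2,3) by metis
  have "is_cocone C D (Cod C u) (\<lambda>i. u \<cdot> c i)"
    by (rule cocone_post[OF cc v(1) u(2) D])
  then have cc': "is_cocone C D L' c'"
    using c' D u(3) unfolding is_cocone_def by (auto simp: Ball_def)
  show ?thesis
    unfolding is_colimit_def
  proof (intro conjI allI impI cc')
    fix M e assume e: "is_cocone C D M e"
    obtain w where w: "w \<in> Arr C" "Dom C w = L" "Cod C w = M" "\<And>i. i \<in> Node D \<Longrightarrow> w \<cdot> c i = e i"
      using colimit_glue[OF c e] by blast
    show "\<exists>!w. w \<in> Hom C L' M \<and> (\<forall>i\<in>Node D. w \<cdot> c' i = e i)"
    proof (rule ex1I)
      show "w \<cdot> v \<in> Hom C L' M \<and> (\<forall>i\<in>Node D. (w \<cdot> v) \<cdot> c' i = e i)"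
        using w v u(2,3) cocone_arr[OF cc] by (simp add: arr_Hom c' comp_tail[OF v(5)])
      fix w' assume w': "w' \<in> Hom C L' M \<and> (\<forall>i\<in>Node D. w' \<cdot> c' i = e i)"
      have "w' \<cdot> u = w"
        by (rule colimit_ext[OF c _ _ _ _ _ D])
          (use w v u(2,3) w' cocone_arr[OF cc] in \<open>simp_all add: arr_Hom c'\<close>)
      then have "w \<cdot> v = w' \<cdot> u \<cdot> v" using w' v u(2,3) by (auto simp: arr_Hom)
      also have "\<dots> = w'" using w' v(6) by (simp add: arr_Hom)
      finally show "w' = w \<cdot> v" ..
    qed
  qed
qed

lemma initialD:
  assumes "initial C Z" "X \<in> Obj C"
  obtains f where "f \<in> Arr C" "Dom C f = Z" "Cod C f = X"
    "\<And>g. \<lbrakk>g \<in> Arr C; Dom C g = Z; Cod C g = X\<rbrakk> \<Longrightarrow> g = f"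
  using assms unfolding initial_def arr_Hom by metis

lemma initial_eq:
  assumes "initial C Z" "f \<in> Arr C" "g \<in> Arr C" "Dom C f = Z" "Dom C g = Z" "Cod C f = Cod C g"
  shows "f = g"
  by (rule initialD[OF assms(1) Obj_Cod[OF assms(2)]]) (use assms in metis)

lemma initial_iso:
  assumes "initial C Z" "initial C Y" "f \<in> Arr C" "Dom C f = Z" "Cod C f = Y"
  shows "is_iso C f"
proof -
  have obj: "Z \<in> Obj C" "Y \<in> Obj C" using assms(1,2) by (simp_all add: initial_def)
  obtain g where g: "g \<in> Arr C" "Dom C g = Y" "Cod C g = Z" by (rule initialD[OF assms(2) obj(1)])
  have "g \<cdot> f = Id C Z" by (rule initial_eq[OF assms(1)]) (use assms g obj in simp_all)
  moreover have "f \<cdot> g = Id C Y" by (rule initial_eq[OF assms(2)]) (use assms g obj in simp_all)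
  ultimately show ?thesis using assms g by (intro isoI[of f g]) simp_all
qed

lemma initial_isomorphic:
  assumes "initial C Z" "isomorphic C Z Y"
  shows "initial C Y"
proof -
  obtain f where f: "is_iso C f" "Dom C f = Z" "Cod C f = Y" using assms(2) by (rule isomorphicE)
  obtain g where g: "f \<in> Arr C" "g \<in> Arr C" "Dom C g = Y" "Cod C g = Z" "f \<cdot> g = Id C Y"
    using isoE[OF f(1)] f(2,3) by metis
  have Y: "Y \<in> Obj C" using g(2,3) Obj_Dom by blast
  have "\<exists>!h. h \<in> Hom C Y X" if X: "X \<in> Obj C" for X
  proof -
    obtain h where h: "h \<in> Arr C" "Dom C h = Z" "Cod C h = X" by (rule initialD[OF assms(1) X])
    show ?thesis
    proof (rule ex1I)
      show "h \<cdot> g \<in> Hom C Y X" using h g by (simp add: arr_Hom)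
      fix k assume k: "k \<in> Hom C Y X"
      have "k \<cdot> f = h"
        by (rule initial_eq[OF assms(1)]) (use k f g h in \<open>simp_all add: arr_Hom\<close>)
      then have "h \<cdot> g = k \<cdot> f \<cdot> g" using k f g by (auto simp: arr_Hom)
      also have "\<dots> = k" using k g by (simp add: arr_Hom)
      finally show "k = h \<cdot> g" ..
    qed
  qed
  then show ?thesis using Y by (simp add: initial_def)
qed

end

section \<open>Braided monoidal categories: unitors and the action of maps to the unit\<close>

context braided_monoidal_category
begin

lemma Obj_tensor [simp]: "\<lbrakk>X \<in> Obj C; Y \<in> Obj C\<rbrakk> \<Longrightarrow> X \<otimes> Y \<in> Obj C"
  by (rule TensorO_in_Obj)

lemma Obj_Unit [simp]: "Unit C \<in> Obj C"
  by (rule Unit_in_Obj)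

lemma arr_tensor [simp]:
  assumes "f \<in> Arr C" "g \<in> Arr C"
  shows "f \<star> g \<in> Arr C" "Dom C (f \<star> g) = Dom C f \<otimes> Dom C g" "Cod C (f \<star> g) = Cod C f \<otimes> Cod C g"
  using TensorA_in_Hom[of f "Dom C f" "Cod C f" g "Dom C g" "Cod C g"] assms by (auto simp: arr_Hom)

lemma tensor_Id [simp]: "\<lbrakk>X \<in> Obj C; Y \<in> Obj C\<rbrakk> \<Longrightarrow> Id C X \<star> Id C Y = Id C (X \<otimes> Y)"
  by (rule TensorA_Id)

lemma tensor_comp [simp]:
  assumes "f \<in> Arr C" "g \<in> Arr C" "f' \<in> Arr C" "g' \<in> Arr C" "Cod C f = Dom C f'" "Cod C g = Dom C g'"
  shows "(f' \<star> g') \<cdot> (f \<star> g) = (f' \<cdot> f) \<star> (g' \<cdot> g)"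
  using TensorA_Comp[of f "Dom C f" "Dom C f'" f' "Cod C f'" g "Dom C g" "Dom C g'" g' "Cod C g'"] assms
  by (simp add: arr_Hom)

lemma tensor_comp_tail [simp]:
  assumes "f \<in> Arr C" "g \<in> Arr C" "f' \<in> Arr C" "g' \<in> Arr C" "h \<in> Arr C"
    "Cod C f = Dom C f'" "Cod C g = Dom C g'" "Cod C h = Dom C f \<otimes> Dom C g"
  shows "(f' \<star> g') \<cdot> (f \<star> g) \<cdot> h = ((f' \<cdot> f) \<star> (g' \<cdot> g)) \<cdot> h"
  using assms by (intro comp_tail) simp_all

lemma lunit_arr [simp]:
  assumes "X \<in> Obj C"
  shows "Lunit C X \<in> Arr C" "Dom C (Lunit C X) = Unit C \<otimes> X" "Cod C (Lunit C X) = X"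
  using Lunit_in_Hom assms by (auto simp: arr_Hom)

lemma runit_arr [simp]:
  assumes "X \<in> Obj C"
  shows "Runit C X \<in> Arr C" "Dom C (Runit C X) = X \<otimes> Unit C" "Cod C (Runit C X) = X"
  using Runit_in_Hom assms by (auto simp: arr_Hom)

lemma assoc_arr [simp]:
  assumes "X \<in> Obj C" "Y \<in> Obj C" "Z \<in> Obj C"
  shows "Assoc C X Y Z \<in> Arr C" "Dom C (Assoc C X Y Z) = (X \<otimes> Y) \<otimes> Z" "Cod C (Assoc C X Y Z) = X \<otimes> (Y \<otimes> Z)"
  using Assoc_in_Hom assms by (auto simp: arr_Hom)

lemma braid_arr [simp]:
  assumes "X \<in> Obj C" "Y \<in> Obj C"
  shows "Braid C X Y \<in> Arr C" "Dom C (Braid C X Y) = X \<otimes> Y" "Cod C (Braid C X Y) = Y \<otimes> X"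
  using Braid_in_Hom assms by (auto simp: arr_Hom)

lemma lunit_nat:
  assumes "f \<in> Arr C"
  shows "Lunit C (Cod C f) \<cdot> (Id C (Unit C) \<star> f) = f \<cdot> Lunit C (Dom C f)"
  using Lunit_natural assms by (simp add: arr_Hom)

lemma runit_nat:
  assumes "f \<in> Arr C"
  shows "Runit C (Cod C f) \<cdot> (f \<star> Id C (Unit C)) = f \<cdot> Runit C (Dom C f)"
  using Runit_natural assms by (simp add: arr_Hom)

lemma assoc_nat:
  assumes "f \<in> Arr C" "g \<in> Arr C" "h \<in> Arr C"
  shows "Assoc C (Cod C f) (Cod C g) (Cod C h) \<cdot> ((f \<star> g) \<star> h)
    = (f \<star> (g \<star> h)) \<cdot> Assoc C (Dom C f) (Dom C g) (Dom C h)"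
  using Assoc_natural assms by (simp add: arr_Hom)

lemma braid_nat:
  assumes "f \<in> Arr C" "g \<in> Arr C"
  shows "Braid C (Cod C f) (Cod C g) \<cdot> (f \<star> g) = (g \<star> f) \<cdot> Braid C (Dom C f) (Dom C g)"
  using Braid_natural assms by (simp add: arr_Hom)

lemma iso_tensor:
  assumes "is_iso C f" "is_iso C g" shows "is_iso C (f \<star> g)"
proof -
  obtain f' where f: "f \<in> Arr C" "f' \<in> Arr C" "Dom C f' = Cod C f" "Cod C f' = Dom C f"
    "f' \<cdot> f = Id C (Dom C f)" "f \<cdot> f' = Id C (Cod C f)"
    using assms(1) by (rule isoE)
  obtain g' where g: "g \<in> Arr C" "g' \<in> Arr C" "Dom C g' = Cod C g" "Cod C g' = Dom C g"
    "g' \<cdot> g = Id C (Dom C g)" "g \<cdot> g' = Id C (Cod C g)"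
    using assms(2) by (rule isoE)
  show ?thesis
    using f g by (intro isoI[of _ "f' \<star> g'"]) simp_all
qed

lemma unit_tensor_faithful:
  assumes "f \<in> Arr C" "g \<in> Arr C" "Dom C f = Dom C g" "Cod C f = Cod C g"
    "Id C (Unit C) \<star> f = Id C (Unit C) \<star> g"
  shows "f = g"
proof (rule iso_cancel_right[OF Lunit_iso])
  show "f \<cdot> Lunit C (Dom C f) = g \<cdot> Lunit C (Dom C f)"
    using lunit_nat[OF assms(1)] lunit_nat[OF assms(2)] assms(3-5) by metis
qed (use assms in auto)

lemma tensor_unit_faithful:
  assumes "f \<in> Arr C" "g \<in> Arr C" "Dom C f = Dom C g" "Cod C f = Cod C g"
    "f \<star> Id C (Unit C) = g \<star> Id C (Unit C)"
  shows "f = g"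
proof (rule iso_cancel_right[OF Runit_iso])
  show "f \<cdot> Runit C (Dom C f) = g \<cdot> Runit C (Dom C f)"
    using runit_nat[OF assms(1)] runit_nat[OF assms(2)] assms(3-5) by metis
qed (use assms in auto)

text \<open>
Kelly's derivation of this coherence law from the pentagon and the triangle: both sides agree after
tensoring with the unit on the left and composing with an isomorphism.
\<close>

lemma lunit_tensor:
  assumes X: "X \<in> Obj C" and Y: "Y \<in> Obj C"
  shows "Lunit C (X \<otimes> Y) \<cdot> Assoc C (Unit C) X Y = Lunit C X \<star> Id C Y"
proof -
  let ?I = "Unit C"
  let ?a = "Assoc C ?I (?I \<otimes> X) Y \<cdot> (Assoc C ?I ?I X \<star> Id C Y)"
  have iso: "is_iso C ?a"
    using X Y by (intro iso_comp iso_tensor Assoc_iso iso_Id) simp_all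
  \<comment> \<open>compose the pentagon for \<open>I, I, X, Y\<close> with \<open>I \<otimes> \<lambda>\<close> and use the triangle on both ends\<close>
  have "(Id C ?I \<star> (Lunit C (X \<otimes> Y) \<cdot> Assoc C ?I X Y)) \<cdot> ?a
      = (Id C ?I \<star> Lunit C (X \<otimes> Y)) \<cdot> (Id C ?I \<star> Assoc C ?I X Y) \<cdot> ?a"
    using X Y by simp
  also have "\<dots> = (Id C ?I \<star> Lunit C (X \<otimes> Y)) \<cdot> Assoc C ?I ?I (X \<otimes> Y) \<cdot> Assoc C (?I \<otimes> ?I) X Y"
    using X Y by (simp only: pentagon[OF Obj_Unit Obj_Unit X Y])
  also have "\<dots> = (Runit C ?I \<star> Id C (X \<otimes> Y)) \<cdot> Assoc C (?I \<otimes> ?I) X Y"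
    using X Y by (intro comp_tail triangle) simp_all
  also have "\<dots> = Assoc C ?I X Y \<cdot> ((Runit C ?I \<star> Id C X) \<star> Id C Y)"
    using assoc_nat[of "Runit C ?I" "Id C X" "Id C Y"] X Y by simp
  also have "\<dots> = Assoc C ?I X Y \<cdot> (((Id C ?I \<star> Lunit C X) \<cdot> Assoc C ?I ?I X) \<star> Id C Y)"
    using X by (simp only: triangle[OF X Obj_Unit] triangle[OF Obj_Unit X])
  also have "\<dots> = Assoc C ?I X Y \<cdot> ((Id C ?I \<star> Lunit C X) \<star> Id C Y) \<cdot> (Assoc C ?I ?I X \<star> Id C Y)"
    using X Y by simp
  also have "\<dots> = (Id C ?I \<star> (Lunit C X \<star> Id C Y)) \<cdot> ?a"
    using assoc_nat[of "Id C ?I" "Lunit C X" "Id C Y"] X Y by (intro comp_tail2) simp_all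
  finally have "Id C ?I \<star> (Lunit C (X \<otimes> Y) \<cdot> Assoc C ?I X Y) = Id C ?I \<star> (Lunit C X \<star> Id C Y)"
    by (rule iso_cancel_right[OF iso, rotated -1]) (use X Y in simp_all)
  then show ?thesis
    by (rule unit_tensor_faithful[rotated -1]) (use X Y in simp_all)
qed

lemma lunit_unit: "Lunit C (Unit C) = Runit C (Unit C)"
proof -
  let ?I = "Unit C"
  have "Lunit C ?I \<cdot> Lunit C (?I \<otimes> ?I) = Lunit C ?I \<cdot> (Id C ?I \<star> Lunit C ?I)"
    using lunit_nat[of "Lunit C ?I"] by simp
  then have "Lunit C (?I \<otimes> ?I) = Id C ?I \<star> Lunit C ?I"
    by (rule iso_cancel_left[OF Lunit_iso, rotated -1]) simp_all
  then have "Lunit C ?I \<star> Id C ?I = Runit C ?I \<star> Id C ?I"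
    using lunit_tensor[of ?I ?I] triangle[of ?I ?I] by simp
  then show ?thesis
    by (rule tensor_unit_faithful[rotated -1]) simp_all
qed

lemma runit_inv [simp]:
  assumes "X \<in> Obj C"
  shows "Inv C (Runit C X) \<in> Arr C" "Dom C (Inv C (Runit C X)) = X" "Cod C (Inv C (Runit C X)) = X \<otimes> Unit C"
    "Runit C X \<cdot> Inv C (Runit C X) = Id C X" "Inv C (Runit C X) \<cdot> Runit C X = Id C (X \<otimes> Unit C)"
    "is_iso C (Inv C (Runit C X))"
proof -
  note r = Inv_props[OF Runit_iso[OF assms]]
  show "Inv C (Runit C X) \<in> Arr C" "Dom C (Inv C (Runit C X)) = X" "Cod C (Inv C (Runit C X)) = X \<otimes> Unit C"
    "Runit C X \<cdot> Inv C (Runit C X) = Id C X" "Inv C (Runit C X) \<cdot> Runit C X = Id C (X \<otimes> Unit C)"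
    using r assms by simp_all
  show "is_iso C (Inv C (Runit C X))"
    using r assms by (intro isoI[of _ "Runit C X"]) simp_all
qed

lemma runit_inv_tail [simp]:
  assumes "X \<in> Obj C" "f \<in> Arr C"
  shows "Cod C f = X \<Longrightarrow> Runit C X \<cdot> Inv C (Runit C X) \<cdot> f = f"
    "Cod C f = X \<otimes> Unit C \<Longrightarrow> Inv C (Runit C X) \<cdot> Runit C X \<cdot> f = f"
  using assms by (simp_all add: comp_tail[OF runit_inv(4)] comp_tail[OF runit_inv(5)])

lemma runit_inv_nat:
  assumes "f \<in> Arr C"
  shows "(f \<star> Id C (Unit C)) \<cdot> Inv C (Runit C (Dom C f)) = Inv C (Runit C (Cod C f)) \<cdot> f"
proof (rule iso_cancel_left[OF Runit_iso])
  have "Runit C (Cod C f) \<cdot> (f \<star> Id C (Unit C)) \<cdot> Inv C (Runit C (Dom C f))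
      = f \<cdot> Runit C (Dom C f) \<cdot> Inv C (Runit C (Dom C f))"
    using assms by (intro comp_tail2 runit_nat) simp_all
  then show "Runit C (Cod C f) \<cdot> (f \<star> Id C (Unit C)) \<cdot> Inv C (Runit C (Dom C f))
      = Runit C (Cod C f) \<cdot> Inv C (Runit C (Cod C f)) \<cdot> f"
    using assms by simp
qed (use assms in simp_all)

text \<open>
The braiding is not assumed to be a symmetry, so going back from \<open>X \<otimes> A\<close> to \<open>A \<otimes> X\<close> uses the inverse of
the braiding rather than the braiding in the other direction.
\<close>

lemma unbraid:
  assumes "A \<in> Obj C" "X \<in> Obj C"
  shows "Inv C (Braid C A X) \<in> Arr C" "Dom C (Inv C (Braid C A X)) = X \<otimes> A"
    "Cod C (Inv C (Braid C A X)) = A \<otimes> X"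
    "Braid C A X \<cdot> Inv C (Braid C A X) = Id C (X \<otimes> A)" "Inv C (Braid C A X) \<cdot> Braid C A X = Id C (A \<otimes> X)"
  using Inv_props[OF Braid_iso[OF assms]] assms by simp_all

lemma unbraid_nat:
  assumes "f \<in> Arr C" "X \<in> Obj C"
  shows "(f \<star> Id C X) \<cdot> Inv C (Braid C (Dom C f) X) = Inv C (Braid C (Cod C f) X) \<cdot> (Id C X \<star> f)"
proof (rule iso_cancel_left[OF Braid_iso[of "Cod C f" X]])
  let ?D = "Inv C (Braid C (Dom C f) X)" and ?E = "Inv C (Braid C (Cod C f) X)"
  note D = unbraid[OF Obj_Dom[OF assms(1)] assms(2)] and E = unbraid[OF Obj_Cod[OF assms(1)] assms(2)]
  have "Braid C (Cod C f) X \<cdot> (f \<star> Id C X) \<cdot> ?D = (Id C X \<star> f) \<cdot> Braid C (Dom C f) X \<cdot> ?D"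
    using braid_nat[of f "Id C X"] assms D by (intro comp_tail2) simp_all
  also have "\<dots> = Id C X \<star> f" using assms D by simp
  also have "\<dots> = Braid C (Cod C f) X \<cdot> ?E \<cdot> (Id C X \<star> f)"
    using assms E by (simp add: comp_tail[OF E(4)])
  finally show "Braid C (Cod C f) X \<cdot> (f \<star> Id C X) \<cdot> ?D = Braid C (Cod C f) X \<cdot> ?E \<cdot> (Id C X \<star> f)" .
qed (use assms unbraid[of "Dom C f" X] unbraid[of "Cod C f" X] in simp_all)

lemma isomorphic_tensor:
  "\<lbrakk>isomorphic C X X'; isomorphic C Y Y'\<rbrakk> \<Longrightarrow> isomorphic C (X \<otimes> Y) (X' \<otimes> Y')"
  by (elim isomorphicE, rule isomorphicI, erule (1) iso_tensor) (auto simp: iso_arr)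

lemma isomorphic_assoc:
  "\<lbrakk>X \<in> Obj C; Y \<in> Obj C; Z \<in> Obj C\<rbrakk> \<Longrightarrow> isomorphic C ((X \<otimes> Y) \<otimes> Z) (X \<otimes> (Y \<otimes> Z))"
  by (rule isomorphicI[OF Assoc_iso[of X Y Z]]) auto

lemma isomorphic_braid:
  "\<lbrakk>X \<in> Obj C; Y \<in> Obj C\<rbrakk> \<Longrightarrow> isomorphic C (X \<otimes> Y) (Y \<otimes> X)"
  by (rule isomorphicI[OF Braid_iso[of X Y]]) auto

lemma isomorphic_refl: "X \<in> Obj C \<Longrightarrow> isomorphic C X X"
  by (rule isomorphicI[OF iso_Id]) auto

abbreviation act where "act \<equiv> unit_act C"

lemma act_arr [simp]:
  assumes "s \<in> Arr C" "Cod C s = Unit C" "X \<in> Obj C"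
  shows "act s X \<in> Arr C" "Dom C (act s X) = Dom C s \<otimes> X" "Cod C (act s X) = X"
  using assms by (simp_all add: unit_act_def)

text \<open>
Naturality of the action in both variables, oriented so that the simplifier moves actions to the right
and absorbs inclusions of subunits: \<open>act t X \<cdot> (i \<star> Id C X)\<close> becomes \<open>act s X\<close> when \<open>t \<cdot> i = s\<close>.
\<close>

lemma act_tensor [simp]:
  assumes "s \<in> Arr C" "Cod C s = Unit C" "f \<in> Arr C" "Cod C f = Dom C s" "g \<in> Arr C" "Cod C g = Y"
  shows "act s Y \<cdot> (f \<star> g) = g \<cdot> act (s \<cdot> f) (Dom C g)"
proof -
  have "act s Y \<cdot> (f \<star> g) = Lunit C Y \<cdot> (Id C (Unit C) \<star> g) \<cdot> ((s \<cdot> f) \<star> Id C (Dom C g))"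
    using assms Obj_Cod[OF assms(5)] by (simp add: unit_act_def)
  also have "\<dots> = g \<cdot> Lunit C (Dom C g) \<cdot> ((s \<cdot> f) \<star> Id C (Dom C g))"
    using assms lunit_nat[OF assms(5)] by (intro comp_tail2) auto
  finally show ?thesis by (simp add: unit_act_def)
qed

lemma act_tensor_tail [simp]:
  assumes "s \<in> Arr C" "Cod C s = Unit C" "f \<in> Arr C" "Cod C f = Dom C s" "g \<in> Arr C" "Cod C g = Y"
    "h \<in> Arr C" "Cod C h = Dom C f \<otimes> Dom C g"
  shows "act s Y \<cdot> (f \<star> g) \<cdot> h = g \<cdot> act (s \<cdot> f) (Dom C g) \<cdot> h"
  using assms Obj_Cod[OF assms(5)] by (intro comp_tail2) simp_all

lemma act_unit:
  assumes "s \<in> Arr C" "Cod C s = Unit C"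
  shows "act s (Unit C) = s \<cdot> Runit C (Dom C s)"
  using runit_nat[OF assms(1)] assms by (simp add: unit_act_def lunit_unit)

lemma act_iso_iff:
  assumes "s \<in> Arr C" "Cod C s = Unit C" "X \<in> Obj C"
  shows "is_iso C (act s X) \<longleftrightarrow> is_iso C (s \<star> Id C X)"
proof
  assume "is_iso C (s \<star> Id C X)"
  then show "is_iso C (act s X)"
    unfolding unit_act_def using assms by (intro iso_comp Lunit_iso) simp_all
next
  assume a: "is_iso C (act s X)"
  obtain l where l: "l \<in> Arr C" "Dom C l = X" "Cod C l = Unit C \<otimes> X"
    "l \<cdot> Lunit C X = Id C (Unit C \<otimes> X)" "is_iso C l"
    using Lunit_iso[OF assms(3)] assms(3) by (metis isoE isoI lunit_arr(2,3))
  have "is_iso C (l \<cdot> act s X)"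
    using a l assms by (intro iso_comp) simp_all
  moreover have "l \<cdot> act s X = s \<star> Id C X"
    using assms l by (simp add: unit_act_def comp_tail[OF l(4)])
  ultimately show "is_iso C (s \<star> Id C X)" by simp
qed

text \<open>
By naturality of the action, invertibility of \<open>act s Y\<close> is a property of the isomorphism class of \<open>Y\<close>.
It can thus be moved along any composite of associators and braidings.
\<close>

lemma act_iso_isomorphic:
  assumes s: "s \<in> Arr C" "Cod C s = Unit C" and act: "is_iso C (act s Y)" and iso: "isomorphic C Y Z"
  shows "is_iso C (act s Z)"
proof -
  obtain f g where f: "is_iso C f" "f \<in> Arr C" "Dom C f = Y" "Cod C f = Z"
    and g: "is_iso C g" "g \<in> Arr C" "Dom C g = Z" "Cod C g = Y" "f \<cdot> g = Id C Z"
  proof -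
    obtain f where f: "is_iso C f" "Dom C f = Y" "Cod C f = Z"
      using iso by (rule isomorphicE)
    obtain g where g: "f \<in> Arr C" "g \<in> Arr C" "Dom C g = Cod C f" "Cod C g = Dom C f"
      "g \<cdot> f = Id C (Dom C f)" "f \<cdot> g = Id C (Cod C f)"
      using f(1) by (rule isoE)
    show thesis
      by (rule that[of f g]) (use f g in \<open>auto intro: isoI[of g f]\<close>)
  qed
  have obj: "Y \<in> Obj C" "Z \<in> Obj C" using f(2-4) Obj_Dom Obj_Cod by blast+
  have "is_iso C (f \<cdot> act s Y \<cdot> (Id C (Dom C s) \<star> g))"
    using s f g obj act by (intro iso_comp iso_tensor iso_Id) simp_all
  also have "f \<cdot> act s Y \<cdot> (Id C (Dom C s) \<star> g) = act s Z"
    using s f g obj by (simp add: comp_tail[OF g(5)])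
  finally show ?thesis .
qed

lemma act_tensor_dom:
  assumes "s \<in> Arr C" "Cod C s = Unit C" "X \<in> Obj C" "Y \<in> Obj C"
  shows "act s X \<star> Id C Y = act s (X \<otimes> Y) \<cdot> Assoc C (Dom C s) X Y"
proof -
  have "act s X \<star> Id C Y = (Lunit C X \<star> Id C Y) \<cdot> ((s \<star> Id C X) \<star> Id C Y)"
    using assms by (simp add: unit_act_def)
  also have "\<dots> = Lunit C (X \<otimes> Y) \<cdot> Assoc C (Unit C) X Y \<cdot> ((s \<star> Id C X) \<star> Id C Y)"
    using assms by (intro comp_tail[symmetric] lunit_tensor) simp_all
  also have "\<dots> = act s (X \<otimes> Y) \<cdot> Assoc C (Dom C s) X Y"
    using assms assoc_nat[of s "Id C X" "Id C Y"] by (simp add: unit_act_def)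
  finally show ?thesis .
qed

end

section \<open>Subunits in a stiff category\<close>

context stiff_category
begin

lemma subunit_arr [simp]: "subunit C s \<Longrightarrow> s \<in> Arr C"
  by (simp add: subunit_def monic_arr)

lemma subunit_cod [simp]: "subunit C s \<Longrightarrow> Cod C s = Unit C"
  by (simp add: subunit_def)

lemma subunit_monic: "subunit C s \<Longrightarrow> monic C s"
  by (simp add: subunit_def)

lemma subunit_iff_act:
  "subunit C s \<longleftrightarrow> monic C s \<and> Cod C s = Unit C \<and> is_iso C (act s (Dom C s))"
  by (auto simp: subunit_def act_iso_iff monic_arr)

lemma stiff_pullback:
  assumes "subunit C s" "subunit C t" "X \<in> Obj C"
  shows "is_pullback C (act s (Dom C t \<otimes> X)) (Id C (Dom C s) \<star> act t X) (act t X) (act s X)"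
    and "monic C (Id C (Dom C s) \<star> act t X)"
  using stiff assms unfolding stiff_def Let_def by blast+

lemma act_monic: "\<lbrakk>subunit C s; X \<in> Obj C\<rbrakk> \<Longrightarrow> monic C (act s X)"
  using stiff unfolding stiff_def Let_def by blast

lemma act_cancel:
  assumes "subunit C s" "act s X \<cdot> f = act s X \<cdot> g" "X \<in> Obj C" "f \<in> Arr C" "g \<in> Arr C"
    "Cod C f = Dom C s \<otimes> X" "Cod C g = Dom C s \<otimes> X" "Dom C f = Dom C g"
  shows "f = g"
  by (rule monicD[OF act_monic]) (use assms in auto)

text \<open>
Stiffness, phrased on generalised elements: points of \<open>S \<otimes> X\<close> and \<open>T \<otimes> X\<close> that agree in \<open>X\<close> come from
the intersection \<open>S \<otimes> (T \<otimes> X)\<close>.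
\<close>

lemma overlap_factor:
  assumes "subunit C s" "subunit C t" "X \<in> Obj C"
    and "x \<in> Arr C" "Cod C x = Dom C s \<otimes> X" "y \<in> Arr C" "Cod C y = Dom C t \<otimes> X" "Dom C x = Dom C y"
    and "act s X \<cdot> x = act t X \<cdot> y"
  obtains u where "u \<in> Arr C" "Dom C u = Dom C x" "Cod C u = Dom C s \<otimes> (Dom C t \<otimes> X)"
    "(Id C (Dom C s) \<star> act t X) \<cdot> u = x" "act s (Dom C t \<otimes> X) \<cdot> u = y"
proof -
  have "commuting_square C y x (act t X) (act s X)"
    using assms by (simp add: commuting_square_def)
  then obtain u where u: "u \<in> Hom C (Dom C y) (Dom C (act s (Dom C t \<otimes> X)))"
    "(Id C (Dom C s) \<star> act t X) \<cdot> u = x" "act s (Dom C t \<otimes> X) \<cdot> u = y"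
    using stiff_pullback(1)[OF assms(1-3)] unfolding is_pullback_def by blast
  show ?thesis
    by (rule that[OF _ _ _ u(2,3)]) (use u(1) assms in \<open>simp_all add: arr_Hom\<close>)
qed

text \<open>
In the stiff square for \<open>t = s\<close>, the pair of identities factors through the pullback, which gives a section
of the monomorphism in question.
\<close>

lemma act_iso_self:
  assumes "subunit C s" "X \<in> Obj C"
  shows "is_iso C (act s (Dom C s \<otimes> X))"
proof -
  obtain u where u: "u \<in> Arr C" "Dom C u = Dom C s \<otimes> X" "Cod C u = Dom C s \<otimes> (Dom C s \<otimes> X)"
    "act s (Dom C s \<otimes> X) \<cdot> u = Id C (Dom C s \<otimes> X)"
    by (rule overlap_factor[of s s X "Id C (Dom C s \<otimes> X)" "Id C (Dom C s \<otimes> X)"])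
      (use assms in simp_all)
  then show ?thesis
    by (intro monic_section_iso[OF act_monic]) (use assms in simp_all)
qed

lemma act_section:
  assumes "subunit C s" "is_iso C (act s Y)" "Y \<in> Obj C"
  obtains d where "d \<in> Arr C" "Dom C d = Y" "Cod C d = Dom C s \<otimes> Y" "act s Y \<cdot> d = Id C Y"
  using assms(2) by (rule isoE) (use assms that in simp)

text \<open>
If \<open>Y\<close> lies inside \<open>s\<close>, in the sense that \<open>act s Y\<close> is invertible, then so does every map out of \<open>Y\<close>:
compose a section \<open>Y \<rightarrow> S \<otimes> Y\<close> with \<open>S \<otimes> f\<close>.
\<close>

lemma act_lift:
  assumes "subunit C s" "is_iso C (act s (Dom C f))" "f \<in> Arr C"
  obtains g where "g \<in> Arr C" "Dom C g = Dom C f" "Cod C g = Dom C s \<otimes> Cod C f" "act s (Cod C f) \<cdot> g = f"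
proof -
  obtain d where d: "d \<in> Arr C" "Dom C d = Dom C f" "Cod C d = Dom C s \<otimes> Dom C f"
    "act s (Dom C f) \<cdot> d = Id C (Dom C f)"
    using act_section[OF assms(1,2)] assms(3) by auto
  show ?thesis
    by (rule that[of "(Id C (Dom C s) \<star> f) \<cdot> d"]) (use assms d in simp_all)
qed

lemma act_iso_isomorphic_tensor:
  assumes "subunit C s" "Y \<in> Obj C" "is_iso C (act s Y)"
  shows "isomorphic C Y (Dom C s \<otimes> Y)"
  using assms by (intro isomorphic_sym[OF isomorphicI[of "act s Y"]]) auto

text \<open>
Up to isomorphism \<open>Y\<close> is \<open>T \<otimes> Y\<close>, hence \<open>Z \<otimes> Y\<close> is \<open>T \<otimes> (Z \<otimes> Y)\<close> by the braiding.
\<close>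

lemma act_iso_tensor:
  assumes t: "subunit C t" and Y: "Y \<in> Obj C" and Z: "Z \<in> Obj C" and iso: "is_iso C (act t Y)"
  shows "is_iso C (act t (Z \<otimes> Y))"
proof -
  let ?T = "Dom C t"
  have T: "?T \<in> Obj C" using t by simp
  have "isomorphic C (?T \<otimes> (Z \<otimes> Y)) ((?T \<otimes> Z) \<otimes> Y)"
    using T Y Z by (intro isomorphic_sym[OF isomorphic_assoc])
  also have "isomorphic C \<dots> ((Z \<otimes> ?T) \<otimes> Y)"
    using T Y Z by (intro isomorphic_tensor isomorphic_braid isomorphic_refl)
  also have "isomorphic C \<dots> (Z \<otimes> (?T \<otimes> Y))"
    using T Y Z by (intro isomorphic_assoc)
  also have "isomorphic C \<dots> (Z \<otimes> Y)"
    using assms by (intro isomorphic_tensor isomorphic_refl isomorphic_sym[OF act_iso_isomorphic_tensor])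
  finally show ?thesis
    using act_iso_isomorphic[of t "?T \<otimes> (Z \<otimes> Y)" "Z \<otimes> Y"] act_iso_self[of t "Z \<otimes> Y"] assms by simp
qed

lemma sub_meet_arr [simp]:
  assumes "s \<in> Arr C" "t \<in> Arr C" "Cod C s = Unit C" "Cod C t = Unit C"
  shows "sub_meet C s t \<in> Arr C" "Dom C (sub_meet C s t) = Dom C s \<otimes> Dom C t" "Cod C (sub_meet C s t) = Unit C"
  using assms by (simp_all add: sub_meet_def)

lemma sub_meet_right:
  assumes "s \<in> Arr C" "t \<in> Arr C" "Cod C s = Unit C" "Cod C t = Unit C"
  shows "t \<cdot> act s (Dom C t) = sub_meet C s t"
proof -
  have "sub_meet C s t = Lunit C (Unit C) \<cdot> (Id C (Unit C) \<star> t) \<cdot> (s \<star> Id C (Dom C t))"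
    using assms by (simp add: sub_meet_def)
  also have "\<dots> = t \<cdot> Lunit C (Dom C t) \<cdot> (s \<star> Id C (Dom C t))"
    using assms lunit_nat[of t] by (intro comp_tail2) simp_all
  finally show ?thesis by (simp add: unit_act_def)
qed

lemma sub_meet_left:
  assumes "s \<in> Arr C" "t \<in> Arr C" "Cod C s = Unit C" "Cod C t = Unit C"
  shows "s \<cdot> Runit C (Dom C s) \<cdot> (Id C (Dom C s) \<star> t) = sub_meet C s t"
proof -
  have "sub_meet C s t = act s (Unit C) \<cdot> (Id C (Dom C s) \<star> t)"
    using assms sub_meet_right[OF assms] by simp
  then show ?thesis using assms by (simp add: act_unit)
qed

text \<open>
With \<open>R = S \<otimes> T\<close>, the action of \<open>s \<and> t\<close> on \<open>R\<close> is the action of \<open>s\<close> on \<open>T \<otimes> R\<close> followed by that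
of \<open>t\<close> on \<open>R\<close>.  Both are invertible because \<open>R\<close> contains \<open>S\<close> and \<open>T\<close> as tensor factors.
\<close>

lemma subunit_sub_meet:
  assumes s: "subunit C s" and t: "subunit C t"
  shows "subunit C (sub_meet C s t)"
proof -
  let ?S = "Dom C s" and ?T = "Dom C t" and ?r = "sub_meet C s t"
  let ?R = "?S \<otimes> ?T"
  have "monic C (t \<cdot> act s ?T)"
    using s t by (intro monic_comp act_monic subunit_monic) simp_all
  then have "monic C ?r" using s t by (simp add: sub_meet_right)
  moreover have "is_iso C (act t ?R)"
    using s t by (intro act_iso_isomorphic[OF _ _ act_iso_self isomorphic_braid]) simp_all
  moreover have "is_iso C (act s (?T \<otimes> ?R))"
    using s t by (intro act_iso_tensor act_iso_self) simp_all
  ultimately have "is_iso C (act t ?R \<cdot> act s (?T \<otimes> ?R) \<cdot> Assoc C ?S ?T ?R)"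
    using s t by (intro iso_comp Assoc_iso) simp_all
  moreover have "act ?r ?R = act t ?R \<cdot> (act s ?T \<star> Id C ?R)"
    using s t by (simp add: sub_meet_right)
  ultimately show ?thesis
    using s t \<open>monic C ?r\<close> by (simp add: subunit_iff_act act_tensor_dom del: act_tensor)
qed

lemma act_iso_sub_meet:
  assumes "subunit C s" "subunit C t" "Y \<in> Obj C" "is_iso C (act s Y)" "is_iso C (act t Y)"
  shows "is_iso C (act (sub_meet C s t) Y)"
proof -
  have "isomorphic C ((Dom C s \<otimes> Dom C t) \<otimes> Y) (Dom C s \<otimes> (Dom C t \<otimes> Y))"
    using assms by (intro isomorphic_assoc) simp_all
  also have "isomorphic C \<dots> (Dom C s \<otimes> Y)"
    using assms by (intro isomorphic_tensor isomorphic_refl isomorphic_sym[OF act_iso_isomorphic_tensor]) simp_all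
  also have "isomorphic C \<dots> Y"
    using assms by (intro isomorphic_sym[OF act_iso_isomorphic_tensor])
  finally show ?thesis
    using act_iso_isomorphic[of "sub_meet C s t" "(Dom C s \<otimes> Dom C t) \<otimes> Y" Y]
      act_iso_self[OF subunit_sub_meet, of s t Y] assms by simp
qed

text \<open>
A section of \<open>act r Y\<close>, composed with the inclusion of \<open>R\<close> into \<open>S\<close>, is a section of the monomorphism
\<open>act s Y\<close>.
\<close>

lemma act_iso_mono:
  assumes "subunit C r" "subunit C s" "Y \<in> Obj C" "is_iso C (act r Y)"
    "f \<in> Arr C" "Dom C f = Dom C r" "Cod C f = Dom C s" "s \<cdot> f = r"
  shows "is_iso C (act s Y)"
proof -
  obtain d where d: "d \<in> Arr C" "Dom C d = Y" "Cod C d = Dom C r \<otimes> Y" "act r Y \<cdot> d = Id C Y"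
    using act_section[OF assms(1,4,3)] .
  show ?thesis
    by (rule monic_section_iso[OF act_monic, of _ _ "(f \<star> Id C Y) \<cdot> d"]) (use assms(2,3,5-7) d in \<open>simp_all add: assms(8)\<close>)
qed

end

section \<open>The order of subunits\<close>

context stiff_category
begin

abbreviation sub_le (infix \<open>\<preceq>\<close> 50) where "s \<preceq> t \<equiv> s \<sqsubseteq>\<^bsub>ISub C\<^esub> t"

lemma carrier_ISub [simp]: "s \<in> carrier (ISub C) \<longleftrightarrow> subunit C s"
  by (simp add: ISub_def)

lemma sub_le_iff:
  "s \<preceq> t \<longleftrightarrow> (\<exists>f. f \<in> Arr C \<and> Dom C f = Dom C s \<and> Cod C f = Dom C t \<and> t \<cdot> f = s)"
  by (auto simp: ISub_def arr_Hom)

lemma sub_leI: "\<lbrakk>f \<in> Arr C; Dom C f = Dom C s; Cod C f = Dom C t; t \<cdot> f = s\<rbrakk> \<Longrightarrow> s \<preceq> t"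
  by (auto simp: sub_le_iff)

lemma incl_unique:
  assumes "monic C t" "f \<in> Arr C" "Dom C f = Dom C s" "Cod C f = Dom C t" "t \<cdot> f = s"
  shows "incl C s t = f"
  unfolding incl_def
proof (rule the_equality)
  fix g assume g: "g \<in> Hom C (Dom C s) (Dom C t) \<and> t \<cdot> g = s"
  show "g = f"
    by (rule monicD[OF assms(1)]) (use assms(2-5) g in \<open>simp_all add: arr_Hom\<close>)
qed (use assms in \<open>auto simp: arr_Hom\<close>)

lemma incl_arr [simp]:
  assumes "s \<preceq> t" "subunit C t"
  shows "incl C s t \<in> Arr C" "Dom C (incl C s t) = Dom C s" "Cod C (incl C s t) = Dom C t" "t \<cdot> incl C s t = s"
proof -
  obtain f where "f \<in> Arr C" "Dom C f = Dom C s" "Cod C f = Dom C t" "t \<cdot> f = s"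
    using assms(1) by (auto simp: sub_le_iff)
  then show "incl C s t \<in> Arr C" "Dom C (incl C s t) = Dom C s" "Cod C (incl C s t) = Dom C t" "t \<cdot> incl C s t = s"
    using incl_unique[OF subunit_monic[OF assms(2)], of f s] by simp_all
qed

lemma sub_le_refl: "subunit C s \<Longrightarrow> s \<preceq> s"
  by (rule sub_leI[of "Id C (Dom C s)"]) auto

lemma sub_le_trans:
  assumes "subunit C s" "subunit C t" "r \<preceq> s" "s \<preceq> t" shows "r \<preceq> t"
proof (rule sub_leI[of "incl C s t \<cdot> incl C r s"])
  show "t \<cdot> incl C s t \<cdot> incl C r s = r"
    using assms by (simp add: comp_tail[OF incl_arr(4)[OF assms(4,2)]])
qed (use assms in simp_all)

lemma incl_iso:
  assumes "s \<preceq> t" "t \<preceq> s" "subunit C s" "subunit C t"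
  shows "is_iso C (incl C s t)"
proof (rule isoI)
  show "incl C t s \<cdot> incl C s t = Id C (Dom C (incl C s t))"
    by (rule monicD[OF subunit_monic[OF assms(3)]])
      (use assms in \<open>simp_all add: comp_tail[OF incl_arr(4)]\<close>)
  show "incl C s t \<cdot> incl C t s = Id C (Cod C (incl C s t))"
    by (rule monicD[OF subunit_monic[OF assms(4)]])
      (use assms in \<open>simp_all add: comp_tail[OF incl_arr(4)]\<close>)
qed (use assms in simp_all)

lemma sub_eq_iff:
  assumes "subunit C s" "subunit C t"
  shows "s .=\<^bsub>ISub C\<^esub> t \<longleftrightarrow> s \<preceq> t \<and> t \<preceq> s"
proof
  assume "s .=\<^bsub>ISub C\<^esub> t"
  then obtain f where f: "is_iso C f" "Dom C f = Dom C s" "Cod C f = Dom C t" "t \<cdot> f = s"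
    by (auto simp: ISub_def arr_Hom)
  then obtain g where g: "f \<in> Arr C" "g \<in> Arr C" "Dom C g = Dom C t" "Cod C g = Dom C s" "f \<cdot> g = Id C (Dom C t)"
    by (metis isoE)
  have "s \<cdot> g = t" using assms f g comp_assoc[of g f t] by simp
  then show "s \<preceq> t \<and> t \<preceq> s" using f g by (auto intro: sub_leI)
next
  assume a: "s \<preceq> t \<and> t \<preceq> s"
  have "incl C s t \<in> Hom C (Dom C s) (Dom C t)" "is_iso C (incl C s t)" "t \<cdot> incl C s t = s"
    using a assms by (simp_all add: incl_iso arr_Hom)
  then show "s .=\<^bsub>ISub C\<^esub> t"
    unfolding ISub_def eq_object.simps by blast
qed

lemma ISub_weak_partial_order: "weak_partial_order (ISub C)"
proof
  show "x .=\<^bsub>ISub C\<^esub> z" if "x .=\<^bsub>ISub C\<^esub> y" "y .=\<^bsub>ISub C\<^esub> z"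
    "x \<in> carrier (ISub C)" "y \<in> carrier (ISub C)" "z \<in> carrier (ISub C)" for x y z
    using that unfolding carrier_ISub by (metis sub_eq_iff sub_le_trans)
  show "(x \<preceq> z) = (y \<preceq> w)" if "x .=\<^bsub>ISub C\<^esub> y" "z .=\<^bsub>ISub C\<^esub> w"
    "x \<in> carrier (ISub C)" "y \<in> carrier (ISub C)" "z \<in> carrier (ISub C)" "w \<in> carrier (ISub C)"
    for x y z w
    using that unfolding carrier_ISub by (metis sub_eq_iff sub_le_trans)
  show "x \<preceq> z" if "x \<preceq> y" "y \<preceq> z" "y \<in> carrier (ISub C)" "z \<in> carrier (ISub C)" for x y z
    using sub_le_trans[OF _ _ that(1,2)] that(3,4) by simp
qed (simp_all add: sub_eq_iff sub_le_refl)

lemma sub_meet_le: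
  assumes "subunit C s" "subunit C t"
  shows "sub_meet C s t \<preceq> s" "sub_meet C s t \<preceq> t"
  using assms sub_meet_left[of s t] sub_meet_right[of s t]
  by (intro sub_leI[of "Runit C (Dom C s) \<cdot> (Id C (Dom C s) \<star> t)"] sub_leI[of "act s (Dom C t)"]; simp)+

text \<open>
Since \<open>R\<close> lies inside \<open>s\<close>, its inclusion into \<open>T\<close> factors through \<open>act s T : S \<otimes> T \<rightarrow> T\<close>.
\<close>

lemma le_sub_meet:
  assumes "subunit C r" "subunit C s" "subunit C t" "r \<preceq> s" "r \<preceq> t"
  shows "r \<preceq> sub_meet C s t"
proof -
  have "is_iso C (act s (Dom C r))"
    using assms by (intro act_iso_mono[of r s _ "incl C r s"]) (auto simp: subunit_iff_act)
  then obtain g where g: "g \<in> Arr C" "Dom C g = Dom C r" "Cod C g = Dom C s \<otimes> Dom C t"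
    "act s (Dom C t) \<cdot> g = incl C r t"
    using assms act_lift[of s "incl C r t"] by auto
  have "sub_meet C s t \<cdot> g = t \<cdot> act s (Dom C t) \<cdot> g"
    using assms g by (simp add: sub_meet_right[symmetric])
  then show ?thesis using assms g by (intro sub_leI[of g]) simp_all
qed

lemma incl_trans [simp]:
  assumes "subunit C s" "subunit C t" "r \<preceq> s" "s \<preceq> t"
  shows "incl C s t \<cdot> incl C r s = incl C r t"
proof (rule incl_unique[symmetric])
  show "t \<cdot> incl C s t \<cdot> incl C r s = r"
    using assms by (simp add: comp_tail[OF incl_arr(4)[OF assms(4,2)]])
qed (use assms in \<open>simp_all add: subunit_monic\<close>)

end

section \<open>Matching families and covers\<close>

context stiff_category
begin

text \<open>
The maps \<open>act a X\<close> make every \<open>A \<otimes> X\<close> a subobject of \<open>X\<close>; the last clause says that the family agrees on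
the intersections of these subobjects.  Quantifying over test maps \<open>x\<close>, \<open>y\<close> keeps the definition symmetric
and free of associators.
\<close>

definition matching :: "'b set \<Rightarrow> 'a \<Rightarrow> 'a \<Rightarrow> ('b \<Rightarrow> 'b) \<Rightarrow> bool" where
  "matching A X L c \<longleftrightarrow> L \<in> Obj C \<and>
     (\<forall>a\<in>A. c a \<in> Arr C \<and> Dom C (c a) = Dom C a \<otimes> X \<and> Cod C (c a) = L) \<and>
     (\<forall>a\<in>A. \<forall>b\<in>A. \<forall>x y. x \<in> Arr C \<and> y \<in> Arr C \<and> Dom C x = Dom C y \<and>
        Cod C x = Dom C a \<otimes> X \<and> Cod C y = Dom C b \<otimes> X \<and> act a X \<cdot> x = act b X \<cdot> y \<longrightarrow>
        c a \<cdot> x = c b \<cdot> y)"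

lemma matching_Obj: "matching A X L c \<Longrightarrow> L \<in> Obj C"
  by (simp add: matching_def)

lemma matching_arr:
  assumes "matching A X L c" "a \<in> A"
  shows "c a \<in> Arr C" "Dom C (c a) = Dom C a \<otimes> X" "Cod C (c a) = L"
  using assms by (simp_all add: matching_def)

lemma matching_agree:
  assumes "matching A X L c" "a \<in> A" "b \<in> A" "act a X \<cdot> x = act b X \<cdot> y"
    "x \<in> Arr C" "y \<in> Arr C" "Dom C x = Dom C y" "Cod C x = Dom C a \<otimes> X" "Cod C y = Dom C b \<otimes> X"
  shows "c a \<cdot> x = c b \<cdot> y"
  using assms unfolding matching_def by blast

lemma matchingI:
  assumes "L \<in> Obj C"
    "\<And>a. a \<in> A \<Longrightarrow> c a \<in> Arr C \<and> Dom C (c a) = Dom C a \<otimes> X \<and> Cod C (c a) = L"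
    "\<And>a b x y. \<lbrakk>a \<in> A; b \<in> A; x \<in> Arr C; y \<in> Arr C; Dom C x = Dom C y; Cod C x = Dom C a \<otimes> X;
       Cod C y = Dom C b \<otimes> X; act a X \<cdot> x = act b X \<cdot> y\<rbrakk> \<Longrightarrow> c a \<cdot> x = c b \<cdot> y"
  shows "matching A X L c"
  using assms unfolding matching_def by blast

lemma matching_subset: "matching U X L c \<Longrightarrow> A \<subseteq> U \<Longrightarrow> matching A X L c"
  unfolding matching_def by blast

text \<open>
Restrictions of a map on \<open>J \<otimes> X\<close> match because \<open>act j X\<close> is monic, so that agreement in \<open>X\<close> is already
agreement in \<open>J \<otimes> X\<close>.
\<close>

lemma matching_restrict:
  assumes "subunit C j" "X \<in> Obj C" "\<And>a. a \<in> A \<Longrightarrow> subunit C a \<and> a \<preceq> j"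
    "w \<in> Arr C" "Dom C w = Dom C j \<otimes> X"
  shows "matching A X (Cod C w) (\<lambda>a. w \<cdot> (incl C a j \<star> Id C X))"
proof (rule matchingI)
  fix a b x y
  assume ab: "a \<in> A" "b \<in> A" and xy: "x \<in> Arr C" "y \<in> Arr C" "Dom C x = Dom C y"
    "Cod C x = Dom C a \<otimes> X" "Cod C y = Dom C b \<otimes> X" "act a X \<cdot> x = act b X \<cdot> y"
  have sub: "subunit C a" "a \<preceq> j" "subunit C b" "b \<preceq> j" using assms(3) ab by auto
  have "(incl C a j \<star> Id C X) \<cdot> x = (incl C b j \<star> Id C X) \<cdot> y"
    by (rule act_cancel[OF assms(1)]) (use assms(1,2) sub xy in simp_all)
  then show "(w \<cdot> (incl C a j \<star> Id C X)) \<cdot> x = (w \<cdot> (incl C b j \<star> Id C X)) \<cdot> y"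
    using assms(1,2,4,5) sub xy by simp
qed (use assms in auto)

text \<open>
The sheaf condition for the family \<open>A\<close>, required after tensoring with any object \<open>X\<close>.
\<close>

definition covers :: "'b set \<Rightarrow> 'b \<Rightarrow> bool" where
  "covers A j \<longleftrightarrow> (\<forall>a\<in>A. subunit C a) \<and> subunit C j \<and> (\<forall>a\<in>A. a \<preceq> j) \<and>
     (\<forall>X\<in>Obj C. \<forall>L c. matching A X L c \<longrightarrow>
        (\<exists>!w. w \<in> Hom C (Dom C j \<otimes> X) L \<and> (\<forall>a\<in>A. w \<cdot> (incl C a j \<star> Id C X) = c a)))"

lemma covers_subunit: "covers A j \<Longrightarrow> subunit C j"
  by (simp add: covers_def)

lemma covers_le: "covers A j \<Longrightarrow> a \<in> A \<Longrightarrow> subunit C a \<and> a \<preceq> j"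
  by (simp add: covers_def)

lemma covers_glue:
  assumes "covers A j" "matching A X L c" "X \<in> Obj C"
  obtains w where "w \<in> Arr C" "Dom C w = Dom C j \<otimes> X" "Cod C w = L"
    "\<And>a. a \<in> A \<Longrightarrow> w \<cdot> (incl C a j \<star> Id C X) = c a"
  using assms unfolding covers_def arr_Hom by metis

lemma covers_ext:
  assumes "covers A j" "X \<in> Obj C" "w \<in> Arr C" "w' \<in> Arr C" "Dom C w = Dom C j \<otimes> X"
    "Dom C w' = Dom C j \<otimes> X" "Cod C w = Cod C w'"
    "\<And>a. a \<in> A \<Longrightarrow> w \<cdot> (incl C a j \<star> Id C X) = w' \<cdot> (incl C a j \<star> Id C X)"
  shows "w = w'"
proof -
  have "matching A X (Cod C w) (\<lambda>a. w \<cdot> (incl C a j \<star> Id C X))"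
    using assms by (intro matching_restrict) (auto simp: covers_def)
  then have "\<exists>!v. v \<in> Hom C (Dom C j \<otimes> X) (Cod C w) \<and>
      (\<forall>a\<in>A. v \<cdot> (incl C a j \<star> Id C X) = w \<cdot> (incl C a j \<star> Id C X))"
    using assms(1,2) unfolding covers_def by blast
  moreover have "w \<in> Hom C (Dom C j \<otimes> X) (Cod C w)" "w' \<in> Hom C (Dom C j \<otimes> X) (Cod C w)"
    using assms(3-7) by (simp_all add: arr_Hom)
  ultimately show ?thesis using assms(8) by metis
qed

lemma coversI:
  assumes "\<And>a. a \<in> A \<Longrightarrow> subunit C a \<and> a \<preceq> j" "subunit C j"
    and "\<And>X L c. \<lbrakk>X \<in> Obj C; matching A X L c\<rbrakk> \<Longrightarrow>
      \<exists>w. w \<in> Arr C \<and> Dom C w = Dom C j \<otimes> X \<and> Cod C w = L \<and> (\<forall>a\<in>A. w \<cdot> (incl C a j \<star> Id C X) = c a)"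
    and "\<And>X w w'. \<lbrakk>X \<in> Obj C; w \<in> Arr C; w' \<in> Arr C; Dom C w = Dom C j \<otimes> X; Dom C w' = Dom C j \<otimes> X;
      Cod C w = Cod C w'; \<forall>a\<in>A. w \<cdot> (incl C a j \<star> Id C X) = w' \<cdot> (incl C a j \<star> Id C X)\<rbrakk> \<Longrightarrow> w = w'"
  shows "covers A j"
  unfolding covers_def
proof (intro conjI ballI allI impI)
  fix X L c assume X: "X \<in> Obj C" and c: "matching A X L c"
  obtain w where w: "w \<in> Arr C" "Dom C w = Dom C j \<otimes> X" "Cod C w = L"
    "\<forall>a\<in>A. w \<cdot> (incl C a j \<star> Id C X) = c a"
    using assms(3)[OF X c] by blast
  show "\<exists>!w. w \<in> Hom C (Dom C j \<otimes> X) L \<and> (\<forall>a\<in>A. w \<cdot> (incl C a j \<star> Id C X) = c a)"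
  proof (rule ex1I)
    show "w \<in> Hom C (Dom C j \<otimes> X) L \<and> (\<forall>a\<in>A. w \<cdot> (incl C a j \<star> Id C X) = c a)"
      using w by (simp add: arr_Hom)
    fix v assume v: "v \<in> Hom C (Dom C j \<otimes> X) L \<and> (\<forall>a\<in>A. v \<cdot> (incl C a j \<star> Id C X) = c a)"
    show "v = w"
      by (rule assms(4)[OF X]) (use v w in \<open>simp_all add: arr_Hom\<close>)
  qed
qed (use assms(1,2) in auto)

lemma covers_cong:
  assumes A: "covers A j" and j': "subunit C j'" "j \<preceq> j'" "j' \<preceq> j"
  shows "covers A j'"
proof (rule coversI)
  have j: "subunit C j" using A by (rule covers_subunit)
  show le: "subunit C a \<and> a \<preceq> j'" if "a \<in> A" for a
    using covers_le[OF A that] j j' sub_le_trans by blast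
  show "\<exists>w. w \<in> Arr C \<and> Dom C w = Dom C j' \<otimes> X \<and> Cod C w = L \<and> (\<forall>a\<in>A. w \<cdot> (incl C a j' \<star> Id C X) = c a)"
    if X: "X \<in> Obj C" and c: "matching A X L c" for X L c
  proof -
    obtain w where w: "w \<in> Arr C" "Dom C w = Dom C j \<otimes> X" "Cod C w = L"
      "\<And>a. a \<in> A \<Longrightarrow> w \<cdot> (incl C a j \<star> Id C X) = c a"
      by (rule covers_glue[OF A c X]) blast
    show ?thesis
      by (rule exI[of _ "w \<cdot> (incl C j' j \<star> Id C X)"]) (use w X j j' le in simp)
  qed
  show "w = w'"
    if X: "X \<in> Obj C" and w: "w \<in> Arr C" "w' \<in> Arr C" "Dom C w = Dom C j' \<otimes> X" "Dom C w' = Dom C j' \<otimes> X"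
      "Cod C w = Cod C w'" "\<forall>a\<in>A. w \<cdot> (incl C a j' \<star> Id C X) = w' \<cdot> (incl C a j' \<star> Id C X)" for X w w'
  proof (rule iso_cancel_right)
    show "is_iso C (incl C j j' \<star> Id C X)"
      using X j j' by (intro iso_tensor incl_iso iso_Id)
    show "w \<cdot> (incl C j j' \<star> Id C X) = w' \<cdot> (incl C j j' \<star> Id C X)"
      by (rule covers_ext[OF A X]) (use w X j j' covers_le[OF A] in simp_all)
  qed (use X w j j' in simp_all)
qed (rule j')

text \<open>
If \<open>t\<close> is an upper bound, the inclusions into \<open>T\<close> form a matching family with \<open>X\<close> the unit, and
gluing them gives the inclusion of \<open>J\<close> into \<open>T\<close>.
\<close>

lemma covers_lub:
  assumes A: "covers A j" shows "is_lub (ISub C) j A"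
proof (rule least_UpperI)
  have j: "subunit C j" using A by (rule covers_subunit)
  fix t assume "t \<in> Upper (ISub C) A"
  then have t: "subunit C t" and le: "\<And>a. a \<in> A \<Longrightarrow> a \<preceq> t"
    using covers_le[OF A] by (auto simp: Upper_def)
  let ?I = "Unit C"
  have *: "matching A ?I (Dom C t) (\<lambda>a. (Runit C (Dom C t) \<cdot> (incl C a t \<star> Id C ?I)))"
    using matching_restrict[of t ?I A "Runit C (Dom C t)"] t le covers_le[OF A] by simp
  obtain w where w: "w \<in> Arr C" "Dom C w = Dom C j \<otimes> ?I" "Cod C w = Dom C t"
    "\<And>a. a \<in> A \<Longrightarrow> w \<cdot> (incl C a j \<star> Id C ?I) = Runit C (Dom C t) \<cdot> (incl C a t \<star> Id C ?I)"
    using covers_glue[OF A *] by auto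
  \<comment> \<open>\<open>w\<close> is defined on \<open>J \<otimes> I\<close>; it lies over the unit because this holds on the pieces\<close>
  have tw: "t \<cdot> w = act j ?I"
  proof (rule covers_ext[OF A Obj_Unit])
    fix a assume a: "a \<in> A"
    have "(t \<cdot> w) \<cdot> (incl C a j \<star> Id C ?I) = (t \<cdot> Runit C (Dom C t)) \<cdot> (incl C a t \<star> Id C ?I)"
      using a w j t le[OF a] covers_le[OF A a] by simp
    also have "\<dots> = act t ?I \<cdot> (incl C a t \<star> Id C ?I)"
      using t by (simp add: act_unit)
    also have "\<dots> = act j ?I \<cdot> (incl C a j \<star> Id C ?I)"
      using t le[OF a] j covers_le[OF A a] by simp
    finally show "(t \<cdot> w) \<cdot> (incl C a j \<star> Id C ?I) = act j ?I \<cdot> (incl C a j \<star> Id C ?I)" .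
  qed (use w t j in simp_all)
  have r: "is_iso C (Runit C (Dom C j))" using j by (intro Runit_iso) simp
  note r = Inv_props[OF r]
  show "j \<preceq> t"
  proof (rule sub_leI)
    have "t \<cdot> w \<cdot> Inv C (Runit C (Dom C j)) = act j ?I \<cdot> Inv C (Runit C (Dom C j))"
      using w t j r tw by (intro comp_tail) simp_all
    then show "t \<cdot> w \<cdot> Inv C (Runit C (Dom C j)) = j"
      using j r by (simp add: act_unit)
  qed (use w r j in simp_all)
qed (use covers_le[OF A] covers_subunit[OF A] in auto)

lemma covers_lub_cong:
  assumes "covers A j" "is_lub (ISub C) j' A" shows "covers A j'"
proof -
  have "is_lub (ISub C) j A" using assms(1) by (rule covers_lub)
  then have "j \<preceq> j'" "j' \<preceq> j" "subunit C j'"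
    using assms(2) by (auto simp: least_def Upper_def)
  then show ?thesis using covers_cong assms(1) by blast
qed

text \<open>
A matching family commutes with inclusions: test the matching condition on the inclusion and an identity.
\<close>

lemma matching_le:
  assumes c: "matching A X L c" and X: "X \<in> Obj C" and ab: "a \<in> A" "b \<in> A" "subunit C a" "subunit C b" "a \<preceq> b"
  shows "c b \<cdot> (incl C a b \<star> Id C X) = c a"
proof -
  have "c b \<cdot> (incl C a b \<star> Id C X) = c a \<cdot> Id C (Dom C a \<otimes> X)"
    by (rule matching_agree[OF c]) (use X ab in simp_all)
  then show ?thesis using matching_arr[OF c ab(1)] X ab by simp
qed

text \<open>
A matching family on \<open>A\<close> extends uniquely to one on any \<open>U\<close> below \<open>A\<close>, by restriction along any chosen
inclusion.  This reduces all questions about covers of idempotent sets to convenient generating sets.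
\<close>

lemma covers_cofinal:
  assumes AU: "A \<subseteq> U" and U: "\<And>u. u \<in> U \<Longrightarrow> subunit C u" and cof: "\<And>u. u \<in> U \<Longrightarrow> \<exists>a\<in>A. u \<preceq> a"
  shows "covers A j \<longleftrightarrow> covers U j"
proof
  assume A: "covers A j"
  have j: "subunit C j" using A by (rule covers_subunit)
  show "covers U j"
  proof (rule coversI)
    show le: "subunit C u \<and> u \<preceq> j" if u: "u \<in> U" for u
    proof -
      obtain a where "a \<in> A" "u \<preceq> a" using cof[OF u] by blast
      then show ?thesis using covers_le[OF A] j U[OF u] sub_le_trans by blast
    qed
    show "\<exists>w. w \<in> Arr C \<and> Dom C w = Dom C j \<otimes> X \<and> Cod C w = L \<and> (\<forall>a\<in>U. w \<cdot> (incl C a j \<star> Id C X) = c a)"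
      if X: "X \<in> Obj C" and c: "matching U X L c" for X L c
    proof -
      obtain w where w: "w \<in> Arr C" "Dom C w = Dom C j \<otimes> X" "Cod C w = L"
        "\<And>a. a \<in> A \<Longrightarrow> w \<cdot> (incl C a j \<star> Id C X) = c a"
        by (rule covers_glue[OF A matching_subset[OF c AU] X]) blast
      have "w \<cdot> (incl C u j \<star> Id C X) = c u" if u: "u \<in> U" for u
      proof -
        obtain a where a: "a \<in> A" "u \<preceq> a" using cof[OF u] by blast
        have sa: "subunit C a" "a \<preceq> j" using covers_le[OF A a(1)] by auto
        have "w \<cdot> (incl C u j \<star> Id C X) = (w \<cdot> (incl C a j \<star> Id C X)) \<cdot> (incl C u a \<star> Id C X)"
          using w(1-3) j X a sa U[OF u] by simp
        also have "\<dots> = c u"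
          using w(4)[OF a(1)] matching_le[OF c X u _ _ _ a(2)] a(1) AU U[OF u] sa by auto
        finally show ?thesis .
      qed
      then show ?thesis using w by blast
    qed
    show "w = w'"
      if "X \<in> Obj C" "w \<in> Arr C" "w' \<in> Arr C" "Dom C w = Dom C j \<otimes> X" "Dom C w' = Dom C j \<otimes> X"
        "Cod C w = Cod C w'" "\<forall>a\<in>U. w \<cdot> (incl C a j \<star> Id C X) = w' \<cdot> (incl C a j \<star> Id C X)" for X w w'
      using that AU by (intro covers_ext[OF A, of X w w']) auto
  qed (rule j)
next
  assume cU: "covers U j"
  have j: "subunit C j" using cU by (rule covers_subunit)
  have leA: "subunit C a \<and> a \<preceq> j" if "a \<in> A" for a
    using covers_le[OF cU] that AU by blast
  obtain f where f: "\<And>u. u \<in> U \<Longrightarrow> f u \<in> A \<and> u \<preceq> f u"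
    using cof by metis
  have fs: "subunit C (f u)" if "u \<in> U" for u
    using f[OF that] leA by blast
  show "covers A j"
  proof (rule coversI)
    show "\<exists>w. w \<in> Arr C \<and> Dom C w = Dom C j \<otimes> X \<and> Cod C w = L \<and> (\<forall>a\<in>A. w \<cdot> (incl C a j \<star> Id C X) = c a)"
      if X: "X \<in> Obj C" and c: "matching A X L c" for X L c
    proof -
      \<comment> \<open>extend the family from \<open>A\<close> to \<open>U\<close> by restriction from the chosen upper bounds\<close>
      let ?c = "\<lambda>u. c (f u) \<cdot> (incl C u (f u) \<star> Id C X)"
      have c': "matching U X L ?c"
      proof (rule matchingI)
        fix u v x y
        assume uv: "u \<in> U" "v \<in> U" and xy: "x \<in> Arr C" "y \<in> Arr C" "Dom C x = Dom C y"
          "Cod C x = Dom C u \<otimes> X" "Cod C y = Dom C v \<otimes> X" "act u X \<cdot> x = act v X \<cdot> y"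
        have "c (f u) \<cdot> (incl C u (f u) \<star> Id C X) \<cdot> x = c (f v) \<cdot> (incl C v (f v) \<star> Id C X) \<cdot> y"
          by (rule matching_agree[OF c]) (use f[OF uv(1)] f[OF uv(2)] fs[OF uv(1)] fs[OF uv(2)] X xy in simp_all)
        then show "?c u \<cdot> x = ?c v \<cdot> y"
          using f[OF uv(1)] f[OF uv(2)] fs[OF uv(1)] fs[OF uv(2)] X xy matching_arr[OF c] by simp
      qed (use f fs X matching_arr[OF c] matching_Obj[OF c] in simp_all)
      obtain w where w: "w \<in> Arr C" "Dom C w = Dom C j \<otimes> X" "Cod C w = L"
        "\<And>u. u \<in> U \<Longrightarrow> w \<cdot> (incl C u j \<star> Id C X) = ?c u"
        by (rule covers_glue[OF cU c' X]) blast
      have "w \<cdot> (incl C a j \<star> Id C X) = c a" if a: "a \<in> A" for a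
        using w(4)[of a] matching_le[OF c X a, of "f a"] f[of a] fs[of a] leA[OF a] a AU by auto
      then show ?thesis using w by blast
    qed
    show "w = w'"
      if X: "X \<in> Obj C" and w: "w \<in> Arr C" "w' \<in> Arr C" "Dom C w = Dom C j \<otimes> X" "Dom C w' = Dom C j \<otimes> X"
        "Cod C w = Cod C w'" and eq: "\<forall>a\<in>A. w \<cdot> (incl C a j \<star> Id C X) = w' \<cdot> (incl C a j \<star> Id C X)" for X w w'
    proof (rule covers_ext[OF cU X w])
      fix u assume u: "u \<in> U"
      have fu: "f u \<in> A" "u \<preceq> f u" "f u \<preceq> j" "subunit C (f u)" using f[OF u] leA by auto
      have "(w \<cdot> (incl C (f u) j \<star> Id C X)) \<cdot> (incl C u (f u) \<star> Id C X)
          = (w' \<cdot> (incl C (f u) j \<star> Id C X)) \<cdot> (incl C u (f u) \<star> Id C X)"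
        using eq fu(1) by simp
      then show "w \<cdot> (incl C u j \<star> Id C X) = w' \<cdot> (incl C u j \<star> Id C X)"
        using w X j fu U[OF u] by simp
    qed
  qed (use j leA in auto)
qed

text \<open>
Downsets provide idempotent sets with prescribed generators.
\<close>

definition downset :: "'b set \<Rightarrow> 'b set" where
  "downset A = {u. subunit C u \<and> (\<exists>a\<in>A. u \<preceq> a)}"

lemma downset_idempotent:
  assumes "\<And>a. a \<in> A \<Longrightarrow> subunit C a"
  shows "meet_idempotent C (downset A)"
  unfolding meet_idempotent_def set_eq_def elem_def
proof (intro conjI ballI)
  fix x assume x: "x \<in> downset A"
  then have s: "subunit C x" "subunit C (sub_meet C x x)" by (simp_all add: downset_def subunit_sub_meet)
  then have "x .=\<^bsub>ISub C\<^esub> sub_meet C x x"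
    by (simp add: sub_eq_iff sub_meet_le le_sub_meet sub_le_refl)
  then show "\<exists>y\<in>{sub_meet C s t |s t. s \<in> downset A \<and> t \<in> downset A}. x .=\<^bsub>ISub C\<^esub> y"
    using x by blast
next
  fix x assume "x \<in> {sub_meet C s t |s t. s \<in> downset A \<and> t \<in> downset A}"
  then obtain s t where st: "x = sub_meet C s t" "s \<in> downset A" "t \<in> downset A" by blast
  then obtain a where a: "a \<in> A" "s \<preceq> a" by (auto simp: downset_def)
  have x: "subunit C x" using st by (simp add: downset_def subunit_sub_meet)
  have "x \<preceq> s" using st by (simp add: downset_def sub_meet_le)
  then have "x \<preceq> a" using a assms[OF a(1)] st(2) sub_le_trans by (auto simp: downset_def)
  then show "\<exists>y\<in>downset A. x .=\<^bsub>ISub C\<^esub> y"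
    using x a by (intro bexI[of _ x]) (auto simp: downset_def sub_eq_iff sub_le_refl)
qed

lemma covers_downset:
  assumes "\<And>a. a \<in> A \<Longrightarrow> subunit C a"
  shows "covers A j \<longleftrightarrow> covers (downset A) j"
  using assms by (intro covers_cofinal) (auto simp: downset_def intro: sub_le_refl)

lemma is_lub_sup:
  assumes "\<exists>j. is_lub (ISub C) j A" shows "is_lub (ISub C) (\<Squnion>\<^bsub>ISub C\<^esub> A) A"
  using assms unfolding sup_def by (rule someI_ex)

end

section \<open>Cocones on the diagrams of an idempotent set\<close>

context stiff_category
begin

text \<open>
Idempotence provides an element of \<open>U\<close> that is equal to \<open>s \<and> t\<close> as a subobject only, whence the two
inequalities for \<open>r\<close> instead of an equation.
\<close>

lemma meet_idempotent_meet:
  assumes "meet_idempotent C U" "s \<in> U" "t \<in> U" "\<And>u. u \<in> U \<Longrightarrow> subunit C u"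
  obtains r where "r \<in> U" "r \<preceq> s" "r \<preceq> t" "sub_meet C s t \<preceq> r"
proof -
  have "sub_meet C s t .\<in>\<^bsub>ISub C\<^esub> U"
    using assms(1-3) unfolding meet_idempotent_def set_eq_def by blast
  then obtain r where r: "r \<in> U" "sub_meet C s t .=\<^bsub>ISub C\<^esub> r" by (auto simp: elem_def)
  have m: "subunit C (sub_meet C s t)" "subunit C r" using assms(2-4) r(1) subunit_sub_meet by auto
  then have "sub_meet C s t \<preceq> r" "r \<preceq> sub_meet C s t" using r(2) by (simp_all add: sub_eq_iff)
  moreover have "sub_meet C s t \<preceq> s" "sub_meet C s t \<preceq> t" using sub_meet_le assms(2-4) by auto
  ultimately show ?thesis using that[of r] r(1) m assms(2-4) sub_le_trans by meson
qed

lemma subunit_diagram_edge: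
  assumes "\<And>u. u \<in> U \<Longrightarrow> subunit C u" "(i, f, j) \<in> Edge (subunit_diagram C U X)"
  shows "i \<in> Node (subunit_diagram C U X) \<and> j \<in> Node (subunit_diagram C U X) \<and> f \<in> Arr C \<and>
    Cod C f = Vertex (subunit_diagram C U X) j"
  using assms(2) by (simp add: subunit_diagram_def arr_Hom)

lemma matching_cocone:
  assumes "\<And>u. u \<in> U \<Longrightarrow> subunit C u" "X \<in> Obj C" "matching U X L c"
  shows "is_cocone C (subunit_diagram C U X) L c"
  unfolding is_cocone_def
proof (intro conjI ballI)
  fix e assume "e \<in> Edge (subunit_diagram C U X)"
  then obtain s f t where e: "e = (s, f, t)" "s \<in> U" "t \<in> U" "f \<in> Arr C" "Dom C f = Dom C s \<otimes> X"
    "Cod C f = Dom C t \<otimes> X" "act t X \<cdot> f = act s X"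
    by (auto simp: subunit_diagram_def arr_Hom)
  have "c t \<cdot> f = c s \<cdot> Id C (Dom C s \<otimes> X)"
    by (rule matching_agree[OF assms(3)]) (use e assms(1,2) in simp_all)
  then show "case e of (s, f, t) \<Rightarrow> c t \<cdot> f = c s"
    using e assms(1,2) matching_arr[OF assms(3)] by simp
qed (use assms matching_Obj[OF assms(3)] matching_arr[OF assms(3)] in \<open>simp_all add: subunit_diagram_def arr_Hom\<close>)

text \<open>
The intersection \<open>S \<otimes> (T \<otimes> X)\<close> lies inside \<open>s\<close> and \<open>t\<close>, hence inside \<open>s \<and> t\<close> and inside the element
\<open>r\<close> of \<open>U\<close> representing it.  Its map to \<open>X\<close> therefore factors through \<open>R \<otimes> X\<close>, and there both sides
restrict to \<open>c r\<close>, because the inclusions of \<open>R \<otimes> X\<close> are edges of the diagram.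
\<close>

lemma cocone_agree_meet:
  assumes U: "\<And>u. u \<in> U \<Longrightarrow> subunit C u" "meet_idempotent C U" and X: "X \<in> Obj C"
    and c: "is_cocone C (subunit_diagram C U X) L c" and st: "s \<in> U" "t \<in> U"
  shows "c s \<cdot> (Id C (Dom C s) \<star> act t X) = c t \<cdot> act s (Dom C t \<otimes> X)"
proof -
  note sub = U(1)[OF st(1)] U(1)[OF st(2)]
  have carr: "c u \<in> Arr C" "Dom C (c u) = Dom C u \<otimes> X" "Cod C (c u) = L" if "u \<in> U" for u
    using cocone_arr[OF c, of u] that by (simp_all add: subunit_diagram_def)
  obtain r where r: "r \<in> U" "r \<preceq> s" "r \<preceq> t" "sub_meet C s t \<preceq> r"
    by (rule meet_idempotent_meet[OF U(2) st U(1)])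
  note rsub = U(1)[OF r(1)]
  let ?W = "Dom C s \<otimes> (Dom C t \<otimes> X)"
  let ?m = "act s X \<cdot> (Id C (Dom C s) \<star> act t X)"
  have m: "?m = act t X \<cdot> act s (Dom C t \<otimes> X)"
    using sub X by simp
  have "is_iso C (act s ?W)" "is_iso C (act t ?W)"
    using sub X by (simp_all add: act_iso_self act_iso_tensor)
  then have "is_iso C (act (sub_meet C s t) ?W)"
    using sub X by (intro act_iso_sub_meet) simp_all
  then have "is_iso C (act r ?W)"
    using sub X r(4) rsub subunit_sub_meet[OF sub]
    by (intro act_iso_mono[of "sub_meet C s t" r _ "incl C (sub_meet C s t) r"]) simp_all
  then obtain g where g: "g \<in> Arr C" "Dom C g = ?W" "Cod C g = Dom C r \<otimes> X" "act r X \<cdot> g = ?m"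
    using act_lift[OF rsub, of ?m] sub X by auto
  have edge: "c u \<cdot> (incl C r u \<star> Id C X) = c r" if "u \<in> U" "r \<preceq> u" for u
  proof -
    have "(r, incl C r u \<star> Id C X, u) \<in> Edge (subunit_diagram C U X)"
      using r(1) rsub that U(1)[OF that(1)] X by (simp add: subunit_diagram_def arr_Hom)
    then show ?thesis using c unfolding is_cocone_def by auto
  qed
  have "(incl C r s \<star> Id C X) \<cdot> g = Id C (Dom C s) \<star> act t X"
    by (rule act_cancel[OF sub(1) _ X]) (use g r sub rsub X in simp_all)
  then have "c s \<cdot> (Id C (Dom C s) \<star> act t X) = c r \<cdot> g"
    using comp_tail[OF edge[OF st(1) r(2)], of g] carr[OF st(1)] g r sub rsub X by simp
  moreover have "(incl C r t \<star> Id C X) \<cdot> g = act s (Dom C t \<otimes> X)"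
    by (rule act_cancel[OF sub(2) _ X]) (use g m r sub rsub X in simp_all)
  then have "c t \<cdot> act s (Dom C t \<otimes> X) = c r \<cdot> g"
    using comp_tail[OF edge[OF st(2) r(3)], of g] carr[OF st(2)] g r sub rsub X by simp
  ultimately show ?thesis by simp
qed

text \<open>
By stiffness it suffices to compare the members of a family on the universal intersection.
\<close>

lemma matchingI_meet:
  assumes A: "\<And>a. a \<in> A \<Longrightarrow> subunit C a" and X: "X \<in> Obj C" and "L \<in> Obj C"
    and c: "\<And>a. a \<in> A \<Longrightarrow> c a \<in> Arr C \<and> Dom C (c a) = Dom C a \<otimes> X \<and> Cod C (c a) = L"
    and meet: "\<And>s t. \<lbrakk>s \<in> A; t \<in> A\<rbrakk> \<Longrightarrow>
      c s \<cdot> (Id C (Dom C s) \<star> act t X) = c t \<cdot> act s (Dom C t \<otimes> X)"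
  shows "matching A X L c"
proof (rule matchingI)
  fix s t x y
  assume st: "s \<in> A" "t \<in> A" and xy: "x \<in> Arr C" "y \<in> Arr C" "Dom C x = Dom C y"
    "Cod C x = Dom C s \<otimes> X" "Cod C y = Dom C t \<otimes> X" "act s X \<cdot> x = act t X \<cdot> y"
  obtain u where u: "u \<in> Arr C" "Dom C u = Dom C x" "Cod C u = Dom C s \<otimes> (Dom C t \<otimes> X)"
    "(Id C (Dom C s) \<star> act t X) \<cdot> u = x" "act s (Dom C t \<otimes> X) \<cdot> u = y"
    by (rule overlap_factor[OF A[OF st(1)] A[OF st(2)] X xy(1,4,2,5,3,6)])
  have "c s \<cdot> (Id C (Dom C s) \<star> act t X) \<cdot> u = c t \<cdot> act s (Dom C t \<otimes> X) \<cdot> u"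
    by (rule comp_tail2[OF meet[OF st]]) (use A[OF st(1)] A[OF st(2)] X u(1-3) c st in simp_all)
  then show "c s \<cdot> x = c t \<cdot> y" by (simp only: u(4,5))
qed (use assms in auto)

lemma cocone_matching:
  assumes U: "\<And>u. u \<in> U \<Longrightarrow> subunit C u" "meet_idempotent C U" and X: "X \<in> Obj C"
    and c: "is_cocone C (subunit_diagram C U X) L c"
  shows "matching U X L c"
proof (rule matchingI_meet[OF U(1) X])
  show "L \<in> Obj C" using c by (simp add: is_cocone_def)
  show "c a \<in> Arr C \<and> Dom C (c a) = Dom C a \<otimes> X \<and> Cod C (c a) = L" if "a \<in> U" for a
    using cocone_arr[OF c, of a] that by (simp add: subunit_diagram_def)
qed (use cocone_agree_meet[OF U X c] in auto)

lemma covers_iff_colimit: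
  assumes U: "\<And>u. u \<in> U \<Longrightarrow> subunit C u" "meet_idempotent C U"
    and j: "subunit C j" "\<And>u. u \<in> U \<Longrightarrow> u \<preceq> j"
  shows "covers U j \<longleftrightarrow> (\<forall>X\<in>Obj C.
    is_colimit C (subunit_diagram C U X) (Dom C j \<otimes> X) (\<lambda>s. incl C s j \<star> Id C X))"
proof -
  have cocone: "is_cocone C (subunit_diagram C U X) (Dom C j \<otimes> X) (\<lambda>s. incl C s j \<star> Id C X)"
    if X: "X \<in> Obj C" for X
  proof -
    have "matching U X (Dom C j \<otimes> X) (\<lambda>s. Id C (Dom C j \<otimes> X) \<cdot> (incl C s j \<star> Id C X))"
      using matching_restrict[of j X U "Id C (Dom C j \<otimes> X)"] X j U by simp
    then have "is_cocone C (subunit_diagram C U X) (Dom C j \<otimes> X)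
        (\<lambda>s. Id C (Dom C j \<otimes> X) \<cdot> (incl C s j \<star> Id C X))"
      by (intro matching_cocone U(1) X)
    then show ?thesis
      using X j U(1) unfolding is_cocone_def by (auto simp: subunit_diagram_def)
  qed
  have "matching U X L c \<longleftrightarrow> is_cocone C (subunit_diagram C U X) L c" if "X \<in> Obj C" for X L c
    using matching_cocone[OF U(1) that] cocone_matching[OF U that] by blast
  then show ?thesis
    using U(1) j cocone unfolding covers_def is_colimit_def
    by (simp add: subunit_diagram_def)
qed

end

section \<open>The colimit conditions\<close>

context stiff_category
begin

text \<open>
It must be shown that \<open>act m K : K \<otimes> K \<rightarrow> K\<close> is invertible.  On \<open>S\<close> its inverse has to be the composite of
a diagonal \<open>S \<rightarrow> S \<otimes> K\<close> with \<open>e s \<star> Id C K\<close>.  These composites form a cocone on the diagram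
with \<open>X\<close> the unit and hence define \<open>u : K \<rightarrow> K \<otimes> K\<close>.  That \<open>u\<close> is a section of \<open>act m K\<close> can be tested on
the \<open>e s\<close>; that it is a retraction can be tested on the \<open>e s \<star> e t\<close>, where it holds because \<open>e s\<close> and
\<open>e t\<close> agree on \<open>S \<otimes> T\<close>, as \<open>m\<close> is monic.
\<close>

lemma colimit_subunit:
  assumes U: "\<And>u. u \<in> U \<Longrightarrow> subunit C u"
    and m: "monic C m" "Dom C m = K" "Cod C m = Unit C"
    and e: "\<And>s. s \<in> U \<Longrightarrow> e s \<in> Arr C \<and> Dom C (e s) = Dom C s \<and> Cod C (e s) = K \<and> m \<cdot> e s = s"
    and col: "\<And>X. X \<in> Obj C \<Longrightarrow> is_colimit C (subunit_diagram C U X) (K \<otimes> X) (\<lambda>s. e s \<star> Id C X)"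
  shows "subunit C m"
proof -
  have mA: "m \<in> Arr C" using m(1) by (rule monic_arr)
  have K: "K \<in> Obj C" using m(2) mA Obj_Dom by blast
  have eA: "e s \<in> Arr C" "Dom C (e s) = Dom C s" "Cod C (e s) = K" "m \<cdot> e s = s" if "s \<in> U" for s
    using e[OF that] by auto
  have ext: "w = w'" if "w \<in> Arr C" "w' \<in> Arr C" "Dom C w = K \<otimes> X" "Dom C w' = K \<otimes> X" "Cod C w = Cod C w'"
    "X \<in> Obj C" "\<And>s. s \<in> U \<Longrightarrow> w \<cdot> (e s \<star> Id C X) = w' \<cdot> (e s \<star> Id C X)" for w w' X
    by (rule colimit_ext[OF col[OF that(6)] that(1-5) subunit_diagram_edge[OF U]])
      (use that(7) in \<open>simp_all add: subunit_diagram_def\<close>)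
  \<comment> \<open>by the braiding, the maps \<open>Id C X \<star> e s\<close> are jointly epic as well\<close>
  have ext': "w = w'" if w: "w \<in> Arr C" "w' \<in> Arr C" "Dom C w = X \<otimes> K" "Dom C w' = X \<otimes> K" "Cod C w = Cod C w'"
    and X: "X \<in> Obj C" and eq: "\<And>s. s \<in> U \<Longrightarrow> w \<cdot> (Id C X \<star> e s) = w' \<cdot> (Id C X \<star> e s)" for w w' X
  proof (rule iso_cancel_right[OF Braid_iso[OF K X]])
    show "w \<cdot> Braid C K X = w' \<cdot> Braid C K X"
    proof (rule ext)
      fix s assume s: "s \<in> U"
      have nat: "Braid C K X \<cdot> (e s \<star> Id C X) = (Id C X \<star> e s) \<cdot> Braid C (Dom C s) X"
        using braid_nat[of "e s" "Id C X"] eA[OF s] X by simp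
      have "(w \<cdot> (Id C X \<star> e s)) \<cdot> Braid C (Dom C s) X = (w' \<cdot> (Id C X \<star> e s)) \<cdot> Braid C (Dom C s) X"
        using eq[OF s] by simp
      then show "(w \<cdot> Braid C K X) \<cdot> (e s \<star> Id C X) = (w' \<cdot> Braid C K X) \<cdot> (e s \<star> Id C X)"
        using w X K eA[OF s] U[OF s] nat by simp
    qed (use w X K in simp_all)
  qed (use w X K in simp_all)
  have "\<exists>g. g \<in> Arr C \<and> Dom C g = Dom C s \<and> Cod C g = Dom C s \<otimes> K \<and> act s K \<cdot> g = e s" if s: "s \<in> U" for s
  proof -
    have "is_iso C (act s (Dom C (e s)))" using U[OF s] eA[OF s] by (simp add: subunit_iff_act)
    then show ?thesis using act_lift[OF U[OF s], of "e s"] eA[OF s] by metis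
  qed
  then obtain g where g: "\<And>s. s \<in> U \<Longrightarrow> g s \<in> Arr C \<and> Dom C (g s) = Dom C s \<and> Cod C (g s) = Dom C s \<otimes> K \<and>
      act s K \<cdot> g s = e s"
    by metis
  have gA: "g s \<in> Arr C" "Dom C (g s) = Dom C s" "Cod C (g s) = Dom C s \<otimes> K" "act s K \<cdot> g s = e s"
    if "s \<in> U" for s using g[OF that] by auto
  \<comment> \<open>\<open>g s\<close> is the diagonal \<open>S \<rightarrow> S \<otimes> K\<close>, and \<open>?\<gamma> s\<close> the intended restriction of the inverse to \<open>S\<close>\<close>
  let ?\<gamma> = "\<lambda>s. (e s \<star> Id C K) \<cdot> g s"
  \<comment> \<open>the diagonals are natural for maps into \<open>S\<close>, provided the source has a diagonal \<open>h\<close>\<close>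
  have lift: "g s \<cdot> x = (x \<star> Id C K) \<cdot> h"
    if s: "s \<in> U" and x: "x \<in> Arr C" "Cod C x = Dom C s"
      and h: "h \<in> Arr C" "Dom C h = Dom C x" "Cod C h = Dom C x \<otimes> K" "act (s \<cdot> x) K \<cdot> h = e s \<cdot> x" for s x h
  proof (rule act_cancel[OF U[OF s] _ K])
    show "act s K \<cdot> g s \<cdot> x = act s K \<cdot> (x \<star> Id C K) \<cdot> h"
      using h x K U[OF s] gA[OF s] eA[OF s] by (simp add: comp_tail[OF gA(4)[OF s]])
  qed (use h x K U[OF s] gA[OF s] in simp_all)
  have agree: "e s \<cdot> x = e t \<cdot> y" if st: "s \<in> U" "t \<in> U" and xy: "x \<in> Arr C" "Cod C x = Dom C s" "y \<in> Arr C"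
    "Cod C y = Dom C t" "Dom C x = Dom C y" "s \<cdot> x = t \<cdot> y" for s t x y
    by (rule monicD[OF m(1)])
      (use st xy m mA eA[OF st(1)] eA[OF st(2)] U[OF st(1)] U[OF st(2)] in
        \<open>simp_all add: comp_tail[OF eA(4)[OF st(1)]] comp_tail[OF eA(4)[OF st(2)]]\<close>)
  have "\<exists>u. u \<in> Arr C \<and> Dom C u = K \<and> Cod C u = K \<otimes> K \<and> (\<forall>s\<in>U. u \<cdot> e s = ?\<gamma> s)"
  proof -
    let ?I = "Unit C"
    have cocone: "is_cocone C (subunit_diagram C U ?I) (K \<otimes> K) (\<lambda>s. ?\<gamma> s \<cdot> Runit C (Dom C s))"
      unfolding is_cocone_def
    proof (intro conjI ballI)
      fix edge assume "edge \<in> Edge (subunit_diagram C U ?I)"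
      then obtain s f t where f: "edge = (s, f, t)" "s \<in> U" "t \<in> U" "f \<in> Arr C" "Dom C f = Dom C s \<otimes> ?I"
        "Cod C f = Dom C t \<otimes> ?I" "act t ?I \<cdot> f = act s ?I"
        by (auto simp: subunit_diagram_def arr_Hom)
      note st = U[OF f(2)] U[OF f(3)] eA[OF f(2)] eA[OF f(3)] gA[OF f(2)] gA[OF f(3)]
      \<comment> \<open>an edge of the diagram with \<open>X\<close> the unit is an inclusion \<open>i : S \<rightarrow> T\<close> in disguise\<close>
      define i where "i = Runit C (Dom C t) \<cdot> f \<cdot> Inv C (Runit C (Dom C s))"
      have i: "i \<in> Arr C" "Dom C i = Dom C s" "Cod C i = Dom C t" "i \<cdot> Runit C (Dom C s) = Runit C (Dom C t) \<cdot> f"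
        using f st by (simp_all add: i_def)
      have "t \<cdot> i = act t ?I \<cdot> f \<cdot> Inv C (Runit C (Dom C s))"
        using f(4-6) st by (simp add: i_def act_unit)
      also have "\<dots> = act s ?I \<cdot> Inv C (Runit C (Dom C s))"
        using f(4-7) st by (intro comp_tail) simp_all
      also have "\<dots> = s" using st by (simp add: act_unit)
      finally have ti: "t \<cdot> i = s" .
      have ei: "e s = e t \<cdot> i"
        using agree[OF f(2,3), of "Id C (Dom C s)" i] st i ti by simp
      have "g t \<cdot> i = (i \<star> Id C K) \<cdot> g s"
        using lift[OF f(3) i(1), of "g s"] st i(2,3) ti ei[symmetric] by simp
      then have "?\<gamma> t \<cdot> i = ?\<gamma> s"
        using st i(1-3) K ei by simp
      then have "(?\<gamma> t \<cdot> i) \<cdot> Runit C (Dom C s) = ?\<gamma> s \<cdot> Runit C (Dom C s)" by simp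
      then have "?\<gamma> t \<cdot> Runit C (Dom C t) \<cdot> f = ?\<gamma> s \<cdot> Runit C (Dom C s)"
        using i st K f(4-6) by simp
      then show "case edge of (s, f, t) \<Rightarrow> (?\<gamma> t \<cdot> Runit C (Dom C t)) \<cdot> f = ?\<gamma> s \<cdot> Runit C (Dom C s)"
        using f(1,4-6) st K by simp
    qed (use K U eA gA in \<open>simp_all add: subunit_diagram_def arr_Hom\<close>)
    obtain u where u: "u \<in> Arr C" "Dom C u = K \<otimes> ?I" "Cod C u = K \<otimes> K"
      "\<And>s. s \<in> U \<Longrightarrow> u \<cdot> (e s \<star> Id C ?I) = ?\<gamma> s \<cdot> Runit C (Dom C s)"
      using colimit_glue[OF col[OF Obj_Unit] cocone] by (auto simp: subunit_diagram_def)
    have "(u \<cdot> Inv C (Runit C K)) \<cdot> e s = ?\<gamma> s" if s: "s \<in> U" for s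
    proof -
      have "(u \<cdot> Inv C (Runit C K)) \<cdot> e s = u \<cdot> (e s \<star> Id C ?I) \<cdot> Inv C (Runit C (Dom C s))"
        using runit_inv_nat[of "e s"] u(1,2) eA[OF s] K by simp
      also have "\<dots> = (?\<gamma> s \<cdot> Runit C (Dom C s)) \<cdot> Inv C (Runit C (Dom C s))"
        using u(1,2) eA[OF s] U[OF s] K by (intro comp_tail u(4)[OF s]) simp_all
      also have "\<dots> = ?\<gamma> s"
        using eA[OF s] gA[OF s] U[OF s] K by simp
      finally show ?thesis .
    qed
    then show ?thesis using u(1-3) K by (intro exI[of _ "u \<cdot> Inv C (Runit C K)"]) simp
  qed
  then obtain u where u: "u \<in> Arr C" "Dom C u = K" "Cod C u = K \<otimes> K" "\<And>s. s \<in> U \<Longrightarrow> u \<cdot> e s = ?\<gamma> s"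
    by blast
  have "act m K \<cdot> u = Id C K"
  proof (rule tensor_unit_faithful)
    show "(act m K \<cdot> u) \<star> Id C (Unit C) = Id C K \<star> Id C (Unit C)"
    proof (rule ext[OF _ _ _ _ _ Obj_Unit])
      fix s assume s: "s \<in> U"
      have "(act m K \<cdot> u) \<cdot> e s = act m K \<cdot> ?\<gamma> s"
        using u m mA eA[OF s] K s by simp
      also have "\<dots> = e s" using m mA eA[OF s] gA[OF s] K by simp
      finally show "((act m K \<cdot> u) \<star> Id C (Unit C)) \<cdot> (e s \<star> Id C (Unit C))
        = (Id C K \<star> Id C (Unit C)) \<cdot> (e s \<star> Id C (Unit C))"
        using u m mA eA[OF s] K by simp
    qed (use u m mA K in simp_all)
  qed (use u m mA K in simp_all)
  moreover have "u \<cdot> act m K = Id C (K \<otimes> K)"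
  proof (rule ext[OF _ _ _ _ _ K])
    fix s assume s: "s \<in> U"
    note sA = U[OF s] eA[OF s] gA[OF s]
    have "u \<cdot> act s K = e s \<star> Id C K"
    proof (rule ext')
      fix t assume t: "t \<in> U"
      note tA = U[OF t] eA[OF t] gA[OF t]
      \<comment> \<open>\<open>?x\<close> and \<open>?y\<close> are the projections of \<open>S \<otimes> T\<close>, and both sides factor through its diagonal \<open>h\<close>\<close>
      let ?r = "sub_meet C s t" and ?x = "Runit C (Dom C s) \<cdot> (Id C (Dom C s) \<star> t)" and ?y = "act s (Dom C t)"
      have r: "subunit C ?r" using sA tA by (simp add: subunit_sub_meet)
      have x: "?x \<in> Arr C" "Dom C ?x = Dom C ?r" "Cod C ?x = Dom C s" "s \<cdot> ?x = ?r"
        using sA tA sub_meet_left[of s t] by simp_all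
      have y: "?y \<in> Arr C" "Dom C ?y = Dom C ?r" "Cod C ?y = Dom C t" "t \<cdot> ?y = ?r"
        using sA tA sub_meet_right[of s t] by simp_all
      have exy: "e s \<cdot> ?x = e t \<cdot> ?y"
        by (rule agree[OF s t x(1,3) y(1,3)]) (simp_all only: x y)
      obtain h where h: "h \<in> Arr C" "Dom C h = Dom C ?r" "Cod C h = Dom C ?r \<otimes> K" "act ?r K \<cdot> h = e t \<cdot> ?y"
        using act_lift[OF r, of "e t \<cdot> ?y"] r y(1-3) tA by (auto simp: subunit_iff_act)
      have "(?x \<star> Id C K) \<cdot> h = Id C (Dom C s) \<star> e t"
      proof (rule act_cancel[OF sA(1) _ K])
        have "act s K \<cdot> (?x \<star> Id C K) \<cdot> h = act ?r K \<cdot> h"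
          using x y h K sA tA by (simp del: comp_assoc)
        also have "\<dots> = act s K \<cdot> (Id C (Dom C s) \<star> e t)"
          using h(4) sA tA by simp
        finally show "act s K \<cdot> (?x \<star> Id C K) \<cdot> h = act s K \<cdot> (Id C (Dom C s) \<star> e t)" .
      qed (use h x K sA tA in simp_all)
      note xh = this
      have "u \<cdot> act s K \<cdot> (Id C (Dom C s) \<star> e t) = (u \<cdot> e t) \<cdot> ?y"
        using u(1-3) sA tA K by simp
      also have "\<dots> = (e t \<star> Id C K) \<cdot> g t \<cdot> ?y"
        unfolding u(4)[OF t] using tA y K by simp
      also have "\<dots> = (e t \<star> Id C K) \<cdot> (?y \<star> Id C K) \<cdot> h"
        using lift[OF t y(1,3) h(1)] h(2-4) y(2,4) by simp
      also have "\<dots> = ((e t \<cdot> ?y) \<star> Id C K) \<cdot> h"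
        using tA y h K by simp
      also have "\<dots> = ((e s \<cdot> ?x) \<star> Id C K) \<cdot> h"
        by (simp only: exy)
      also have "\<dots> = (e s \<star> Id C K) \<cdot> (?x \<star> Id C K) \<cdot> h"
        using sA(1-4) x h K by (simp del: comp_assoc)
      also have "\<dots> = (e s \<star> Id C K) \<cdot> (Id C (Dom C s) \<star> e t)"
        by (simp only: xh)
      finally show "(u \<cdot> act s K) \<cdot> (Id C (Dom C s) \<star> e t) = (e s \<star> Id C K) \<cdot> (Id C (Dom C s) \<star> e t)"
        using u(1-3) sA tA K by simp
    qed (use u(1-3) sA K in simp_all)
    then show "(u \<cdot> act m K) \<cdot> (e s \<star> Id C K) = Id C (K \<otimes> K) \<cdot> (e s \<star> Id C K)"
      using u(1-3) m mA sA K by simp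
  qed (use u m mA K in simp_all)
  ultimately have "is_iso C (act m K)"
    using u m mA K by (intro isoI[of _ u]) simp_all
  then show ?thesis using m by (simp add: subunit_iff_act)
qed

text \<open>
From left to right, the third condition moves the colimit of \<open>D(U, X)\<close> to \<open>K \<otimes> X\<close>, so that
\<open>colimit_subunit\<close> applies to the canonical map \<open>m\<close>.  From right to left, every choice of colimits is
isomorphic to the objects \<open>J \<otimes> X\<close>, for which the canonical maps are \<open>act j I\<close> and, up to the unitor, an
identity.
\<close>

lemma colimit_conditions_iff_covers:
  assumes U: "\<And>u. u \<in> U \<Longrightarrow> subunit C u" "meet_idempotent C U"
  shows "colimit_conditions C U \<longleftrightarrow> (\<exists>j. covers U j)"
proof
  assume cc: "colimit_conditions C U"
  let ?I = "Unit C"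
  obtain K d where Kd: "is_colimit C (subunit_diagram C U ?I) K d"
    using cc Obj_Unit unfolding colimit_conditions_def by blast
  obtain m where m: "canonical_to_unit C U K d m" "monic C m"
    using cc Kd unfolding colimit_conditions_def by blast
  have mA: "m \<in> Arr C" "Dom C m = K" "Cod C m = ?I" "\<And>s. s \<in> U \<Longrightarrow> m \<cdot> unit_leg C d s = s"
    using m(1) by (auto simp: canonical_to_unit_def arr_Hom)
  have dA: "d s \<in> Arr C" "Dom C (d s) = Dom C s \<otimes> ?I" "Cod C (d s) = K" if "s \<in> U" for s
    using cocone_arr[OF colimit_cocone[OF Kd], of s] that by (simp_all add: subunit_diagram_def)
  have eA: "unit_leg C d s \<in> Arr C" "Dom C (unit_leg C d s) = Dom C s" "Cod C (unit_leg C d s) = K"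
    if "s \<in> U" for s
    using dA[OF that] U(1)[OF that] by (simp_all add: unit_leg_def)
  have col: "is_colimit C (subunit_diagram C U X) (K \<otimes> X) (\<lambda>s. unit_leg C d s \<star> Id C X)" if X: "X \<in> Obj C" for X
  proof -
    obtain L c where Lc: "is_colimit C (subunit_diagram C U X) L c"
      using cc X unfolding colimit_conditions_def by blast
    obtain k where k: "canonical_to_tensor C U X L c K d k" "is_iso C k"
      using cc X Lc Kd unfolding colimit_conditions_def by blast
    show ?thesis
      by (rule colimit_transport[OF Lc k(2) _ _ _ subunit_diagram_edge[OF U(1)]])
        (use k(1) in \<open>simp_all add: canonical_to_tensor_def arr_Hom subunit_diagram_def\<close>)
  qed
  have sm: "subunit C m"
    by (rule colimit_subunit[OF U(1) m(2) mA(2,3) _ col]) (use eA mA(4) in simp_all)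
  have le: "s \<preceq> m" and incl: "incl C s m = unit_leg C d s" if "s \<in> U" for s
    using eA[OF that] mA(2) mA(4)[OF that] by (auto intro: sub_leI incl_unique[OF m(2)])
  have "is_colimit C (subunit_diagram C U X) (Dom C m \<otimes> X) (\<lambda>s. incl C s m \<star> Id C X)" if X: "X \<in> Obj C" for X
    by (rule colimit_transport[OF col[OF X] iso_Id[of "K \<otimes> X"] _ _ _ subunit_diagram_edge[OF U(1)]])
      (use X mA(2) incl eA Obj_Dom[OF mA(1)] in \<open>simp_all add: subunit_diagram_def\<close>)
  then have "covers U m"
    using covers_iff_colimit[OF U sm le] by blast
  then show "\<exists>j. covers U j" ..
next
  assume "\<exists>j. covers U j"
  then obtain j where cov: "covers U j" ..
  have j: "subunit C j" "\<And>u. u \<in> U \<Longrightarrow> u \<preceq> j"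
    using covers_subunit[OF cov] covers_le[OF cov] by auto
  let ?I = "Unit C" and ?J = "Dom C j"
  have col: "is_colimit C (subunit_diagram C U X) (?J \<otimes> X) (\<lambda>s. incl C s j \<star> Id C X)" if "X \<in> Obj C" for X
    using covers_iff_colimit[OF U j] cov that by blast
  \<comment> \<open>any other colimit \<open>L\<close> of \<open>D(U, X)\<close> is identified with \<open>J \<otimes> X\<close> by inverse maps \<open>\<phi>\<close> and \<open>\<psi>\<close>\<close>
  have cmp: thesis
    if Lc: "is_colimit C (subunit_diagram C U X) L c" and X: "X \<in> Obj C" and
      thesis: "\<And>\<phi> \<psi>. \<lbrakk>\<phi> \<in> Arr C; Dom C \<phi> = ?J \<otimes> X; Cod C \<phi> = L; \<psi> \<in> Arr C; Dom C \<psi> = L; Cod C \<psi> = ?J \<otimes> X;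
        \<phi> \<cdot> \<psi> = Id C L; \<psi> \<cdot> \<phi> = Id C (?J \<otimes> X); \<And>s. s \<in> U \<Longrightarrow> \<phi> \<cdot> (incl C s j \<star> Id C X) = c s;
        \<And>s. s \<in> U \<Longrightarrow> \<psi> \<cdot> c s = incl C s j \<star> Id C X\<rbrakk> \<Longrightarrow> thesis"
    for X L c thesis
  proof -
    obtain \<phi> where \<phi>: "is_iso C \<phi>" "Dom C \<phi> = ?J \<otimes> X" "Cod C \<phi> = L"
      "\<And>s. s \<in> Node (subunit_diagram C U X) \<Longrightarrow> \<phi> \<cdot> (incl C s j \<star> Id C X) = c s"
      by (rule colimit_unique[OF col[OF X] Lc subunit_diagram_edge[OF U(1)]]) blast+
    obtain \<psi> where \<psi>: "\<phi> \<in> Arr C" "\<psi> \<in> Arr C" "Dom C \<psi> = L" "Cod C \<psi> = ?J \<otimes> X"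
      "\<psi> \<cdot> \<phi> = Id C (?J \<otimes> X)" "\<phi> \<cdot> \<psi> = Id C L"
      using isoE[OF \<phi>(1)] \<phi>(2,3) by metis
    have leg: "\<phi> \<cdot> (incl C s j \<star> Id C X) = c s" if "s \<in> U" for s
      using \<phi>(4) that by (simp add: subunit_diagram_def)
    have "\<psi> \<cdot> c s = incl C s j \<star> Id C X" if "s \<in> U" for s
      using comp_tail[OF \<psi>(5), of "incl C s j \<star> Id C X"] leg[OF that] \<psi> \<phi>(2,3) j U(1) that X by simp
    then show thesis using thesis[OF \<psi>(1) \<phi>(2,3) \<psi>(2-4,6,5) leg] by blast
  qed
  show "colimit_conditions C U"
    unfolding colimit_conditions_def
  proof (intro conjI ballI allI impI)
    show "\<exists>L c. is_colimit C (subunit_diagram C U X) L c" if "X \<in> Obj C" for X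
      using col[OF that] by blast
  next
    fix K d assume Kd: "is_colimit C (subunit_diagram C U ?I) K d"
    obtain \<phi> \<psi> where \<phi>: "\<phi> \<in> Arr C" "Dom C \<phi> = ?J \<otimes> ?I" "Cod C \<phi> = K" "\<psi> \<in> Arr C" "Dom C \<psi> = K"
      "Cod C \<psi> = ?J \<otimes> ?I" "\<phi> \<cdot> \<psi> = Id C K" "\<psi> \<cdot> \<phi> = Id C (?J \<otimes> ?I)"
      "\<And>s. s \<in> U \<Longrightarrow> \<psi> \<cdot> d s = incl C s j \<star> Id C ?I"
      by (rule cmp[OF Kd Obj_Unit]) blast
    have dA: "d s \<in> Arr C" "Dom C (d s) = Dom C s \<otimes> ?I" "Cod C (d s) = K" if "s \<in> U" for s
      using cocone_arr[OF colimit_cocone[OF Kd], of s] that by (simp_all add: subunit_diagram_def)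
    have "(act j ?I \<cdot> \<psi>) \<cdot> unit_leg C d s = s" if s: "s \<in> U" for s
    proof -
      have "(act j ?I \<cdot> \<psi>) \<cdot> unit_leg C d s = act j ?I \<cdot> (\<psi> \<cdot> d s) \<cdot> Inv C (Runit C (Dom C s))"
        using \<phi>(4-6) dA[OF s] U(1)[OF s] j by (simp add: unit_leg_def)
      also have "\<dots> = act s ?I \<cdot> Inv C (Runit C (Dom C s))"
        unfolding \<phi>(9)[OF s] using U(1)[OF s] j s by simp
      also have "\<dots> = s" using U(1)[OF s] by (simp add: act_unit)
      finally show ?thesis .
    qed
    then have "canonical_to_unit C U K d (act j ?I \<cdot> \<psi>)"
      using \<phi> j(1) by (simp add: canonical_to_unit_def arr_Hom)
    moreover have "is_iso C \<psi>" using \<phi>(1-8) by (intro isoI[of \<psi> \<phi>]) simp_all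
    then have "monic C (act j ?I \<cdot> \<psi>)"
      using \<phi>(4-6) j(1) by (intro monic_comp act_monic iso_monic) simp_all
    ultimately show "\<exists>m. canonical_to_unit C U K d m \<and> monic C m" by blast
  next
    fix X L c K d
    assume X: "X \<in> Obj C" and LK: "is_colimit C (subunit_diagram C U X) L c \<and>
        is_colimit C (subunit_diagram C U ?I) K d"
    obtain \<phi> \<psi> where \<phi>: "\<phi> \<in> Arr C" "Dom C \<phi> = ?J \<otimes> ?I" "Cod C \<phi> = K" "\<psi> \<in> Arr C" "Dom C \<psi> = K"
      "Cod C \<psi> = ?J \<otimes> ?I" "\<phi> \<cdot> \<psi> = Id C K" "\<psi> \<cdot> \<phi> = Id C (?J \<otimes> ?I)"
      "\<And>s. s \<in> U \<Longrightarrow> \<phi> \<cdot> (incl C s j \<star> Id C ?I) = d s"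
      by (rule cmp[OF conjunct2[OF LK] Obj_Unit]) blast
    obtain \<theta> \<eta> where \<theta>: "\<eta> \<in> Arr C" "Dom C \<eta> = ?J \<otimes> X" "Cod C \<eta> = L" "\<theta> \<in> Arr C" "Dom C \<theta> = L"
      "Cod C \<theta> = ?J \<otimes> X" "\<eta> \<cdot> \<theta> = Id C L" "\<theta> \<cdot> \<eta> = Id C (?J \<otimes> X)"
      "\<And>s. s \<in> U \<Longrightarrow> \<theta> \<cdot> c s = incl C s j \<star> Id C X"
      by (rule cmp[OF conjunct1[OF LK] X]) blast
    have cA: "c s \<in> Arr C" "Dom C (c s) = Dom C s \<otimes> X" "Cod C (c s) = L" if "s \<in> U" for s
      using cocone_arr[OF colimit_cocone[OF conjunct1[OF LK]], of s] that by (simp_all add: subunit_diagram_def)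
    let ?\<kappa> = "\<phi> \<cdot> Inv C (Runit C ?J)"
    have leg: "?\<kappa> \<cdot> incl C s j = unit_leg C d s" if s: "s \<in> U" for s
    proof -
      have "?\<kappa> \<cdot> incl C s j = \<phi> \<cdot> (incl C s j \<star> Id C ?I) \<cdot> Inv C (Runit C (Dom C s))"
        using runit_inv_nat[of "incl C s j"] \<phi>(1-3) j s U(1)[OF s] by simp
      also have "\<dots> = d s \<cdot> Inv C (Runit C (Dom C s))"
        using \<phi>(1-3) j s U(1)[OF s] by (intro comp_tail \<phi>(9)) simp_all
      finally show ?thesis by (simp add: unit_leg_def)
    qed
    have "((?\<kappa> \<star> Id C X) \<cdot> \<theta>) \<cdot> c s = unit_leg C d s \<star> Id C X" if s: "s \<in> U" for s
    proof -
      have "((?\<kappa> \<star> Id C X) \<cdot> \<theta>) \<cdot> c s = (?\<kappa> \<star> Id C X) \<cdot> \<theta> \<cdot> c s"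
        using \<phi>(1-3) \<theta>(4-6) j X cA[OF s] by (intro comp_assoc) simp_all
      also have "\<dots> = (?\<kappa> \<cdot> incl C s j) \<star> Id C X"
        using \<phi>(1-3) \<theta>(9)[OF s] j X s U(1)[OF s] by simp
      finally show ?thesis by (simp only: leg[OF s])
    qed
    then have "canonical_to_tensor C U X L c K d ((?\<kappa> \<star> Id C X) \<cdot> \<theta>)"
      using \<phi>(1-3) \<theta>(4-6) j(1) X by (simp add: canonical_to_tensor_def arr_Hom)
    moreover have "is_iso C \<theta>" using \<theta>(1-8) by (intro isoI[of \<theta> \<eta>]) simp_all
    moreover have "is_iso C \<phi>" using \<phi>(1-8) by (intro isoI[of \<phi> \<psi>]) simp_all
    ultimately show "\<exists>k. canonical_to_tensor C U X L c K d k \<and> is_iso C k"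
      using \<phi>(1-3) \<theta>(4-6) j(1) X
      by (intro exI[of _ "(?\<kappa> \<star> Id C X) \<cdot> \<theta>"] conjI iso_comp iso_tensor iso_Id) simp_all
  qed
qed

end

section \<open>Universal joins\<close>

context stiff_category
begin

text \<open>
The inclusions \<open>B \<otimes> A \<rightarrow> T\<close> of the \<open>b \<and> a\<close> form a matching family with \<open>X = A\<close>, and gluing them
gives the inclusion of \<open>J \<otimes> A\<close>, the domain of \<open>j \<and> a\<close>, into \<open>T\<close>.
\<close>

lemma covers_distrib:
  assumes B: "covers B j" and a: "subunit C a" and t: "subunit C t"
    and le: "\<And>b. b \<in> B \<Longrightarrow> sub_meet C b a \<preceq> t"
  shows "sub_meet C j a \<preceq> t"
proof -
  have j: "subunit C j" using B by (rule covers_subunit)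
  let ?A = "Dom C a" and ?c = "\<lambda>b. incl C (sub_meet C b a) t"
  have tc: "t \<cdot> ?c b = a \<cdot> act b ?A" if "b \<in> B" for b
    using covers_le[OF B that] a t le[OF that] by (simp add: sub_meet_right)
  have c: "matching B ?A (Dom C t) ?c"
  proof (rule matchingI)
    show "?c b \<in> Arr C \<and> Dom C (?c b) = Dom C b \<otimes> ?A \<and> Cod C (?c b) = Dom C t" if "b \<in> B" for b
      using covers_le[OF B that] a t le[OF that] by simp
    fix b b' x y
    assume bb: "b \<in> B" "b' \<in> B" and xy: "x \<in> Arr C" "y \<in> Arr C" "Dom C x = Dom C y"
      "Cod C x = Dom C b \<otimes> ?A" "Cod C y = Dom C b' \<otimes> ?A" "act b ?A \<cdot> x = act b' ?A \<cdot> y"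
    note bb' = covers_le[OF B bb(1)] covers_le[OF B bb(2)] le[OF bb(1)] le[OF bb(2)]
    show "?c b \<cdot> x = ?c b' \<cdot> y"
    proof (rule monicD[OF subunit_monic[OF t]])
      have "t \<cdot> ?c b \<cdot> x = a \<cdot> act b ?A \<cdot> x"
        using bb' xy a t by (intro comp_tail[OF tc[OF bb(1)], THEN trans]) simp_all
      also have "\<dots> = a \<cdot> act b' ?A \<cdot> y" by (simp only: xy(6))
      also have "\<dots> = t \<cdot> ?c b' \<cdot> y"
        using bb' xy a t by (intro comp_tail[OF tc[OF bb(2)], THEN trans, symmetric]) simp_all
      finally show "t \<cdot> ?c b \<cdot> x = t \<cdot> ?c b' \<cdot> y" .
    qed (use bb' xy a t in simp_all)
  qed (use t in simp)
  obtain w where w: "w \<in> Arr C" "Dom C w = Dom C j \<otimes> ?A" "Cod C w = Dom C t"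
    "\<And>b. b \<in> B \<Longrightarrow> w \<cdot> (incl C b j \<star> Id C ?A) = ?c b"
    by (rule covers_glue[OF B c]) (use a in auto)
  have "t \<cdot> w = a \<cdot> act j ?A"
  proof (rule covers_ext[OF B])
    fix b assume b: "b \<in> B"
    show "(t \<cdot> w) \<cdot> (incl C b j \<star> Id C ?A) = (a \<cdot> act j ?A) \<cdot> (incl C b j \<star> Id C ?A)"
      using w(1-3) w(4)[OF b] tc[OF b] a t j covers_le[OF B b] by simp
  qed (use w(1-3) a t j in simp_all)
  then show ?thesis
    using w(1-3) a j t by (intro sub_leI[of w]) (simp_all add: sub_meet_right)
qed

text \<open>
In a frame the chosen join covers \<open>U\<close> by \<open>covers_iff_colimit\<close>.  Conversely, passing to downsets gives a
cover, hence a join, of every set of subunits; meets are joins of lower bounds, and the frame law is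
\<open>covers_distrib\<close>.
\<close>

lemma universal_joins_iff_covers:
  "universal_joins C \<longleftrightarrow> (\<forall>U\<subseteq>carrier (ISub C). meet_idempotent C U \<longrightarrow> (\<exists>j. covers U j))"
proof (intro iffI allI impI)
  fix U assume uj: "universal_joins C" and U: "U \<subseteq> carrier (ISub C)" "meet_idempotent C U"
  interpret L: weak_complete_lattice "ISub C"
    using uj by (simp add: universal_joins_def weak_frame_def)
  let ?j = "\<Squnion>\<^bsub>ISub C\<^esub> U"
  have lub: "is_lub (ISub C) ?j U"
    using L.sup_exists[OF U(1)] by (rule is_lub_sup)
  have j: "subunit C ?j" "\<And>u. u \<in> U \<Longrightarrow> u \<preceq> ?j"
    using lub U(1) by (auto simp: least_def Upper_def)
  have "covers U ?j"
    using covers_iff_colimit[of U ?j] j U uj unfolding universal_joins_def by (auto simp: subset_iff)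
  then show "\<exists>j. covers U j" ..
next
  assume cov: "\<forall>U\<subseteq>carrier (ISub C). meet_idempotent C U \<longrightarrow> (\<exists>j. covers U j)"
  interpret P: weak_partial_order "ISub C" by (rule ISub_weak_partial_order)
  have ex: "\<exists>j. covers A j" if "A \<subseteq> carrier (ISub C)" for A
    using cov[rule_format, of "downset A"] downset_idempotent[of A] covers_downset[of A] that
    by (auto simp: downset_def subset_iff)
  have sup: "covers A (\<Squnion>\<^bsub>ISub C\<^esub> A)" if "A \<subseteq> carrier (ISub C)" for A
  proof -
    obtain j where "covers A j" using ex[OF \<open>A \<subseteq> carrier (ISub C)\<close>] by blast
    then show ?thesis
      using covers_lub covers_lub_cong is_lub_sup by blast
  qed
  interpret L: weak_complete_lattice "ISub C"
  proof (rule P.weak_complete_latticeI)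
    fix A assume A: "A \<subseteq> carrier (ISub C)"
    show "\<exists>s. is_lub (ISub C) s A" using covers_lub[OF sup[OF A]] by blast
    have B: "Lower (ISub C) A \<subseteq> carrier (ISub C)" by (auto simp: Lower_def)
    \<comment> \<open>the meet of \<open>A\<close> is the join of its lower bounds\<close>
    have lub: "is_lub (ISub C) (\<Squnion>\<^bsub>ISub C\<^esub> (Lower (ISub C) A)) (Lower (ISub C) A)"
      by (rule covers_lub[OF sup[OF B]])
    show "\<exists>i. is_glb (ISub C) i A"
    proof (rule exI, rule greatest_LowerI)
      show "\<Squnion>\<^bsub>ISub C\<^esub> (Lower (ISub C) A) \<preceq> x" if "x \<in> A" for x
        using lub that A unfolding least_def by (auto simp: Upper_def Lower_def)
      show "y \<preceq> \<Squnion>\<^bsub>ISub C\<^esub> (Lower (ISub C) A)" if "y \<in> Lower (ISub C) A" for y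
        using covers_le[OF sup[OF B] that] by simp
    qed (use A covers_subunit[OF sup[OF B]] in auto)
  qed
  have frame: "a \<sqinter>\<^bsub>ISub C\<^esub> (\<Squnion>\<^bsub>ISub C\<^esub> B) .=\<^bsub>ISub C\<^esub> \<Squnion>\<^bsub>ISub C\<^esub> {a \<sqinter>\<^bsub>ISub C\<^esub> b | b. b \<in> B}"
    if a: "a \<in> carrier (ISub C)" and B: "B \<subseteq> carrier (ISub C)" for a B
  proof -
    let ?M = "{a \<sqinter>\<^bsub>ISub C\<^esub> b | b. b \<in> B}"
    let ?j = "\<Squnion>\<^bsub>ISub C\<^esub> B" and ?t = "\<Squnion>\<^bsub>ISub C\<^esub> ?M"
    have j: "covers B ?j" "subunit C ?j" using sup[OF B] covers_subunit by auto
    have glb: "subunit C (a \<sqinter>\<^bsub>ISub C\<^esub> b) \<and> a \<sqinter>\<^bsub>ISub C\<^esub> b \<preceq> a \<and> a \<sqinter>\<^bsub>ISub C\<^esub> b \<preceq> b \<and>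
        (\<forall>x. subunit C x \<longrightarrow> x \<preceq> a \<longrightarrow> x \<preceq> b \<longrightarrow> x \<preceq> a \<sqinter>\<^bsub>ISub C\<^esub> b)" if "subunit C b" for b
      using L.meet_closed[of a b] L.meet_left[of a b] L.meet_right[of a b] L.meet_le[of _ a b] a that by simp
    have M: "?M \<subseteq> carrier (ISub C)" using B glb by auto
    note t = sup[OF M] covers_subunit[OF sup[OF M]]
    have "sub_meet C ?j a \<preceq> ?t"
    proof (rule covers_distrib[OF j(1) _ t(2)])
      fix b assume b: "b \<in> B"
      have sb: "subunit C b" using b B by auto
      have "sub_meet C b a \<preceq> a \<sqinter>\<^bsub>ISub C\<^esub> b"
        using glb[OF sb] sub_meet_le[of b a] subunit_sub_meet[of b a] a sb by simp
      moreover have "a \<sqinter>\<^bsub>ISub C\<^esub> b \<preceq> ?t" using covers_le[OF t(1)] b by blast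
      ultimately show "sub_meet C b a \<preceq> ?t" using sub_le_trans t(2) glb[OF sb] by blast
    qed (use a in simp)
    moreover have "a \<sqinter>\<^bsub>ISub C\<^esub> ?j \<preceq> sub_meet C ?j a"
      using glb[OF j(2)] j a by (intro le_sub_meet) simp_all
    ultimately have 1: "a \<sqinter>\<^bsub>ISub C\<^esub> ?j \<preceq> ?t"
      using sub_le_trans[OF subunit_sub_meet t(2)] j(2) a by simp
    have "a \<sqinter>\<^bsub>ISub C\<^esub> ?j \<in> Upper (ISub C) ?M"
      unfolding Upper_def
    proof (intro IntI CollectI allI impI)
      fix x assume "x \<in> ?M \<inter> carrier (ISub C)"
      then obtain b where b: "x = a \<sqinter>\<^bsub>ISub C\<^esub> b" "b \<in> B" by blast
      have sb: "subunit C b" "b \<preceq> ?j" using covers_le[OF j(1) b(2)] by auto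
      have "x \<preceq> ?j" using glb[OF sb(1)] b(1) sb j(2) sub_le_trans by blast
      then show "x \<preceq> a \<sqinter>\<^bsub>ISub C\<^esub> ?j" using glb[OF sb(1)] glb[OF j(2)] b(1) by blast
    qed (use glb[OF j(2)] in simp)
    then have 2: "?t \<preceq> a \<sqinter>\<^bsub>ISub C\<^esub> ?j" using covers_lub[OF t(1)] by (simp add: least_def)
    show ?thesis using 1 2 glb[OF j(2)] t(2) by (simp add: sub_eq_iff)
  qed
  have wf: "weak_frame (ISub C)"
    unfolding weak_frame_def using L.weak_complete_lattice_axioms frame by blast
  have col: "is_colimit C (subunit_diagram C U X) (Dom C (\<Squnion>\<^bsub>ISub C\<^esub> U) \<otimes> X)
      (\<lambda>s. incl C s (\<Squnion>\<^bsub>ISub C\<^esub> U) \<star> Id C X)"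
    if U: "U \<subseteq> carrier (ISub C)" "meet_idempotent C U" and X: "X \<in> Obj C" for U X
    using covers_iff_colimit[of U "\<Squnion>\<^bsub>ISub C\<^esub> U"] sup[OF U(1)] covers_subunit[OF sup[OF U(1)]]
      covers_le[OF sup[OF U(1)]] U X by blast
  show "universal_joins C"
    unfolding universal_joins_def using stiff_category_axioms wf col by blast
qed

end

section \<open>Universal finite joins\<close>

context stiff_category
begin

lemma covers_empty_iff:
  assumes "subunit C z"
  shows "covers {} z \<longleftrightarrow> (\<forall>X\<in>Obj C. initial C (Dom C z \<otimes> X))"
proof -
  have "matching {} X L c \<longleftrightarrow> L \<in> Obj C" for X L c by (simp add: matching_def)
  then show ?thesis using assms by (simp add: covers_def initial_def Ball_def)
qed

text \<open>
The stiff square over \<open>X\<close> remains a pullback over the intermediate subobject \<open>J \<otimes> X\<close> of \<open>X\<close>.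
\<close>

lemma pair_pullback:
  assumes s: "subunit C s" and t: "subunit C t" and j: "subunit C j" "s \<preceq> j" "t \<preceq> j" and X: "X \<in> Obj C"
  shows "is_pullback C (Id C (Dom C s) \<star> act t X) (act s (Dom C t \<otimes> X))
    (incl C s j \<star> Id C X) (incl C t j \<star> Id C X)"
    and "monic C (incl C s j \<star> Id C X)" and "monic C (incl C t j \<star> Id C X)"
proof -
  let ?p = "Id C (Dom C s) \<star> act t X" and ?q = "act s (Dom C t \<otimes> X)"
  let ?f = "incl C s j \<star> Id C X" and ?g = "incl C t j \<star> Id C X"
  have eq: "?f \<cdot> ?p = ?g \<cdot> ?q"
    by (rule act_cancel[OF j(1) _ X]) (use s t j X in simp_all)
  have "\<exists>!u. u \<in> Hom C (Dom C p') (Dom C ?p) \<and> ?p \<cdot> u = p' \<and> ?q \<cdot> u = q'"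
    if sq: "commuting_square C p' q' ?f ?g" for p' q'
  proof -
    have pq: "p' \<in> Arr C" "Cod C p' = Dom C s \<otimes> X" "q' \<in> Arr C" "Cod C q' = Dom C t \<otimes> X"
      "Dom C p' = Dom C q'" "?f \<cdot> p' = ?g \<cdot> q'"
      using sq s t j X by (simp_all add: commuting_square_def)
    have "act j X \<cdot> ?f \<cdot> p' = act j X \<cdot> ?g \<cdot> q'" by (simp only: pq(6))
    then have "act s X \<cdot> p' = act t X \<cdot> q'" using pq(1-5) s t j X by simp
    then obtain u where u: "u \<in> Arr C" "Dom C u = Dom C p'" "Cod C u = Dom C s \<otimes> (Dom C t \<otimes> X)"
      "?p \<cdot> u = p'" "?q \<cdot> u = q'"
      by (rule overlap_factor[OF s t X pq(1-5)])
    show ?thesis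
    proof (rule ex1I)
      show "u \<in> Hom C (Dom C p') (Dom C ?p) \<and> ?p \<cdot> u = p' \<and> ?q \<cdot> u = q'"
        using u s t X by (simp add: arr_Hom)
      fix v assume v: "v \<in> Hom C (Dom C p') (Dom C ?p) \<and> ?p \<cdot> v = p' \<and> ?q \<cdot> v = q'"
      show "v = u"
        by (rule act_cancel[OF s]) (use u v s t X in \<open>simp_all add: arr_Hom\<close>)
    qed
  qed
  moreover have "commuting_square C ?p ?q ?f ?g"
    using eq s t j X by (simp add: commuting_square_def)
  ultimately show "is_pullback C ?p ?q ?f ?g" by (simp add: is_pullback_def)
  have "monic C (act j X \<cdot> ?f)" "monic C (act j X \<cdot> ?g)"
    using s t j X act_monic by simp_all
  note monic = this
  show "monic C ?f" by (rule monic_left_factor[OF monic(1)]) (use s t j X in simp_all)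
  show "monic C ?g" by (rule monic_left_factor[OF monic(2)]) (use s t j X in simp_all)
qed

text \<open>
Two maps on \<open>S \<otimes> X\<close> and \<open>T \<otimes> X\<close> form a matching family exactly if they agree on \<open>S \<otimes> (T \<otimes> X)\<close>, that is,
if they are a cocone on the span of the pushout square.
\<close>

lemma covers_pair_iff_pushout:
  assumes s: "subunit C s" and t: "subunit C t" and j: "subunit C j" "s \<preceq> j" "t \<preceq> j"
  shows "covers {s, t} j \<longleftrightarrow> (\<forall>X\<in>Obj C. is_pushout C (Id C (Dom C s) \<star> act t X) (act s (Dom C t \<otimes> X))
    (incl C s j \<star> Id C X) (incl C t j \<star> Id C X))"
proof -
  let ?p = "\<lambda>X. Id C (Dom C s) \<star> act t X" and ?q = "\<lambda>X. act s (Dom C t \<otimes> X)"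
  let ?f = "\<lambda>X. incl C s j \<star> Id C X" and ?g = "\<lambda>X. incl C t j \<star> Id C X"
  have square: "commuting_square C (?p X) (?q X) (?f X) (?g X)" if "X \<in> Obj C" for X
    using pair_pullback(1)[OF s t j that] by (simp add: is_pullback_def)
  have agree: "c s \<cdot> ?p X = c t \<cdot> ?q X" if "matching {s, t} X L c" "X \<in> Obj C" for X L c
    by (rule matching_agree[OF that(1)]) (use s t that(2) in simp_all)
  show ?thesis
  proof
    assume cov: "covers {s, t} j"
    show "\<forall>X\<in>Obj C. is_pushout C (?p X) (?q X) (?f X) (?g X)"
    proof
      fix X assume X: "X \<in> Obj C"
      have "\<exists>!u. u \<in> Hom C (Cod C (?f X)) (Cod C f') \<and> u \<cdot> ?f X = f' \<and> u \<cdot> ?g X = g'"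
        if sq: "commuting_square C (?p X) (?q X) f' g'" for f' g'
      proof -
        have fg: "f' \<in> Arr C" "Dom C f' = Dom C s \<otimes> X" "g' \<in> Arr C" "Dom C g' = Dom C t \<otimes> X"
          "Cod C f' = Cod C g'" "f' \<cdot> ?p X = g' \<cdot> ?q X"
          using sq s t X by (simp_all add: commuting_square_def)
        have one: "x = y"
          if "r = s \<or> r = t" "x \<in> Arr C" "y \<in> Arr C" "Dom C x = Dom C y" "Cod C x = Dom C r \<otimes> X"
            "Cod C y = Dom C r \<otimes> X" "act r X \<cdot> x = act r X \<cdot> y" for r x y
          by (rule act_cancel[of r X]) (use that s t X in auto)
        have two: "f' \<cdot> x = g' \<cdot> y"
          if xy: "x \<in> Arr C" "y \<in> Arr C" "Dom C x = Dom C y" "Cod C x = Dom C s \<otimes> X"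
            "Cod C y = Dom C t \<otimes> X" "act s X \<cdot> x = act t X \<cdot> y" for x y
        proof -
          obtain u where u: "u \<in> Arr C" "Dom C u = Dom C x" "Cod C u = Dom C s \<otimes> (Dom C t \<otimes> X)"
            "?p X \<cdot> u = x" "?q X \<cdot> u = y"
            by (rule overlap_factor[OF s t X xy(1,4,2,5,3,6)])
          have "f' \<cdot> ?p X \<cdot> u = g' \<cdot> ?q X \<cdot> u"
            by (rule comp_tail2[OF fg(6)]) (use fg(1-5) u(1-3) s t X in simp_all)
          then show ?thesis by (simp only: u(4,5))
        qed
        \<comment> \<open>a family indexed by subunits cannot separate \<open>f'\<close> from \<open>g'\<close> if \<open>s = t\<close>, so that case is special\<close>
        define c where "c = (\<lambda>r. if r = s then f' else g')"
        show ?thesis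
        proof (cases "s = t")
          case True
          have eq: "f' = g'"
            using two[of "Id C (Dom C s \<otimes> X)" "Id C (Dom C s \<otimes> X)"] fg(1-5) True s X by simp
          have "matching {s, t} X (Cod C f') c"
          proof (rule matchingI)
            fix a b x y
            assume "a \<in> {s, t}" "b \<in> {s, t}" and xy: "x \<in> Arr C" "y \<in> Arr C" "Dom C x = Dom C y"
              "Cod C x = Dom C a \<otimes> X" "Cod C y = Dom C b \<otimes> X" "act a X \<cdot> x = act b X \<cdot> y"
            then have ab: "a = s" "b = s" using True by auto
            have "x = y" by (rule one[of s]) (use xy ab in auto)
            then show "c a \<cdot> x = c b \<cdot> y" using ab by simp
          qed (use fg True eq in \<open>auto simp: c_def\<close>)
          then have "\<exists>!w. w \<in> Hom C (Dom C j \<otimes> X) (Cod C f') \<and> (\<forall>a\<in>{s, t}. w \<cdot> (incl C a j \<star> Id C X) = c a)"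
            using cov X unfolding covers_def by blast
          then show ?thesis using True eq j X s by (simp add: c_def)
        next
          case False
          have "matching {s, t} X (Cod C f') c"
          proof (rule matchingI)
            fix a b x y
            assume ab: "a \<in> {s, t}" "b \<in> {s, t}" and xy: "x \<in> Arr C" "y \<in> Arr C" "Dom C x = Dom C y"
              "Cod C x = Dom C a \<otimes> X" "Cod C y = Dom C b \<otimes> X" "act a X \<cdot> x = act b X \<cdot> y"
            consider "a = b" | "a = s" "b = t" | "a = t" "b = s" using ab by blast
            then show "c a \<cdot> x = c b \<cdot> y"
            proof cases
              case 1
              have "x = y" by (rule one[of a]) (use xy ab 1 in auto)
              then show ?thesis using 1 by simp
            next
              case 2
              then show ?thesis using two[of x y] xy False by (simp add: c_def)
            next
              case 3
              then show ?thesis using two[of y x] xy False by (simp add: c_def)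
            qed
          qed (use fg False in \<open>auto simp: c_def\<close>)
          then have "\<exists>!w. w \<in> Hom C (Dom C j \<otimes> X) (Cod C f') \<and> (\<forall>a\<in>{s, t}. w \<cdot> (incl C a j \<star> Id C X) = c a)"
            using cov X unfolding covers_def by blast
          then show ?thesis using False j X s by (simp add: c_def)
        qed
      qed
      then show "is_pushout C (?p X) (?q X) (?f X) (?g X)"
        using square[OF X] by (simp add: is_pushout_def)
    qed
  next
    assume po: "\<forall>X\<in>Obj C. is_pushout C (?p X) (?q X) (?f X) (?g X)"
    have "\<exists>!w. w \<in> Hom C (Dom C j \<otimes> X) L \<and> (\<forall>a\<in>{s, t}. w \<cdot> (incl C a j \<star> Id C X) = c a)"
      if X: "X \<in> Obj C" and c: "matching {s, t} X L c" for X L c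
    proof -
      have "commuting_square C (?p X) (?q X) (c s) (c t)"
        using agree[OF c X] matching_arr[OF c, of s] matching_arr[OF c, of t] s t X
        by (simp add: commuting_square_def)
      then have "\<exists>!u. u \<in> Hom C (Cod C (?f X)) (Cod C (c s)) \<and> u \<cdot> ?f X = c s \<and> u \<cdot> ?g X = c t"
        using po X unfolding is_pushout_def by blast
      then show ?thesis using matching_arr[OF c, of s] s j X by simp
    qed
    then show "covers {s, t} j"
      using s t j unfolding covers_def by blast
  qed
qed

text \<open>
Glue first over \<open>A\<close> to a map \<open>v\<close> on \<open>I \<otimes> X\<close>, then \<open>v\<close> and \<open>c a\<close> over the pair \<open>i\<close>, \<open>a\<close>.  That \<open>v\<close> and \<open>c a\<close>
agree on \<open>I \<otimes> (A \<otimes> X)\<close> can be tested on the pieces \<open>B \<otimes> (A \<otimes> X)\<close>, because \<open>i\<close> covers also after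
tensoring with \<open>A \<otimes> X\<close>; this is where the quantification over all \<open>X\<close> is needed.
\<close>

lemma covers_insert:
  assumes A: "covers A i" and a: "subunit C a" and ij: "covers {i, a} j"
  shows "covers (insert a A) j"
proof (rule coversI)
  have i: "subunit C i" "i \<preceq> j" "a \<preceq> j" "subunit C j"
    using covers_le[OF ij] covers_subunit[OF ij] by auto
  have Ai: "subunit C b" "b \<preceq> i" "b \<preceq> j" if "b \<in> A" for b
    using covers_le[OF A that] i sub_le_trans by blast+
  show "subunit C b \<and> b \<preceq> j" if "b \<in> insert a A" for b
    using that Ai a i by auto
  show "subunit C j" by (rule i(4))
  show "\<exists>w. w \<in> Arr C \<and> Dom C w = Dom C j \<otimes> X \<and> Cod C w = L \<and>
      (\<forall>b\<in>insert a A. w \<cdot> (incl C b j \<star> Id C X) = c b)"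
    if X: "X \<in> Obj C" and c: "matching (insert a A) X L c" for X L c
  proof -
    note cA = matching_arr[OF c]
    have L: "L \<in> Obj C" using c by (rule matching_Obj)
    obtain v where v: "v \<in> Arr C" "Dom C v = Dom C i \<otimes> X" "Cod C v = L"
      "\<And>b. b \<in> A \<Longrightarrow> v \<cdot> (incl C b i \<star> Id C X) = c b"
      by (rule covers_glue[OF A matching_subset[OF c] X]) blast+
    have agree: "v \<cdot> (Id C (Dom C i) \<star> act a X) = c a \<cdot> act i (Dom C a \<otimes> X)"
    proof (rule covers_ext[OF A, of "Dom C a \<otimes> X"])
      fix b assume b: "b \<in> A"
      have "(v \<cdot> (Id C (Dom C i) \<star> act a X)) \<cdot> (incl C b i \<star> Id C (Dom C a \<otimes> X))
          = v \<cdot> (incl C b i \<star> Id C X) \<cdot> (Id C (Dom C b) \<star> act a X)"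
        using v(1,2) i Ai[OF b] a X by simp
      also have "\<dots> = c b \<cdot> (Id C (Dom C b) \<star> act a X)"
        using v(1,2) i Ai[OF b] a X by (intro comp_tail v(4) b) simp_all
      also have "\<dots> = c a \<cdot> act b (Dom C a \<otimes> X)"
        by (rule matching_agree[OF c]) (use b Ai[OF b] a X in simp_all)
      also have "\<dots> = (c a \<cdot> act i (Dom C a \<otimes> X)) \<cdot> (incl C b i \<star> Id C (Dom C a \<otimes> X))"
        using cA i Ai[OF b] a X by simp
      finally show "(v \<cdot> (Id C (Dom C i) \<star> act a X)) \<cdot> (incl C b i \<star> Id C (Dom C a \<otimes> X))
          = (c a \<cdot> act i (Dom C a \<otimes> X)) \<cdot> (incl C b i \<star> Id C (Dom C a \<otimes> X))" .
    qed (use v(1-3) cA i a X in simp_all)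
    have "is_pushout C (Id C (Dom C i) \<star> act a X) (act i (Dom C a \<otimes> X)) (incl C i j \<star> Id C X) (incl C a j \<star> Id C X)"
      using covers_pair_iff_pushout[OF i(1) a i(4,2,3)] ij X by blast
    moreover have "commuting_square C (Id C (Dom C i) \<star> act a X) (act i (Dom C a \<otimes> X)) v (c a)"
      using agree v(1-3) cA i a X by (simp add: commuting_square_def)
    ultimately obtain w where "w \<in> Hom C (Cod C (incl C i j \<star> Id C X)) (Cod C v)"
      and wv: "w \<cdot> (incl C i j \<star> Id C X) = v" "w \<cdot> (incl C a j \<star> Id C X) = c a"
      unfolding is_pushout_def by blast
    then have w: "w \<in> Arr C" "Dom C w = Dom C j \<otimes> X" "Cod C w = L"
      using i X v(3) by (simp_all add: arr_Hom)
    have "w \<cdot> (incl C b j \<star> Id C X) = c b" if b: "b \<in> A" for b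
    proof -
      have "w \<cdot> (incl C b j \<star> Id C X) = w \<cdot> (incl C i j \<star> Id C X) \<cdot> (incl C b i \<star> Id C X)"
        using i Ai[OF b] X w by simp
      also have "\<dots> = v \<cdot> (incl C b i \<star> Id C X)"
        using i Ai[OF b] X w by (intro comp_tail wv) simp_all
      finally show ?thesis by (simp only: v(4)[OF b])
    qed
    then show ?thesis using w wv(2) by blast
  qed
  show "w = w'"
    if X: "X \<in> Obj C" and w: "w \<in> Arr C" "w' \<in> Arr C" "Dom C w = Dom C j \<otimes> X" "Dom C w' = Dom C j \<otimes> X"
      "Cod C w = Cod C w'" and eq: "\<forall>b\<in>insert a A. w \<cdot> (incl C b j \<star> Id C X) = w' \<cdot> (incl C b j \<star> Id C X)"
    for X w w'
  proof (rule covers_ext[OF ij X w])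
    have "w \<cdot> (incl C i j \<star> Id C X) = w' \<cdot> (incl C i j \<star> Id C X)"
    proof (rule covers_ext[OF A X])
      fix b assume b: "b \<in> A"
      show "(w \<cdot> (incl C i j \<star> Id C X)) \<cdot> (incl C b i \<star> Id C X) = (w' \<cdot> (incl C i j \<star> Id C X)) \<cdot> (incl C b i \<star> Id C X)"
        using eq b w i Ai[OF b] X by simp
    qed (use w i X in simp_all)
    then show "w \<cdot> (incl C b j \<star> Id C X) = w' \<cdot> (incl C b j \<star> Id C X)" if "b \<in> {i, a}" for b
      using that eq by auto
  qed
qed

text \<open>
Finitely bounded sets are generated by maximal elements, so the finite sets generating downsets have to be
thinned out.  The order is only a preorder on representatives, and maximality is up to equality of
subobjects.
\<close>

lemma finite_maximal_elements:
  assumes "finite A" "\<And>a. a \<in> A \<Longrightarrow> subunit C a"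
  shows "\<exists>M\<subseteq>A. (\<forall>m\<in>M. \<forall>a\<in>A. m \<preceq> a \<longrightarrow> a \<preceq> m) \<and> (\<forall>a\<in>A. \<exists>m\<in>M. a \<preceq> m)"
  using assms
proof (induction A)
  case (insert x A)
  have sub: "subunit C a" if "a \<in> insert x A" for a using insert.prems that .
  have "\<exists>M\<subseteq>A. (\<forall>m\<in>M. \<forall>a\<in>A. m \<preceq> a \<longrightarrow> a \<preceq> m) \<and> (\<forall>a\<in>A. \<exists>m\<in>M. a \<preceq> m)"
    by (rule insert.IH) (simp add: sub)
  then obtain M where "M \<subseteq> A" "\<forall>m\<in>M. \<forall>a\<in>A. m \<preceq> a \<longrightarrow> a \<preceq> m" "\<forall>a\<in>A. \<exists>m\<in>M. a \<preceq> m"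
    by (elim exE conjE)
  then have M: "M \<subseteq> A" "\<And>m a. \<lbrakk>m \<in> M; a \<in> A; m \<preceq> a\<rbrakk> \<Longrightarrow> a \<preceq> m" "\<And>a. a \<in> A \<Longrightarrow> \<exists>m\<in>M. a \<preceq> m"
    by (simp_all only: simp_thms)
  have trans: "a \<preceq> b \<Longrightarrow> b \<preceq> c \<Longrightarrow> b \<in> insert x A \<Longrightarrow> c \<in> insert x A \<Longrightarrow> a \<preceq> c" for a b c
    using sub sub_le_trans by blast
  have refl: "x \<preceq> x" using sub sub_le_refl by blast
  show ?case
  proof (cases "\<exists>m\<in>M. x \<preceq> m")
    case True
    have "x \<preceq> m" if m: "m \<in> M" "m \<preceq> x" for m
    proof -
      obtain m' where m': "m' \<in> M" "x \<preceq> m'" using True by blast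
      then have "m \<preceq> m'" using m M(1) trans by blast
      then have "m' \<preceq> m" using M(2) m m' M(1) by blast
      then show ?thesis using m' m M(1) trans by blast
    qed
    then show ?thesis using True M by (intro exI[of _ M]) blast
  next
    case False
    \<comment> \<open>\<open>x\<close> becomes maximal and displaces the old maximal elements below it\<close>
    let ?M = "insert x {m \<in> M. \<not> m \<preceq> x}"
    have "a \<preceq> m" if "m \<in> ?M" "a \<in> insert x A" "m \<preceq> a" for m a
    proof (cases "m = x \<and> a \<in> A")
      case True
      then obtain m' where "m' \<in> M" "a \<preceq> m'" using M(3) by blast
      then have "x \<preceq> m'" using True that M(1) trans by blast
      then show ?thesis using False \<open>m' \<in> M\<close> by blast
    next
      case False
      then show ?thesis using that M(2) refl by blast
    qed
    moreover have "\<exists>m\<in>?M. a \<preceq> m" if a: "a \<in> insert x A" for a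
    proof (cases "a = x")
      case True then show ?thesis using refl by blast
    next
      case False
      then obtain m where "m \<in> M" "a \<preceq> m" using a M(3) by blast
      then show ?thesis using M(1) trans by (cases "m \<preceq> x") blast+
    qed
    ultimately show ?thesis using M(1) by (intro exI[of _ ?M]) blast
  qed
qed simp

lemma downset_finitely_bounded:
  assumes A: "finite A" "\<And>a. a \<in> A \<Longrightarrow> subunit C a"
  shows "finitely_bounded (ISub C) (downset A)"
proof -
  obtain M where M: "M \<subseteq> A" "\<And>m a. \<lbrakk>m \<in> M; a \<in> A; m \<preceq> a\<rbrakk> \<Longrightarrow> a \<preceq> m" "\<And>a. a \<in> A \<Longrightarrow> \<exists>m\<in>M. a \<preceq> m"
    using finite_maximal_elements[OF A] by blast
  show ?thesis
    unfolding finitely_bounded_def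
  proof (intro exI[of _ M] conjI ballI impI)
    show "M \<subseteq> downset A" using M(1) A(2) sub_le_refl by (auto simp: downset_def)
    show "finite M" using M(1) A(1) finite_subset by blast
    fix m u assume m: "m \<in> M" and u: "u \<in> downset A" and le: "m \<preceq> u"
    obtain a where a: "a \<in> A" "u \<preceq> a" "subunit C u" using u by (auto simp: downset_def)
    have sm: "subunit C m" "subunit C a" using m a M(1) A(2) by auto
    have "m \<preceq> a" using le a sm sub_le_trans by blast
    then have "a \<preceq> m" using M(2) m a by blast
    then have "u \<preceq> m" using a sm sub_le_trans by blast
    then show "u .=\<^bsub>ISub C\<^esub> m" using le a sm by (simp add: sub_eq_iff)
  next
    fix u assume u: "u \<in> downset A"
    obtain a where a: "a \<in> A" "u \<preceq> a" using u by (auto simp: downset_def)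
    obtain m where m: "m \<in> M" "a \<preceq> m" using M(3) a(1) by blast
    show "\<exists>m\<in>M. u \<preceq> m" using a m M(1) A(2) sub_le_trans by blast
  qed
qed

text \<open>
A finitely bounded set is covered by whatever covers its finitely many maximal elements, and finite sets are
covered by induction, starting from the initial object and using pushouts for pairs.  Conversely the downset
of a finite set is idempotent and finitely bounded; the empty set gives the initial object and the pairs give
the squares.
\<close>

lemma universal_finite_joins_iff_covers:
  "universal_finite_joins C \<longleftrightarrow>
    (\<forall>U\<subseteq>carrier (ISub C). meet_idempotent C U \<and> finitely_bounded (ISub C) U \<longrightarrow> (\<exists>j. covers U j))"
proof
  assume uj: "universal_finite_joins C"
  note uj = uj[unfolded universal_finite_joins_def Let_def]
  obtain Z where Z: "initial C Z" "\<forall>z\<in>Hom C Z (Unit C). monic C z" "\<forall>X\<in>Obj C. isomorphic C (X \<otimes> Z) Z"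
    using conjunct1[OF uj] by (elim exE conjE)
  have ZO: "Z \<in> Obj C" using Z(1) by (simp add: initial_def)
  obtain z where z: "z \<in> Arr C" "Dom C z = Z" "Cod C z = Unit C"
    by (rule initialD[OF Z(1) Obj_Unit])
  have init: "initial C (Z \<otimes> X)" if X: "X \<in> Obj C" for X
  proof -
    have "isomorphic C (Z \<otimes> X) Z"
      using isomorphic_braid[OF ZO X] bspec[OF Z(3) X] isomorphic_trans by blast
    then show ?thesis using Z(1) initial_isomorphic isomorphic_sym by blast
  qed
  have "is_iso C (act z Z)"
    by (rule initial_iso[OF init[OF ZO] Z(1)]) (use z ZO in simp_all)
  moreover have "monic C z" by (rule bspec[OF Z(2)]) (use z in \<open>simp add: arr_Hom\<close>)
  ultimately have sz: "subunit C z" using z(2,3) unfolding subunit_iff_act by metis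
  have cov0: "covers {} z"
    using covers_empty_iff[OF sz] init z(2) by simp
  have pair: "\<exists>j. covers {s, t} j" if st: "subunit C s" "subunit C t" for s t
  proof -
    let ?j = "s \<squnion>\<^bsub>ISub C\<^esub> t"
    have sub: "{s, t} \<subseteq> carrier (ISub C)" "finite {s, t}" using st by auto
    then have "\<exists>j. is_lub (ISub C) j {s, t}"
      using conjunct1[OF conjunct2[OF uj]] by blast
    then have "is_lub (ISub C) ?j {s, t}" unfolding join_def by (rule is_lub_sup)
    then have j: "subunit C ?j" "s \<preceq> ?j" "t \<preceq> ?j" using st by (auto simp: least_def Upper_def)
    have "\<forall>X\<in>Obj C. is_pushout C (Id C (Dom C s) \<star> act t X) (act s (Dom C t \<otimes> X))
        (incl C s ?j \<star> Id C X) (incl C t ?j \<star> Id C X)"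
      using conjunct2[OF conjunct2[OF uj]] st by simp
    then show ?thesis using covers_pair_iff_pushout[OF st j] by blast
  qed
  have fin: "\<exists>j. covers A j" if "finite A" "\<And>a. a \<in> A \<Longrightarrow> subunit C a" for A
    using that
  proof (induction A)
    case empty
    show ?case using cov0 by blast
  next
    case (insert a A)
    then obtain i where i: "covers A i" by blast
    obtain j where "covers {i, a} j" using pair covers_subunit[OF i] insert.prems by blast
    then show ?case using covers_insert[OF i] insert.prems by blast
  qed
  show "\<forall>U\<subseteq>carrier (ISub C). meet_idempotent C U \<and> finitely_bounded (ISub C) U \<longrightarrow> (\<exists>j. covers U j)"
  proof (intro allI impI)
    fix U assume U: "U \<subseteq> carrier (ISub C)" and fb: "meet_idempotent C U \<and> finitely_bounded (ISub C) U"
    obtain M where M: "M \<subseteq> U" "finite M" "\<And>u. u \<in> U \<Longrightarrow> \<exists>m\<in>M. u \<preceq> m"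
      using fb unfolding finitely_bounded_def by blast
    have sub: "subunit C u" if "u \<in> U" for u using U that by auto
    have "\<exists>j. covers M j" by (rule fin[OF M(2)]) (use M(1) sub in blast)
    then obtain j where "covers M j" ..
    then have "covers U j" using covers_cofinal[OF M(1) sub M(3)] by blast
    then show "\<exists>j. covers U j" ..
  qed
next
  assume cov: "\<forall>U\<subseteq>carrier (ISub C). meet_idempotent C U \<and> finitely_bounded (ISub C) U \<longrightarrow> (\<exists>j. covers U j)"
  have fin: "\<exists>j. covers A j" if A: "finite A" "A \<subseteq> carrier (ISub C)" for A
  proof -
    have sub: "\<And>a. a \<in> A \<Longrightarrow> subunit C a" using A by auto
    have "downset A \<subseteq> carrier (ISub C)" by (auto simp: downset_def)
    then show ?thesis
      using cov downset_idempotent[OF sub] downset_finitely_bounded[OF A(1) sub] covers_downset[OF sub] by blast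
  qed
  obtain z where z: "covers {} z" using fin[of "{}"] by blast
  let ?Z = "Dom C z"
  have sz: "subunit C z" using z by (rule covers_subunit)
  have initX: "initial C (?Z \<otimes> X)" if "X \<in> Obj C" for X
    using covers_empty_iff[OF sz] z that by blast
  have "isomorphic C (?Z \<otimes> Unit C) ?Z"
    using sz by (intro isomorphicI[OF Runit_iso[of ?Z]]) simp_all
  then have init: "initial C ?Z" by (rule initial_isomorphic[OF initX[OF Obj_Unit]])
  have "monic C z'" if z': "z' \<in> Hom C ?Z (Unit C)" for z'
  proof -
    have "z' = z" by (rule initial_eq[OF init]) (use z' sz in \<open>simp_all add: arr_Hom\<close>)
    then show ?thesis using sz by (simp add: subunit_monic)
  qed
  moreover have "isomorphic C (X \<otimes> ?Z) ?Z" if X: "X \<in> Obj C" for X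
  proof -
    have i: "initial C (X \<otimes> ?Z)"
      using initial_isomorphic[OF initX[OF X] isomorphic_braid] sz X by simp
    have "?Z \<in> Obj C" using sz by simp
    then obtain f where f: "f \<in> Arr C" "Dom C f = X \<otimes> ?Z" "Cod C f = ?Z"
      by (rule initialD[OF i])
    show ?thesis using isomorphicI[OF initial_iso[OF i init f]] f by simp
  qed
  moreover have "\<exists>j. is_lub (ISub C) j A" if "finite A" "A \<subseteq> carrier (ISub C)" for A
    using fin[OF that] covers_lub by blast
  moreover have "is_pullback C (Id C (Dom C s) \<star> act t X) (act s (Dom C t \<otimes> X))
        (incl C s (s \<squnion>\<^bsub>ISub C\<^esub> t) \<star> Id C X) (incl C t (s \<squnion>\<^bsub>ISub C\<^esub> t) \<star> Id C X) \<and>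
      is_pushout C (Id C (Dom C s) \<star> act t X) (act s (Dom C t \<otimes> X))
        (incl C s (s \<squnion>\<^bsub>ISub C\<^esub> t) \<star> Id C X) (incl C t (s \<squnion>\<^bsub>ISub C\<^esub> t) \<star> Id C X) \<and>
      monic C (Id C (Dom C s) \<star> act t X) \<and> monic C (act s (Dom C t \<otimes> X)) \<and>
      monic C (incl C s (s \<squnion>\<^bsub>ISub C\<^esub> t) \<star> Id C X) \<and> monic C (incl C t (s \<squnion>\<^bsub>ISub C\<^esub> t) \<star> Id C X)"
    if s: "subunit C s" and t: "subunit C t" and X: "X \<in> Obj C" for s t X
  proof -
    let ?j = "s \<squnion>\<^bsub>ISub C\<^esub> t"
    obtain i where i: "covers {s, t} i" using fin[of "{s, t}"] s t by auto
    have "is_lub (ISub C) ?j {s, t}"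
      unfolding join_def using covers_lub[OF i] is_lub_sup by blast
    then have c: "covers {s, t} ?j" by (rule covers_lub_cong[OF i])
    have j: "subunit C ?j" "s \<preceq> ?j" "t \<preceq> ?j" using covers_le[OF c] covers_subunit[OF c] by auto
    show ?thesis
      using pair_pullback[OF s t j X] covers_pair_iff_pushout[OF s t j] c X
        stiff_pullback(2)[OF s t X] act_monic[OF s] t by simp
  qed
  ultimately show "universal_finite_joins C"
    unfolding universal_finite_joins_def Let_def using init by (intro conjI exI[of _ ?Z] ballI allI impI) simp_all
qed

end

section \<open>Universal directed joins\<close>

context stiff_category
begin

lemma family_edge:
  assumes "subunit_family C P s"
  shows "(i, f, k) \<in> Edge (family_diagram C P s) \<Longrightarrow>
    i \<in> Node (family_diagram C P s) \<and> k \<in> Node (family_diagram C P s) \<and> f \<in> Arr C \<and>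
    Cod C f = Vertex (family_diagram C P s) k"
  using assms by (auto simp: family_diagram_def subunit_family_def)

lemma tensor_family_edge:
  assumes "subunit_family C P s" "X \<in> Obj C"
  shows "(i, f, k) \<in> Edge (tensor_diagram C X (family_diagram C P s)) \<Longrightarrow>
    i \<in> Node (tensor_diagram C X (family_diagram C P s)) \<and> k \<in> Node (tensor_diagram C X (family_diagram C P s)) \<and>
    f \<in> Arr C \<and> Cod C f = Vertex (tensor_diagram C X (family_diagram C P s)) k"
  using assms by (auto simp: tensor_diagram_def family_diagram_def subunit_family_def)

lemma tensor_family_cocone_iff:
  "is_cocone C (tensor_diagram C X (family_diagram C P s)) L c \<longleftrightarrow> L \<in> Obj C \<and>
    (\<forall>i\<in>carrier P. c i \<in> Hom C (X \<otimes> Dom C (s i)) L) \<and>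
    (\<forall>i\<in>carrier P. \<forall>k\<in>carrier P. i \<sqsubseteq>\<^bsub>P\<^esub> k \<longrightarrow> c k \<cdot> (Id C X \<star> incl C (s i) (s k)) = c i)"
  unfolding is_cocone_def by (auto simp: tensor_diagram_def family_diagram_def)

text \<open>
After conjugation with the braiding, a cocone on the diagram of the \<open>X \<otimes> S i\<close> is a matching family:
members \<open>i\<close> and \<open>k\<close> are compared inside \<open>S l \<otimes> X\<close> for an upper bound \<open>l\<close> of both.
\<close>

lemma tensor_family_colimit:
  assumes fam: "subunit_family C P s" and dir: "directed P (carrier P)"
    and cov: "covers (s ` carrier P) j" and X: "X \<in> Obj C"
  shows "is_colimit C (tensor_diagram C X (family_diagram C P s)) (X \<otimes> Dom C j)
    (\<lambda>i. Id C X \<star> incl C (s i) j)"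
proof -
  let ?J = "Dom C j" and ?b = "\<lambda>i. Braid C (Dom C (s i)) X"
  have j: "subunit C j" using cov by (rule covers_subunit)
  have s: "subunit C (s i)" "s i \<preceq> j" if "i \<in> carrier P" for i
    using covers_le[OF cov, of "s i"] that by auto
  have mono: "s i \<preceq> s k" if "i \<in> carrier P" "k \<in> carrier P" "i \<sqsubseteq>\<^bsub>P\<^esub> k" for i k
    using fam that by (simp add: subunit_family_def)
  show ?thesis
    unfolding is_colimit_def
  proof (intro conjI allI impI)
    show "is_cocone C (tensor_diagram C X (family_diagram C P s)) (X \<otimes> ?J) (\<lambda>i. Id C X \<star> incl C (s i) j)"
      unfolding tensor_family_cocone_iff using s mono j X by (simp add: arr_Hom)
    fix L c assume cc: "is_cocone C (tensor_diagram C X (family_diagram C P s)) L c"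
    have L: "L \<in> Obj C" and c: "\<And>i. i \<in> carrier P \<Longrightarrow> c i \<in> Arr C \<and> Dom C (c i) = X \<otimes> Dom C (s i) \<and> Cod C (c i) = L"
      and ck: "\<And>i k. \<lbrakk>i \<in> carrier P; k \<in> carrier P; i \<sqsubseteq>\<^bsub>P\<^esub> k\<rbrakk> \<Longrightarrow> c k \<cdot> (Id C X \<star> incl C (s i) (s k)) = c i"
      using cc unfolding tensor_family_cocone_iff by (auto simp: arr_Hom)
    have up: "c i \<cdot> ?b i \<cdot> x = c l \<cdot> ?b l \<cdot> (incl C (s i) (s l) \<star> Id C X) \<cdot> x"
      if il: "i \<in> carrier P" "l \<in> carrier P" "i \<sqsubseteq>\<^bsub>P\<^esub> l" and x: "x \<in> Arr C" "Cod C x = Dom C (s i) \<otimes> X" for i l x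
    proof -
      note h = s[OF il(1)] s[OF il(2)] mono[OF il] c[OF il(1)] c[OF il(2)]
      have "c i \<cdot> ?b i \<cdot> x = c l \<cdot> (Id C X \<star> incl C (s i) (s l)) \<cdot> ?b i \<cdot> x"
        using h x X by (intro comp_tail[OF ck[OF il], symmetric]) simp_all
      also have "(Id C X \<star> incl C (s i) (s l)) \<cdot> ?b i \<cdot> x = ?b l \<cdot> (incl C (s i) (s l) \<star> Id C X) \<cdot> x"
        using braid_nat[of "incl C (s i) (s l)" "Id C X"] h x X by (intro comp_tail2) simp_all
      finally show ?thesis .
    qed
    have agree: "c i \<cdot> ?b i \<cdot> x = c k \<cdot> ?b k \<cdot> y"
      if ik: "i \<in> carrier P" "k \<in> carrier P" and xy: "x \<in> Arr C" "y \<in> Arr C" "Dom C x = Dom C y"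
        "Cod C x = Dom C (s i) \<otimes> X" "Cod C y = Dom C (s k) \<otimes> X" "act (s i) X \<cdot> x = act (s k) X \<cdot> y" for i k x y
    proof -
      obtain l where l: "l \<in> carrier P" "i \<sqsubseteq>\<^bsub>P\<^esub> l" "k \<sqsubseteq>\<^bsub>P\<^esub> l"
        using dir ik unfolding directed_def by blast
      note h = s[OF ik(1)] s[OF ik(2)] s[OF l(1)] mono[OF ik(1) l(1,2)] mono[OF ik(2) l(1,3)]
      have "(incl C (s i) (s l) \<star> Id C X) \<cdot> x = (incl C (s k) (s l) \<star> Id C X) \<cdot> y"
        by (rule act_cancel[OF h(5) _ X]) (use h xy X in simp_all)
      then show ?thesis
        using up[OF ik(1) l(1,2) xy(1,4)] up[OF ik(2) l(1,3) xy(2,5)] by simp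
    qed
    \<comment> \<open>different indices may carry the same subunit; by \<open>agree\<close> the chosen one does not matter\<close>
    define idx where "idx a = (SOME i. i \<in> carrier P \<and> s i = a)" for a
    have idx: "idx a \<in> carrier P \<and> s (idx a) = a" if "a \<in> s ` carrier P" for a
      unfolding idx_def by (rule someI_ex) (use that in blast)
    have "matching (s ` carrier P) X L (\<lambda>a. c (idx a) \<cdot> ?b (idx a))"
    proof (rule matchingI[OF L])
      show "c (idx a) \<cdot> ?b (idx a) \<in> Arr C \<and> Dom C (c (idx a) \<cdot> ?b (idx a)) = Dom C a \<otimes> X \<and>
          Cod C (c (idx a) \<cdot> ?b (idx a)) = L" if "a \<in> s ` carrier P" for a
        using c[of "idx a"] s[of "idx a"] idx[OF that] X by simp
      fix a b x y
      assume ab: "a \<in> s ` carrier P" "b \<in> s ` carrier P" and xy: "x \<in> Arr C" "y \<in> Arr C" "Dom C x = Dom C y"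
        "Cod C x = Dom C a \<otimes> X" "Cod C y = Dom C b \<otimes> X" "act a X \<cdot> x = act b X \<cdot> y"
      show "(c (idx a) \<cdot> ?b (idx a)) \<cdot> x = (c (idx b) \<cdot> ?b (idx b)) \<cdot> y"
        using agree[of "idx a" "idx b" x y] idx[OF ab(1)] idx[OF ab(2)] xy X
          c[of "idx a"] c[of "idx b"] s[of "idx a"] s[of "idx b"] by simp
    qed
    from covers_glue[OF cov this X] obtain w where w: "w \<in> Arr C" "Dom C w = ?J \<otimes> X" "Cod C w = L"
      "\<And>a. a \<in> s ` carrier P \<Longrightarrow> w \<cdot> (incl C a j \<star> Id C X) = c (idx a) \<cdot> ?b (idx a)"
      by blast
    have wi: "w \<cdot> (incl C (s i) j \<star> Id C X) = c i \<cdot> ?b i" if i: "i \<in> carrier P" for i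
    proof -
      have si: "s i \<in> s ` carrier P" using i by blast
      have "c (idx (s i)) \<cdot> ?b (idx (s i)) \<cdot> Id C (Dom C (s i) \<otimes> X) = c i \<cdot> ?b i \<cdot> Id C (Dom C (s i) \<otimes> X)"
        by (rule agree) (use idx[OF si] i s[OF i] X in simp_all)
      then show ?thesis using w(4)[OF si] idx[OF si] c[OF i] s[OF i] X by simp
    qed
    let ?u = "Inv C (Braid C ?J X)"
    note u = unbraid[OF _ X, of ?J]
    have J: "?J \<in> Obj C" using j by simp
    show "\<exists>!v. v \<in> Hom C (X \<otimes> ?J) L \<and>
        (\<forall>i\<in>Node (tensor_diagram C X (family_diagram C P s)). v \<cdot> (Id C X \<star> incl C (s i) j) = c i)"
    proof (rule ex1I)
      have "(w \<cdot> ?u) \<cdot> (Id C X \<star> incl C (s i) j) = c i" if i: "i \<in> carrier P" for i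
      proof -
        note h = s[OF i] c[OF i] and ui = unbraid[of "Dom C (s i)" X]
        have "(w \<cdot> ?u) \<cdot> (Id C X \<star> incl C (s i) j) = w \<cdot> (incl C (s i) j \<star> Id C X) \<cdot> Inv C (?b i)"
          using unbraid_nat[of "incl C (s i) j" X] w(1-3) u J h X j by simp
        also have "\<dots> = (c i \<cdot> ?b i) \<cdot> Inv C (?b i)"
          using w(1-3) h X j ui by (intro comp_tail wi i) simp_all
        also have "\<dots> = c i" using h ui X by simp
        finally show ?thesis .
      qed
      then show "w \<cdot> ?u \<in> Hom C (X \<otimes> ?J) L \<and>
          (\<forall>i\<in>Node (tensor_diagram C X (family_diagram C P s)). (w \<cdot> ?u) \<cdot> (Id C X \<star> incl C (s i) j) = c i)"
        using w(1-3) u J X by (simp add: arr_Hom tensor_diagram_def family_diagram_def)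
      fix v assume "v \<in> Hom C (X \<otimes> ?J) L \<and>
          (\<forall>i\<in>Node (tensor_diagram C X (family_diagram C P s)). v \<cdot> (Id C X \<star> incl C (s i) j) = c i)"
      then have v: "v \<in> Arr C" "Dom C v = X \<otimes> ?J" "Cod C v = L"
        "\<And>i. i \<in> carrier P \<Longrightarrow> v \<cdot> (Id C X \<star> incl C (s i) j) = c i"
        by (simp_all add: arr_Hom tensor_diagram_def family_diagram_def)
      have "v \<cdot> Braid C ?J X = w"
      proof (rule covers_ext[OF cov X])
        fix a assume "a \<in> s ` carrier P"
        then obtain i where i: "i \<in> carrier P" "a = s i" by blast
        note h = s[OF i(1)] c[OF i(1)]
        have "(v \<cdot> Braid C ?J X) \<cdot> (incl C (s i) j \<star> Id C X) = v \<cdot> (Id C X \<star> incl C (s i) j) \<cdot> ?b i"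
          using braid_nat[of "incl C (s i) j" "Id C X"] v(1-3) h X j by simp
        also have "\<dots> = c i \<cdot> ?b i"
          using v(1-3) h X j by (intro comp_tail v(4) i) simp_all
        finally show "(v \<cdot> Braid C ?J X) \<cdot> (incl C a j \<star> Id C X) = w \<cdot> (incl C a j \<star> Id C X)"
          using wi[OF i(1)] i(2) by simp
      qed (use v(1-3) w(1-3) J X in simp_all)
      then have "w \<cdot> ?u = (v \<cdot> Braid C ?J X) \<cdot> ?u" by simp
      also have "\<dots> = v" using v(1-3) u J X by simp
      finally show "v = w \<cdot> ?u" ..
    qed
  qed
qed

lemma lunit_tensor_family_cocone:
  assumes "subunit_family C P s" "is_cocone C (family_diagram C P s) L c"
  shows "is_cocone C (tensor_diagram C (Unit C) (family_diagram C P s)) L (\<lambda>i. c i \<cdot> Lunit C (Dom C (s i)))"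
proof -
  have s: "subunit C (s i)" if "i \<in> carrier P" for i
    using assms(1) that by (simp add: subunit_family_def)
  have c: "c i \<in> Arr C" "Dom C (c i) = Dom C (s i)" "Cod C (c i) = L" if "i \<in> carrier P" for i
    using cocone_arr[OF assms(2), of i] that by (simp_all add: family_diagram_def)
  have "(c k \<cdot> Lunit C (Dom C (s k))) \<cdot> (Id C (Unit C) \<star> incl C (s i) (s k)) = c i \<cdot> Lunit C (Dom C (s i))"
    if ik: "i \<in> carrier P" "k \<in> carrier P" "i \<sqsubseteq>\<^bsub>P\<^esub> k" for i k
  proof -
    have le: "s i \<preceq> s k" using assms(1) ik by (simp add: subunit_family_def)
    have "(i, incl C (s i) (s k), k) \<in> Edge (family_diagram C P s)"
      using ik by (auto simp: family_diagram_def)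
    then have ck: "c k \<cdot> incl C (s i) (s k) = c i"
      using assms(2) unfolding is_cocone_def by auto
    show ?thesis
      using lunit_nat[of "incl C (s i) (s k)"] le s[OF ik(1)] s[OF ik(2)] c[OF ik(1)] c[OF ik(2)]
      by (simp add: comp_tail[OF ck])
  qed
  then show ?thesis
    unfolding tensor_family_cocone_iff using assms(2) s c by (simp add: arr_Hom is_cocone_def)
qed

text \<open>
The case of \<open>tensor_family_colimit\<close> in which \<open>X\<close> is the unit, with the unitors removed.
\<close>

lemma family_colimit:
  assumes fam: "subunit_family C P s" and dir: "directed P (carrier P)"
    and cov: "covers (s ` carrier P) j"
  shows "is_colimit C (family_diagram C P s) (Dom C j) (\<lambda>i. incl C (s i) j)"
  unfolding is_colimit_def
proof (intro conjI allI impI)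
  let ?I = "Unit C" and ?J = "Dom C j"
  have j: "subunit C j" using cov by (rule covers_subunit)
  have s: "subunit C (s i)" "s i \<preceq> j" if "i \<in> carrier P" for i
    using covers_le[OF cov, of "s i"] that by auto
  have mono: "s i \<preceq> s k" if "i \<in> carrier P" "k \<in> carrier P" "i \<sqsubseteq>\<^bsub>P\<^esub> k" for i k
    using fam that by (simp add: subunit_family_def)
  note col = tensor_family_colimit[OF fam dir cov Obj_Unit]
  show "is_cocone C (family_diagram C P s) ?J (\<lambda>i. incl C (s i) j)"
    unfolding is_cocone_def using s mono j by (auto simp: family_diagram_def arr_Hom)
  fix L c assume cc: "is_cocone C (family_diagram C P s) L c"
  have c: "c i \<in> Arr C" "Dom C (c i) = Dom C (s i)" "Cod C (c i) = L" if "i \<in> carrier P" for i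
    using cocone_arr[OF cc, of i] that by (simp_all add: family_diagram_def)
  obtain u where u: "u \<in> Arr C" "Dom C u = ?I \<otimes> ?J" "Cod C u = L"
    "\<And>i. i \<in> carrier P \<Longrightarrow> u \<cdot> (Id C ?I \<star> incl C (s i) j) = c i \<cdot> Lunit C (Dom C (s i))"
    using colimit_glue[OF col lunit_tensor_family_cocone[OF fam cc]]
    by (auto simp: tensor_diagram_def family_diagram_def)
  let ?l = "Inv C (Lunit C ?J)"
  have J: "?J \<in> Obj C" using j by simp
  note l = Inv_props[OF Lunit_iso[OF J]]
  have lu: "u = v \<cdot> Lunit C ?J"
    if v: "v \<in> Arr C" "Dom C v = ?J" "Cod C v = L" "\<And>i. i \<in> carrier P \<Longrightarrow> v \<cdot> incl C (s i) j = c i" for v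
  proof (rule colimit_ext[OF col _ _ _ _ _ tensor_family_edge[OF fam Obj_Unit]])
    fix i assume "i \<in> Node (tensor_diagram C ?I (family_diagram C P s))"
    then have i: "i \<in> carrier P" by (simp add: tensor_diagram_def family_diagram_def)
    have "(v \<cdot> Lunit C ?J) \<cdot> (Id C ?I \<star> incl C (s i) j) = v \<cdot> incl C (s i) j \<cdot> Lunit C (Dom C (s i))"
      using lunit_nat[of "incl C (s i) j"] v(1-3) s[OF i] j by simp
    also have "\<dots> = c i \<cdot> Lunit C (Dom C (s i))"
      using v(1-3) s[OF i] j by (intro comp_tail v(4) i) simp_all
    finally show "u \<cdot> (Id C ?I \<star> incl C (s i) j) = (v \<cdot> Lunit C ?J) \<cdot> (Id C ?I \<star> incl C (s i) j)"
      using u(4)[OF i] by simp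
  qed (use u(1-3) v(1-3) J in simp_all)
  show "\<exists>!v. v \<in> Hom C ?J L \<and> (\<forall>i\<in>Node (family_diagram C P s). v \<cdot> incl C (s i) j = c i)"
  proof (rule ex1I)
    have "(u \<cdot> ?l) \<cdot> incl C (s i) j = c i" if i: "i \<in> carrier P" for i
    proof (rule iso_cancel_right[OF Lunit_iso[of "Dom C (s i)"]])
      have "((u \<cdot> ?l) \<cdot> incl C (s i) j) \<cdot> Lunit C (Dom C (s i)) = u \<cdot> ?l \<cdot> Lunit C ?J \<cdot> (Id C ?I \<star> incl C (s i) j)"
        using lunit_nat[of "incl C (s i) j"] u(1-3) l s[OF i] j by simp
      also have "\<dots> = u \<cdot> (Id C ?I \<star> incl C (s i) j)"
        using u(1-3) l s[OF i] j by (simp add: comp_tail[OF l(4)])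
      finally show "((u \<cdot> ?l) \<cdot> incl C (s i) j) \<cdot> Lunit C (Dom C (s i)) = c i \<cdot> Lunit C (Dom C (s i))"
        using u(4)[OF i] by simp
    qed (use u(1-3) l s[OF i] j c[OF i] in simp_all)
    then show "u \<cdot> ?l \<in> Hom C ?J L \<and> (\<forall>i\<in>Node (family_diagram C P s). (u \<cdot> ?l) \<cdot> incl C (s i) j = c i)"
      using u(1-3) l J by (simp add: arr_Hom family_diagram_def)
    fix v assume "v \<in> Hom C ?J L \<and> (\<forall>i\<in>Node (family_diagram C P s). v \<cdot> incl C (s i) j = c i)"
    then have v: "v \<in> Arr C" "Dom C v = ?J" "Cod C v = L" "\<And>i. i \<in> carrier P \<Longrightarrow> v \<cdot> incl C (s i) j = c i"
      by (simp_all add: arr_Hom family_diagram_def)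
    have "u \<cdot> ?l = (v \<cdot> Lunit C ?J) \<cdot> ?l" using lu[OF v] by simp
    also have "\<dots> = v" using v(1-3) l J by simp
    finally show "v = u \<cdot> ?l" ..
  qed
qed

lemma subunit_comp_iso:
  assumes "subunit C j" "is_iso C f" "Cod C f = Dom C j"
  shows "subunit C (j \<cdot> f)"
proof -
  have f: "f \<in> Arr C" using assms(2) by (rule iso_arr)
  have "isomorphic C (Dom C j) (Dom C f)"
    using isomorphicI[OF assms(2) refl assms(3)] by (rule isomorphic_sym)
  then have "is_iso C (act j (Dom C f))"
    using act_iso_isomorphic[of j "Dom C j" "Dom C f"] assms(1) unfolding subunit_iff_act
    by (meson monic_arr)
  then have "is_iso C (act j (Dom C f) \<cdot> (f \<star> Id C (Dom C f)))"
    using assms f by (intro iso_comp iso_tensor iso_Id) simp_all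
  then have "is_iso C (act (j \<cdot> f) (Dom C f))" using assms f by simp
  moreover have "monic C (j \<cdot> f)"
    using assms f by (intro monic_comp iso_monic subunit_monic) simp_all
  ultimately show ?thesis unfolding subunit_iff_act using assms f by simp
qed

text \<open>
The downset of the image of a directed diagram is idempotent and directed, and its cover is a colimit of the
diagram.  The index type enters only through this image, so it can be arbitrary.
\<close>

lemma universal_directed_joins_if_covers:
  assumes cov: "\<forall>U\<subseteq>carrier (ISub C). meet_idempotent C U \<and> directed (ISub C) U \<longrightarrow> (\<exists>j. covers U j)"
  shows "universal_directed_joins TYPE('i) C"
proof -
  have "(\<exists>L c. is_colimit C (family_diagram C P s) L c) \<and>
      (\<forall>L c. is_colimit C (family_diagram C P s) L c \<longrightarrow>
         (\<exists>m\<in>Hom C L (Unit C). (\<forall>i\<in>carrier P. m \<cdot> c i = s i) \<and> subunit C m) \<and>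
         (\<forall>X\<in>Obj C. is_colimit C (tensor_diagram C X (family_diagram C P s)) (X \<otimes> L) (\<lambda>i. Id C X \<star> c i)))"
    if dir: "directed P (carrier P)" and fam: "subunit_family C P s" for P :: "'i gorder" and s
  proof -
    let ?A = "s ` carrier P"
    have A: "subunit C a" if "a \<in> ?A" for a using fam that by (auto simp: subunit_family_def)
    have "directed (ISub C) (downset ?A)"
      unfolding directed_def
    proof (intro ballI)
      fix a b assume "a \<in> downset ?A" "b \<in> downset ?A"
      then obtain i k where ik: "i \<in> carrier P" "a \<preceq> s i" "k \<in> carrier P" "b \<preceq> s k"
        by (auto simp: downset_def)
      obtain l where l: "l \<in> carrier P" "i \<sqsubseteq>\<^bsub>P\<^esub> l" "k \<sqsubseteq>\<^bsub>P\<^esub> l"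
        using dir ik unfolding directed_def by blast
      have "s i \<preceq> s l" "s k \<preceq> s l" using fam ik l by (simp_all add: subunit_family_def)
      moreover have "subunit C (s i)" "subunit C (s k)" "subunit C (s l)" using A ik l by auto
      ultimately have "a \<preceq> s l" "b \<preceq> s l"
        using ik(2,4) by (meson sub_le_trans)+
      moreover have "s l \<in> downset ?A"
        using \<open>subunit C (s l)\<close> l(1) sub_le_refl unfolding downset_def by blast
      ultimately show "\<exists>c\<in>downset ?A. a \<preceq> c \<and> b \<preceq> c" by blast
    qed
    moreover have "downset ?A \<subseteq> carrier (ISub C)" by (auto simp: downset_def)
    ultimately obtain j where j: "covers ?A j"
      using cov downset_idempotent[OF A] covers_downset[OF A] by blast
    have sj: "subunit C j" using j by (rule covers_subunit)
    have s: "subunit C (s i)" "s i \<preceq> j" if "i \<in> carrier P" for i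
      using covers_le[OF j, of "s i"] that by auto
    note colJ = family_colimit[OF fam dir j]
    show ?thesis
    proof (intro conjI allI impI ballI)
      show "\<exists>L c. is_colimit C (family_diagram C P s) L c" using colJ by blast
    next
      fix L c assume Lc: "is_colimit C (family_diagram C P s) L c"
      obtain f where f: "is_iso C f" "Dom C f = L" "Cod C f = Dom C j"
        "\<And>i. i \<in> carrier P \<Longrightarrow> f \<cdot> c i = incl C (s i) j"
        using colimit_unique[OF Lc colJ family_edge[OF fam]] by (auto simp: family_diagram_def)
      have c: "c i \<in> Arr C" "Dom C (c i) = Dom C (s i)" "Cod C (c i) = L" if "i \<in> carrier P" for i
        using cocone_arr[OF colimit_cocone[OF Lc], of i] that by (simp_all add: family_diagram_def)
      have "(j \<cdot> f) \<cdot> c i = s i" if i: "i \<in> carrier P" for i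
        using f(2,3) f(4)[OF i] iso_arr[OF f(1)] c[OF i] s[OF i] sj by simp
      moreover have "j \<cdot> f \<in> Hom C L (Unit C)"
        using f(2,3) iso_arr[OF f(1)] sj by (simp add: arr_Hom)
      ultimately show "\<exists>m\<in>Hom C L (Unit C). (\<forall>i\<in>carrier P. m \<cdot> c i = s i) \<and> subunit C m"
        using subunit_comp_iso[OF sj f(1,3)] by blast
    next
      fix L c X assume Lc: "is_colimit C (family_diagram C P s) L c" and X: "X \<in> Obj C"
      obtain f where f: "is_iso C f" "Dom C f = Dom C j" "Cod C f = L"
        "\<And>i. i \<in> carrier P \<Longrightarrow> f \<cdot> incl C (s i) j = c i"
        using colimit_unique[OF colJ Lc family_edge[OF fam]] by (auto simp: family_diagram_def)
      show "is_colimit C (tensor_diagram C X (family_diagram C P s)) (X \<otimes> L) (\<lambda>i. Id C X \<star> c i)"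
      proof (rule colimit_transport[OF tensor_family_colimit[OF fam dir j X] _ _ _ _ tensor_family_edge[OF fam X]])
        show "is_iso C (Id C X \<star> f)" using f(1) X by (intro iso_tensor iso_Id)
        show "Id C X \<star> c i = (Id C X \<star> f) \<cdot> (Id C X \<star> incl C (s i) j)"
          if "i \<in> Node (tensor_diagram C X (family_diagram C P s))" for i
          using that f(2,3) f(4)[of i] iso_arr[OF f(1)] X s[of i] sj
          by (simp add: tensor_diagram_def family_diagram_def)
      qed (use f(2,3) iso_arr[OF f(1)] X in simp_all)
    qed
  qed
  then show ?thesis
    unfolding universal_directed_joins_def using stiff_category_axioms by blast
qed

text \<open>
The converse of \<open>tensor_family_colimit\<close> for a poset of subunits, indexed by itself.
\<close>

lemma covers_if_tensor_colimit:
  fixes P :: "'b gorder"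
  assumes fam: "subunit_family C P (\<lambda>v. v)" and m: "subunit C m" "\<And>v. v \<in> carrier P \<Longrightarrow> v \<preceq> m"
    and le: "\<And>a b. \<lbrakk>a \<in> carrier P; b \<in> carrier P\<rbrakk> \<Longrightarrow> a \<sqsubseteq>\<^bsub>P\<^esub> b \<longleftrightarrow> a \<preceq> b"
    and col: "\<And>X. X \<in> Obj C \<Longrightarrow> is_colimit C (tensor_diagram C X (family_diagram C P (\<lambda>v. v))) (X \<otimes> Dom C m)
      (\<lambda>v. Id C X \<star> incl C v m)"
  shows "covers (carrier P) m"
proof (rule coversI)
  have sub: "subunit C v" if "v \<in> carrier P" for v using fam that by (simp add: subunit_family_def)
  let ?M = "Dom C m"
  have M: "?M \<in> Obj C" using m by simp
  show "subunit C v \<and> v \<preceq> m" if "v \<in> carrier P" for v using sub m that by blast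
  show "\<exists>w. w \<in> Arr C \<and> Dom C w = ?M \<otimes> X \<and> Cod C w = L \<and> (\<forall>a\<in>carrier P. w \<cdot> (incl C a m \<star> Id C X) = c a)"
    if X: "X \<in> Obj C" and c: "matching (carrier P) X L c" for X L c
  proof -
    let ?u = "\<lambda>v. Inv C (Braid C (Dom C v) X)"
    have "is_cocone C (tensor_diagram C X (family_diagram C P (\<lambda>v. v))) L (\<lambda>v. c v \<cdot> ?u v)"
      unfolding tensor_family_cocone_iff
    proof (intro conjI ballI impI)
      show "L \<in> Obj C" using c by (rule matching_Obj)
      show "c v \<cdot> ?u v \<in> Hom C (X \<otimes> Dom C v) L" if "v \<in> carrier P" for v
        using matching_arr[OF c that] sub[OF that] unbraid[of "Dom C v" X] X by (simp add: arr_Hom)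
      fix v v' assume v: "v \<in> carrier P" "v' \<in> carrier P" "v \<sqsubseteq>\<^bsub>P\<^esub> v'"
      then have vv': "v \<preceq> v'" using le by blast
      note h = sub[OF v(1)] sub[OF v(2)] vv' matching_arr[OF c v(1)] matching_arr[OF c v(2)]
        unbraid[of "Dom C v" X] unbraid[of "Dom C v'" X]
      have "(c v' \<cdot> ?u v') \<cdot> (Id C X \<star> incl C v v') = c v' \<cdot> (incl C v v' \<star> Id C X) \<cdot> ?u v"
        using unbraid_nat[of "incl C v v'" X] h X by simp
      also have "\<dots> = c v \<cdot> ?u v"
        using h X by (intro comp_tail matching_le[OF c X v(1,2)]) simp_all
      finally show "(c v' \<cdot> ?u v') \<cdot> (Id C X \<star> incl C v v') = c v \<cdot> ?u v" .
    qed
    then obtain w where w: "w \<in> Arr C" "Dom C w = X \<otimes> ?M" "Cod C w = L"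
      "\<And>v. v \<in> carrier P \<Longrightarrow> w \<cdot> (Id C X \<star> incl C v m) = c v \<cdot> ?u v"
      using colimit_glue[OF col[OF X]] by (auto simp: tensor_diagram_def family_diagram_def)
    have "(w \<cdot> Braid C ?M X) \<cdot> (incl C v m \<star> Id C X) = c v" if v: "v \<in> carrier P" for v
    proof -
      note h = sub[OF v] m(2)[OF v] matching_arr[OF c v] unbraid[of "Dom C v" X]
      have "(w \<cdot> Braid C ?M X) \<cdot> (incl C v m \<star> Id C X) = w \<cdot> (Id C X \<star> incl C v m) \<cdot> Braid C (Dom C v) X"
        using braid_nat[of "incl C v m" "Id C X"] w(1-3) h X m(1) by simp
      also have "\<dots> = (c v \<cdot> ?u v) \<cdot> Braid C (Dom C v) X"
        using w(1-3) h X m(1) by (intro comp_tail w(4) v) simp_all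
      also have "\<dots> = c v" using h X by simp
      finally show ?thesis .
    qed
    then show ?thesis using w(1-3) M X by (intro exI[of _ "w \<cdot> Braid C ?M X"]) simp
  qed
  show "w = w'"
    if X: "X \<in> Obj C" and w: "w \<in> Arr C" "w' \<in> Arr C" "Dom C w = ?M \<otimes> X" "Dom C w' = ?M \<otimes> X"
      "Cod C w = Cod C w'" and eq: "\<forall>a\<in>carrier P. w \<cdot> (incl C a m \<star> Id C X) = w' \<cdot> (incl C a m \<star> Id C X)" for X w w'
  proof -
    let ?u = "Inv C (Braid C ?M X)"
    note u = unbraid[OF M X]
    have "w \<cdot> ?u = w' \<cdot> ?u"
    proof (rule colimit_ext[OF col[OF X] _ _ _ _ _ tensor_family_edge[OF fam X]])
      fix v assume "v \<in> Node (tensor_diagram C X (family_diagram C P (\<lambda>v. v)))"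
      then have v: "v \<in> carrier P" by (simp add: tensor_diagram_def family_diagram_def)
      note h = sub[OF v] m(2)[OF v] unbraid[of "Dom C v" X]
      have "(w \<cdot> (incl C v m \<star> Id C X)) \<cdot> Inv C (Braid C (Dom C v) X)
          = (w' \<cdot> (incl C v m \<star> Id C X)) \<cdot> Inv C (Braid C (Dom C v) X)"
        using eq v by simp
      then show "(w \<cdot> ?u) \<cdot> (Id C X \<star> incl C v m) = (w' \<cdot> ?u) \<cdot> (Id C X \<star> incl C v m)"
        using unbraid_nat[of "incl C v m" X] w u h X m(1) by simp
    qed (use w u in simp_all)
    then have "(w \<cdot> ?u) \<cdot> Braid C ?M X = (w' \<cdot> ?u) \<cdot> Braid C ?M X" by simp
    then show ?thesis using w u M X by simp
  qed
qed (rule m(1))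

lemma universal_directed_joinsD:
  fixes P :: "'i gorder"
  assumes uj: "universal_directed_joins TYPE('i) C" and "partial_order P" "directed P (carrier P)" "subunit_family C P s"
  shows "\<exists>L c. is_colimit C (family_diagram C P s) L c"
    and "is_colimit C (family_diagram C P s) L c \<Longrightarrow>
      \<exists>m\<in>Hom C L (Unit C). (\<forall>i\<in>carrier P. m \<cdot> c i = s i) \<and> subunit C m"
    and "\<lbrakk>is_colimit C (family_diagram C P s) L c; X \<in> Obj C\<rbrakk> \<Longrightarrow>
      is_colimit C (tensor_diagram C X (family_diagram C P s)) (X \<otimes> L) (\<lambda>i. Id C X \<star> c i)"
proof -
  note * = mp[OF spec[OF spec[OF conjunct2[OF uj[unfolded universal_directed_joins_def]], of P], of s],
      OF conjI[OF assms(2) conjI[OF assms(3,4)]]]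
  show "\<exists>L c. is_colimit C (family_diagram C P s) L c" by (rule conjunct1[OF *])
  assume Lc: "is_colimit C (family_diagram C P s) L c"
  note ** = mp[OF spec[OF spec[OF conjunct2[OF *]]] Lc]
  show "\<exists>m\<in>Hom C L (Unit C). (\<forall>i\<in>carrier P. m \<cdot> c i = s i) \<and> subunit C m"
    by (rule conjunct1[OF **])
  show "is_colimit C (tensor_diagram C X (family_diagram C P s)) (X \<otimes> L) (\<lambda>i. Id C X \<star> c i)" if "X \<in> Obj C"
    using conjunct2[OF **] that by (rule bspec)
qed

text \<open>
A set of subunits, being ordered up to equality of subobjects only, becomes an index poset after choosing
one representative of each subobject; the representatives generate the same downset.
\<close>

lemma covers_if_universal_directed_joins:
  assumes uj: "universal_directed_joins TYPE('b) C"
    and U: "U \<subseteq> carrier (ISub C)" "directed (ISub C) U"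
  shows "\<exists>j. covers U j"
proof -
  have sU: "subunit C u" if "u \<in> U" for u using U(1) that by auto
  \<comment> \<open>\<open>rep\<close> depends only on the subobject, because equal subobjects offer the same candidates\<close>
  define rep where "rep u = (SOME v. v \<in> U \<and> u \<preceq> v \<and> v \<preceq> u)" for u
  have rep: "rep u \<in> U \<and> u \<preceq> rep u \<and> rep u \<preceq> u" if "u \<in> U" for u
    unfolding rep_def by (rule someI_ex) (use that sU sub_le_refl in blast)
  have rep_cong: "rep u = rep v" if "u \<in> U" "v \<in> U" "u \<preceq> v" "v \<preceq> u" for u v
  proof -
    have "(\<lambda>x. x \<in> U \<and> u \<preceq> x \<and> x \<preceq> u) = (\<lambda>x. x \<in> U \<and> v \<preceq> x \<and> x \<preceq> v)"
      using that sU sub_le_trans by blast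
    then show ?thesis by (simp add: rep_def)
  qed
  define V where "V = rep ` U"
  have V: "V \<subseteq> U" using rep by (auto simp: V_def)
  have sV: "subunit C v" if "v \<in> V" for v using sU V that by blast
  have anti: "v = v'" if "v \<in> V" "v' \<in> V" "v \<preceq> v'" "v' \<preceq> v" for v v'
  proof -
    obtain u u' where u: "u \<in> U" "v = rep u" "u' \<in> U" "v' = rep u'" using \<open>v \<in> V\<close> \<open>v' \<in> V\<close> by (auto simp: V_def)
    have "v = rep v" "v' = rep v'" using rep_cong[of u v] rep_cong[of u' v'] rep[of u] rep[of u'] u by auto
    moreover have "rep v = rep v'" using that V by (intro rep_cong) auto
    ultimately show ?thesis by simp
  qed
  define P :: "'b gorder" where "P = \<lparr>carrier = V, eq = (=), le = (\<lambda>a b. a \<preceq> b)\<rparr>"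
  have P: "carrier P = V" "\<And>a b. a \<sqsubseteq>\<^bsub>P\<^esub> b \<longleftrightarrow> a \<preceq> b" "\<And>a b. a .=\<^bsub>P\<^esub> b \<longleftrightarrow> a = b"
    by (simp_all add: P_def)
  have refl: "v \<preceq> v" if "v \<in> V" for v using sV[OF that] by (rule sub_le_refl)
  have trans: "a \<preceq> c" if "a \<preceq> b" "b \<preceq> c" "b \<in> V" "c \<in> V" for a b c
    using sub_le_trans[OF sV[OF that(3)] sV[OF that(4)] that(1,2)] .
  have po: "partial_order P"
    by (unfold_locales; simp add: P fun_eq_iff; (blast intro: anti refl trans)?)
  have dir: "directed P (carrier P)"
    unfolding directed_def
  proof (intro ballI)
    fix a b assume "a \<in> carrier P" "b \<in> carrier P"
    then have ab: "a \<in> V" "b \<in> V" by (simp_all add: P)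
    then obtain c where c: "c \<in> U" "a \<preceq> c" "b \<preceq> c" using U(2) V unfolding directed_def by blast
    have "a \<preceq> rep c" "b \<preceq> rep c" using c rep[OF c(1)] sU sub_le_trans by blast+
    then show "\<exists>c\<in>carrier P. a \<sqsubseteq>\<^bsub>P\<^esub> c \<and> b \<sqsubseteq>\<^bsub>P\<^esub> c"
      using c(1) by (auto simp: P V_def)
  qed
  have fam: "subunit_family C P (\<lambda>v. v)" using sV by (simp add: subunit_family_def P)
  note uj = universal_directed_joinsD[OF uj po dir fam]
  obtain L c where Lc: "is_colimit C (family_diagram C P (\<lambda>v. v)) L c"
    using uj(1) by blast
  obtain m where m: "m \<in> Hom C L (Unit C)" "\<forall>v\<in>carrier P. m \<cdot> c v = v" "subunit C m"
    using uj(2)[OF Lc] by blast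
  note colX = uj(3)[OF Lc]
  have mL: "Dom C m = L" using m(1) by (simp add: arr_Hom)
  have c: "c v \<in> Arr C" "Dom C (c v) = Dom C v" "Cod C (c v) = L" "m \<cdot> c v = v" if "v \<in> V" for v
    using cocone_arr[OF colimit_cocone[OF Lc], of v] m(2) that by (simp_all add: family_diagram_def P)
  have le: "v \<preceq> m" and incl: "incl C v m = c v" if "v \<in> V" for v
    using c[OF that] mL by (auto intro: sub_leI incl_unique[OF subunit_monic[OF m(3)]])
  have "covers (carrier P) m"
  proof (rule covers_if_tensor_colimit[OF fam m(3)])
    show "is_colimit C (tensor_diagram C X (family_diagram C P (\<lambda>v. v))) (X \<otimes> Dom C m) (\<lambda>v. Id C X \<star> incl C v m)"
      if X: "X \<in> Obj C" for X
      by (rule colimit_transport[OF colX[OF X] iso_Id[of "X \<otimes> L"] _ _ _ tensor_family_edge[OF fam X]])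
        (use X mL m(3) incl c Obj_Dom[of m] in \<open>simp_all add: tensor_diagram_def family_diagram_def P\<close>)
  qed (use le in \<open>simp_all add: P\<close>)
  moreover have "\<exists>v\<in>V. u \<preceq> v" if "u \<in> U" for u using rep[OF that] that by (auto simp: V_def)
  ultimately show ?thesis using covers_cofinal[OF V sU, of m] by (auto simp: P)
qed

end

section \<open>The characterisation by colimits\<close>

theorem theorem8p4:
  fixes C :: "('o, 'a) braided_data"
  assumes "stiff_category C"
  shows
    "(universal_joins C \<longleftrightarrow>
        (\<forall>U\<subseteq>carrier (ISub C). meet_idempotent C U \<longrightarrow> colimit_conditions C U)) \<and>
     (universal_finite_joins C \<longleftrightarrow>
        (\<forall>U\<subseteq>carrier (ISub C). meet_idempotent C U \<and> finitely_bounded (ISub C) U \<longrightarrow>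
           colimit_conditions C U)) \<and>
     (universal_directed_joins TYPE('a) C \<longleftrightarrow>
        (\<forall>U\<subseteq>carrier (ISub C). meet_idempotent C U \<and> directed (ISub C) U \<longrightarrow>
           colimit_conditions C U)) \<and>
     (universal_directed_joins TYPE('a) C \<longrightarrow> universal_directed_joins TYPE('i) C)"
proof -
  interpret stiff_category C by (rule assms)
  have iff: "colimit_conditions C U \<longleftrightarrow> (\<exists>j. covers U j)"
    if "U \<subseteq> carrier (ISub C)" "meet_idempotent C U" for U
    by (rule colimit_conditions_iff_covers) (use that in auto)
  let ?D = "\<forall>U\<subseteq>carrier (ISub C). meet_idempotent C U \<and> directed (ISub C) U \<longrightarrow> (\<exists>j. covers U j)"
  have dir: "?D" if "universal_directed_joins TYPE('a) C"
    using covers_if_universal_directed_joins[OF that] by blast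
  have "universal_directed_joins TYPE('a) C \<longleftrightarrow> ?D"
    using dir universal_directed_joins_if_covers by blast
  moreover have "universal_directed_joins TYPE('i) C" if "universal_directed_joins TYPE('a) C"
    by (rule universal_directed_joins_if_covers[OF dir[OF that]])
  ultimately show ?thesis
    unfolding universal_joins_iff_covers universal_finite_joins_iff_covers using iff by blast
qed

end
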